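(* Let $1\le x\le q$ be given. For all but at most $q^{1-\frac{1}{\log x}}$ characters $\chi \pmod q$ we have $$\sum_{n\le x}\chi(n)=\Psi(x,y;\chi)+O\left(\frac{\Psi(x,y)}{(\log\log q)^2}\right)\quad\text{whenever } y\ge \log q\,\log x\,(\log\log q)^5.$$ For all but at most $q^{1-\frac{1}{(\log\log q)^2}}$ characters $\chi \pmod q$ we have $$\left|\sum_{n\le x}\chi(n)\right|\le \Psi\left(x,(\log q+\log^2 x)(\log\log q)^5\right).$$
   Context: $\chi$ runs over Dirichlet characters modulo $q$ ($q$ large). For an arithmetic function $f$, $\Psi(x,y;f)=\sum_{n\le x,\ p\mid n\Rightarrow p\le y} f(n)$ (sum over positive integers $n\le x$ all of whose prime factors are at most $y$), and $\Psi(x,y)=\Psi(x,y;1)$ is the number of such integers. The implied constant in $O(\cdot)$ is absolute. *)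

theory Defs
  imports "HOL-Analysis.Analysis" "HOL-Number_Theory.Number_Theory"
begin

(* Dirichlet characters modulo q: completely multiplicative, q-periodic, and supported exactly
   on the integers coprime to q.  (\<xi> 1 = 1 follows from \<xi> 1 = (\<xi> 1)^2 and \<xi> 1 \<noteq> 0.) *)
definition dirichlet_characters :: "nat \<Rightarrow> (nat \<Rightarrow> complex) set" where
  "dirichlet_characters q =
     {\<xi>. (\<forall>m n. \<xi> (m * n) = \<xi> m * \<xi> n) \<and>
          (\<forall>n. \<xi> (n + q) = \<xi> n) \<and>
          (\<forall>n. \<xi> n \<noteq> 0 \<longleftrightarrow> coprime n q)}"

definition smooth_upto :: "real \<Rightarrow> real \<Rightarrow> nat set" where
  "smooth_upto x y =
     {n. 0 < n \<and> real n \<le> x \<and> (\<forall>p. prime p \<and> p dvd n \<longrightarrow> real p \<le> y)}"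

definition Psi_sum :: "real \<Rightarrow> real \<Rightarrow> (nat \<Rightarrow> 'a :: comm_monoid_add) \<Rightarrow> 'a" where
  "Psi_sum x y f = (\<Sum>n\<in>smooth_upto x y. f n)"

definition Psi :: "real \<Rightarrow> real \<Rightarrow> real" where
  "Psi x y = Psi_sum x y (\<lambda>_. 1)"

lemma finite_smooth_upto: "finite (smooth_upto x y)"
proof (rule finite_subset)
  show "smooth_upto x y \<subseteq> {..nat \<lfloor>x\<rfloor>}"
    by (auto simp: smooth_upto_def le_nat_floor)
qed auto

(* Sets of characters are finite, so that card counts them genuinely. *)
lemma finite_dirichlet_characters:
  assumes "q > 0"
  shows "finite (dirichlet_characters q)"
proof -
  define R where "R = insert 0 {z :: complex. z ^ totient q = 1}"
  have per: "\<xi> n = \<xi> (n mod q)" if "\<xi> \<in> dirichlet_characters q" for \<xi> n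
  proof -
    have "\<xi> (m + k * q) = \<xi> m" for m k
    proof (induction k)
      case (Suc k)
      have "\<xi> (m + Suc k * q) = \<xi> ((m + k * q) + q)"
        by (simp add: algebra_simps)
      with Suc that show ?case
        unfolding dirichlet_characters_def by simp
    qed simp
    from this[of "n mod q" "n div q"] show ?thesis
      by simp
  qed
  have val: "\<xi> n \<in> R" if \<xi>: "\<xi> \<in> dirichlet_characters q" for \<xi> n
  proof (cases "coprime n q")
    case True
    have mult: "\<xi> (m * k) = \<xi> m * \<xi> k" for m k
      using \<xi> by (simp add: dirichlet_characters_def)
    have "\<xi> 1 \<noteq> 0"
      using \<xi> by (simp add: dirichlet_characters_def)
    then have one: "\<xi> 1 = 1"
      using mult[of 1 1] by simp
    have pow: "\<xi> (n ^ k) = \<xi> n ^ k" for k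
      by (induction k) (use one mult in simp_all)
    have "[n ^ totient q = 1] (mod q)"
      using True by (rule euler_theorem)
    then have "\<xi> (n ^ totient q) = \<xi> 1"
      using per[OF \<xi>] by (metis cong_def)
    then show ?thesis
      using pow one by (simp add: R_def)
  next
    case False
    then show ?thesis
      using \<xi> unfolding R_def dirichlet_characters_def by blast
  qed
  have "finite R"
    using finite_roots_unity[of "totient q", where ?'a = complex] assms by (simp add: R_def Suc_le_eq)
  then have "finite (PiE {..<q} (\<lambda>_. R))"
    by (intro finite_PiE) auto
  moreover have "(\<lambda>\<xi>. restrict \<xi> {..<q}) ` dirichlet_characters q \<subseteq> PiE {..<q} (\<lambda>_. R)"
    using val by (auto simp: restrict_def split: if_splits)
  ultimately have "finite ((\<lambda>\<xi>. restrict \<xi> {..<q}) ` dirichlet_characters q)"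
    by (rule finite_subset[rotated])
  moreover have "inj_on (\<lambda>\<xi>. restrict \<xi> {..<q}) (dirichlet_characters q)"
  proof (intro inj_onI ext)
    fix \<xi> \<psi> n
    assume *: "\<xi> \<in> dirichlet_characters q" "\<psi> \<in> dirichlet_characters q"
      "restrict \<xi> {..<q} = restrict \<psi> {..<q}"
    have "\<xi> (n mod q) = \<psi> (n mod q)"
      using fun_cong[OF *(3), of "n mod q"] assms by simp
    with per[OF *(1)] per[OF *(2)] show "\<xi> n = \<psi> n"
      by metis
  qed
  ultimately show ?thesis
    by (rule finite_imageD)
qed

end

theory Submission
  imports Defs "HOL-Real_Asymp.Real_Asymp"
begin

text \<open>
  Write \<open>L = ln (ln q)\<close>. The difference between the full sum and the sum over \<open>y\<close>-smooth numbers is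
  a sum over \<open>n \<le> x\<close> with a rough part \<open>d > 1\<close>, a product of primes above \<open>y\<close>. Its
  \<open>2k\<close>-th moment over the characters, with \<open>x\<^sup>k \<le> q\<close>, is at most \<open>q\<close> times the number of
  solutions of \<open>n\<^sub>1 \<cdots> n\<^sub>k = m\<^sub>1 \<cdots> m\<^sub>k\<close>. Grouping by rough parts reduces this to bounds for
  \<open>\<Psi>(x/d, y) / \<Psi>(x, y)\<close>.

  Comparing \<open>\<Sum> ln n\<close> over smooth \<open>n\<close> with its expansion over primes gives
  \<open>\<Psi>(x/z, y) \<le> (ln x / (c z)) \<Psi>(x, y)\<close> for \<open>z \<le> y\<close>. A second moment argument over the
  primes near \<open>d\<close> interpolates this to \<open>\<Psi>(x/d, y) \<le> A d\<^sup>-\<^sup>\<gamma> \<Psi>(x, y)\<close> with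
  \<open>\<gamma> = 1/2 + 3/(2 ln y)\<close>, which is enough because \<open>\<Sum> p\<^sup>-\<^sup>2\<^sup>\<gamma>\<close> then converges. No saddle point
  analysis is needed.

  For the first assertion the resulting bounds are combined over a grid of values of \<open>y\<close>. For the
  second one, the sharper truncation at \<open>Y / sqrt L\<close> is used: passing from there to \<open>Y\<close> multiplies
  \<open>\<Psi>\<close> by at least \<open>exp (G ln x / L\<^sup>2)\<close> with \<open>G\<close> of order \<open>ln L\<close>, which absorbs the error
  and the saving required in the exceptional set.
\<close>

section \<open>Sums over primes\<close>

text \<open>With L = ln ln q, the exponent 5 arises as follows. Every n that is not y-smooth has a
  rough part d with at least one prime factor, so its weight may be multiplied by lam^(Omega(d) - 1)
  with lam >= 1. In the moment this replaces \<Psi> by \<Psi> / lam, while the prime sum in the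
  exponent of the loss, of order ln q ln x ln y / y, grows by lam^2. A relative error 1 / L^2 asks
  for lam of order L^2, and ln y has order L near the lower end of the range: five powers of L in
  all. Two demands pull on \<gamma>: the sum of p^(-2 \<gamma>) over p > y must converge, so 2
  \<gamma> > 1, and y^(-\<gamma>) must still exceed the factor ln x / (c y) of one division by y.
  Moving \<gamma> away from 1/2 by a multiple of 1 / ln y changes y^\<gamma> by a constant only, so
  both hold once sqrt y is a large multiple of ln x; since ln x <= ln q, the ranges of both
  assertions provide this. A rough part with j prime factors allows j divisions by y, so the decay
  has a completely multiplicative majorant, and the moment is bounded by an Euler product.\<close>

lemma real_nat_floor_ge: "b - 1 \<le> real (nat \<lfloor>b\<rfloor>)"
  by linarith

definition primes_in :: "real \<Rightarrow> real \<Rightarrow> nat set" where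
  "primes_in a b = {p. prime p \<and> a < real p \<and> real p \<le> b}"

lemma finite_primes_in [simp]: "finite (primes_in a b)"
proof (rule finite_subset)
  show "primes_in a b \<subseteq> {..nat \<lfloor>b\<rfloor>}"
    by (auto simp: primes_in_def le_nat_floor)
qed auto

lemma primes_inD:
  assumes "p \<in> primes_in a b"
  shows "prime p" "a < real p" "real p \<le> b" "p \<ge> 2"
  using assms prime_ge_2_nat by (auto simp: primes_in_def)

text \<open>Distinct primes are pairwise coprime, so the product of those dividing \<open>m\<close>
  divides \<open>m\<close>.\<close>

lemma sum_ln_primes_dvd_le:
  assumes "finite P" "\<And>p. p \<in> P \<Longrightarrow> prime p" "m \<ge> (1::nat)"
  shows "(\<Sum>p\<in>{p\<in>P. p dvd m}. ln (real p)) \<le> ln (real m)"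
proof -
  have fin: "finite {p\<in>P. p dvd m}" using assms by auto
  have "(\<Prod>p\<in>{p\<in>P. p dvd m}. p) dvd m"
  proof -
    have "\<Prod>Q dvd m" if "finite Q" "Q \<subseteq> {p\<in>P. p dvd m}" for Q
      using that
    proof (induction Q rule: finite_induct)
      case (insert p Q)
      have "coprime p (\<Prod>Q)"
        using insert assms(2) by (intro prod_coprime_right primes_coprime) auto
      thus ?case using insert by (auto intro!: divides_mult)
    qed auto
    thus ?thesis using fin by blast
  qed
  hence "(\<Prod>p\<in>{p\<in>P. p dvd m}. p) \<le> m" using assms(3) by (simp add: dvd_imp_le)
  hence "real (\<Prod>p\<in>{p\<in>P. p dvd m}. p) \<le> real m" by (simp only: of_nat_le_iff)
  moreover have pos: "p > 0" if "p \<in> {p\<in>P. p dvd m}" for p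
    using that assms(2) prime_gt_0_nat by auto
  hence "real (\<Prod>p\<in>{p\<in>P. p dvd m}. p) > 0" 
    by (auto intro!: prod_pos)
  ultimately have "ln (real (\<Prod>p\<in>{p\<in>P. p dvd m}. p)) \<le> ln (real m)" by simp
  moreover have "ln (real (\<Prod>p\<in>{p\<in>P. p dvd m}. p)) = (\<Sum>p\<in>{p\<in>P. p dvd m}. ln (real p))"
    using pos by (subst of_nat_prod, subst ln_prod) (auto simp: fin)
  ultimately show ?thesis by simp
qed

text \<open>The identity ln m = sum of \<Lambda>(d) over d dividing m, with the prime powers written
  out. The cut at J loses nothing: p^j dividing m forces 2^j <= m < 2^(J+1).\<close>

lemma ln_eq_sum_prime_powers:
  assumes "finite P" "\<And>p. p \<in> P \<Longrightarrow> prime p" "m \<ge> (1::nat)"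
    "\<And>p. prime p \<Longrightarrow> p dvd m \<Longrightarrow> p \<in> P" "m < 2 ^ Suc J"
  shows "ln (real m) = (\<Sum>p\<in>P. \<Sum>j=1..J. if p ^ j dvd m then ln (real p) else 0)"
proof -
  have inner: "(\<Sum>j=1..J. if p ^ j dvd m then ln (real p) else 0) = real (multiplicity p m) * ln (real p)"
    if p: "p \<in> P" for p
  proof -
    have pp: "prime p" using assms p by auto
    have le: "multiplicity p m \<le> J"
    proof (rule ccontr)
      assume "\<not> ?thesis"
      hence "p ^ Suc J dvd m" by (metis multiplicity_dvd' not_less_eq_eq)
      hence "p ^ Suc J \<le> m" using assms(3) by (intro dvd_imp_le) auto
      moreover have "(2::nat) ^ Suc J \<le> p ^ Suc J" using prime_ge_2_nat[OF pp] by (intro power_mono) auto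
      ultimately show False using assms(5) by linarith
    qed
    have "{j\<in>{1..J}. p ^ j dvd m} = {1..multiplicity p m}"
    proof -
      have "p ^ j dvd m \<longleftrightarrow> j \<le> multiplicity p m" for j
        using assms(3) pp by (intro power_dvd_iff_le_multiplicity) auto
      thus ?thesis using le by (simp add: set_eq_iff) (metis le_trans)
    qed
    thus ?thesis
      by (simp add: sum.If_cases Int_def conj_commute)
  qed
  have "real m = (\<Prod>p\<in>prime_factors m. real (p ^ multiplicity p m))"
    using assms(3) arg_cong[OF prime_factorization_nat[of m], of real]
    unfolding of_nat_prod by simp
  hence "ln (real m) = ln (\<Prod>p\<in>prime_factors m. real (p ^ multiplicity p m))" by simp
  also have "\<dots> = (\<Sum>p\<in>prime_factors m. ln (real (p ^ multiplicity p m)))"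
    by (rule ln_prod) (auto simp: prime_factors_gt_0_nat)
  also have "\<dots> = (\<Sum>p\<in>prime_factors m. real (multiplicity p m) * ln (real p))"
    by (intro sum.cong refl) (auto simp: ln_realpow prime_factors_gt_0_nat)
  also have "\<dots> = (\<Sum>p\<in>P. real (multiplicity p m) * ln (real p))"
  proof (rule sum.mono_neutral_left)
    show "prime_factors m \<subseteq> P" using assms by (auto simp: in_prime_factors_iff)
    show "\<forall>i\<in>P - prime_factors m. real (multiplicity i m) * ln (real i) = 0"
      using assms by (auto simp: in_prime_factors_iff not_dvd_imp_multiplicity_0)
  qed (use assms in auto)
  finally show ?thesis using inner by simp
qed

text \<open>Chebyshev's theta function.\<close>

definition theta :: "real \<Rightarrow> real" where
  "theta z = (\<Sum>p\<in>primes_in 0 z. ln (real p))"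

lemma sum_ln_primes_in_nonneg: "(\<Sum>p\<in>primes_in a b. ln (real p)) \<ge> 0"
  by (intro sum_nonneg) (auto dest!: primes_inD)

lemma theta_mono: "a \<le> b \<Longrightarrow> theta a \<le> theta b"
  unfolding theta_def
  by (intro sum_mono2 finite_primes_in) (auto simp: primes_in_def intro!: ln_ge_zero dest: prime_ge_1_nat)

lemma theta_split:
  assumes "0 \<le> a" "a \<le> b"
  shows "theta b = theta a + (\<Sum>p\<in>primes_in a b. ln (real p))"
proof -
  have "primes_in 0 b = primes_in 0 a \<union> primes_in a b" "primes_in 0 a \<inter> primes_in a b = {}"
    using assms by (auto simp: primes_in_def)
  thus ?thesis unfolding theta_def by (simp add: sum.union_disjoint)
qed

section \<open>Counting smooth numbers\<close>

lemma Psi_eq_card: "Psi X y = real (card (smooth_upto X y))"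
  by (simp add: Psi_def Psi_sum_def)

lemma Psi_nonneg [simp]: "Psi X y \<ge> 0"
  by (simp add: Psi_eq_card)

lemma Psi_mono:
  assumes "X \<le> X'" "y \<le> y'"
  shows "Psi X y \<le> Psi X' y'"
  unfolding Psi_eq_card of_nat_le_iff
  by (rule card_mono[OF finite_smooth_upto]) (use assms in \<open>auto simp: smooth_upto_def intro: order_trans\<close>)

lemma Psi_eq_0:
  assumes "X < 1"
  shows "Psi X y = 0"
proof -
  have "smooth_upto X y = {}" using assms by (auto simp: smooth_upto_def)
  thus ?thesis by (simp add: Psi_eq_card)
qed

lemma divide_le_bound:
  fixes X x d :: real
  assumes "X \<le> x" "0 \<le> x" "d \<ge> 1"
  shows "X / d \<le> x"
proof -
  have "X / d \<le> x / d" using assms by (intro divide_right_mono) auto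
  also have "\<dots> \<le> x / 1" using assms by (intro divide_left_mono) auto
  finally show ?thesis by simp
qed

lemma Psi_div_le:
  assumes "d \<ge> 1"
  shows "Psi (X / d) y \<le> Psi X y"
proof (cases "X \<ge> 0")
  case True
  thus ?thesis using assms by (intro Psi_mono divide_le_bound) auto
next
  case False
  hence "X / d \<le> 0" using assms by (simp add: divide_le_0_iff)
  thus ?thesis by (simp add: Psi_eq_0)
qed

lemma Psi_ge_1:
  assumes "X \<ge> 1"
  shows "Psi X y \<ge> 1"
proof -
  have "{1} \<subseteq> smooth_upto X y" using assms not_prime_unit by (auto simp: smooth_upto_def)
  hence "card {1::nat} \<le> card (smooth_upto X y)" by (rule card_mono[OF finite_smooth_upto])
  thus ?thesis by (simp add: Psi_eq_card)
qed

lemma Psi_le: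
  assumes "X \<ge> 0"
  shows "Psi X y \<le> X"
proof -
  have "smooth_upto X y \<subseteq> {1..nat \<lfloor>X\<rfloor>}" by (auto simp: smooth_upto_def le_nat_floor)
  hence "card (smooth_upto X y) \<le> nat \<lfloor>X\<rfloor>" using card_mono[of "{1..nat \<lfloor>X\<rfloor>}"] by fastforce
  thus ?thesis using assms by (simp add: Psi_eq_card le_nat_iff le_floor_iff)
qed

lemma smooth_upto_eq_all:
  assumes "0 \<le> X" "X \<le> y"
  shows "smooth_upto X y = {1..nat \<lfloor>X\<rfloor>}"
proof -
  have sm: "real p \<le> y" if "0 < n" "real n \<le> X" "p dvd n" for n p
  proof -
    have "real p \<le> real n" using that dvd_imp_le by auto
    thus ?thesis using that assms by linarith
  qed
  have "n \<in> smooth_upto X y \<longleftrightarrow> n \<in> {1..nat \<lfloor>X\<rfloor>}" for n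
    using sm[of n] assms by (auto simp: smooth_upto_def le_nat_iff le_floor_iff)
  thus ?thesis by blast
qed

lemma Psi_ge_half:
  assumes "1 \<le> X" "X \<le> y"
  shows "Psi X y \<ge> X / 2"
proof -
  have "Psi X y = real (nat \<lfloor>X\<rfloor>)" using assms by (simp add: Psi_eq_card smooth_upto_eq_all)
  moreover have "1 \<le> real (nat \<lfloor>X\<rfloor>)" using assms by simp
  ultimately show ?thesis using real_nat_floor_ge[of X] by simp
qed

lemma card_smooth_multiples:
  assumes "a > 0" "\<And>p. prime p \<Longrightarrow> p dvd a \<Longrightarrow> real p \<le> y"
  shows "real (card {n\<in>smooth_upto X y. a dvd n}) = Psi (X / real a) y"
proof -
  have "{n\<in>smooth_upto X y. a dvd n} = (\<lambda>m. a * m) ` smooth_upto (X / real a) y"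
  proof (intro equalityI subsetI)
    fix n assume n: "n \<in> {n\<in>smooth_upto X y. a dvd n}"
    then obtain m where "n = a * m" by auto
    thus "n \<in> (\<lambda>m. a * m) ` smooth_upto (X / real a) y"
      using n assms(1) by (auto simp: smooth_upto_def field_simps intro!: image_eqI[of _ _ m])
  next
    fix n assume n: "n \<in> (\<lambda>m. a * m) ` smooth_upto (X / real a) y"
    then obtain m where m: "n = a * m" "m \<in> smooth_upto (X / real a) y" by auto
    thus "n \<in> {n\<in>smooth_upto X y. a dvd n}"
      using assms by (auto simp: smooth_upto_def field_simps prime_dvd_mult_iff)
  qed
  moreover have "inj_on (\<lambda>m. a * m) (smooth_upto (X / real a) y)" using assms by (auto simp: inj_on_def)
  ultimately show ?thesis by (simp add: card_image Psi_eq_card)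
qed

lemma card_smooth_prime_power_multiples:
  assumes "prime p" "real p \<le> y"
  shows "real (card {n\<in>smooth_upto X y. p ^ j dvd n}) = Psi (X / real p ^ j) y"
proof -
  have "real r \<le> y" if "prime r" "r dvd p ^ j" for r
    using prime_dvd_power[OF that] primes_dvd_imp_eq[OF that(1) assms(1)] assms by auto
  thus ?thesis using card_smooth_multiples[of "p ^ j" y X] assms by (auto simp: prime_gt_0_nat)
qed

lemma sum_weights_smooth_multiples:
  assumes "finite P" "\<And>p. p \<in> P \<Longrightarrow> prime p \<and> real p \<le> y"
  shows "(\<Sum>n\<in>smooth_upto X y. \<Sum>p\<in>{p\<in>P. p dvd n}. w p) = (\<Sum>p\<in>P. w p * Psi (X / real p) y)"
proof -
  have "(\<Sum>n\<in>smooth_upto X y. \<Sum>p\<in>{p\<in>P. p dvd n}. w p) =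
        (\<Sum>n\<in>smooth_upto X y. \<Sum>p\<in>P. if p dvd n then w p else 0)"
    using assms by (simp add: sum.If_cases Int_def conj_commute)
  also have "\<dots> = (\<Sum>p\<in>P. \<Sum>n\<in>smooth_upto X y. if p dvd n then w p else 0)"
    by (rule sum.swap)
  also have "\<dots> = (\<Sum>p\<in>P. w p * Psi (X / real p) y)"
  proof (rule sum.cong[OF refl])
    fix p assume "p \<in> P"
    thus "(\<Sum>n\<in>smooth_upto X y. if p dvd n then w p else 0) = w p * Psi (X / real p) y"
      using card_smooth_prime_power_multiples[of p y X 1] assms(2)[of p]
      by (simp add: sum.If_cases Int_def conj_commute finite_smooth_upto)
  qed
  finally show ?thesis .
qed

lemma ln_le_of_smooth:
  assumes "n \<in> smooth_upto X y"
  shows "ln (real n) \<le> ln X"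
  using assms by (auto simp: smooth_upto_def)

text \<open>Pairs of a smooth n and a prime p <= z dividing it are counted in two ways; seen from n,
  the logarithms of its distinct primes add up to at most ln n.\<close>

lemma sum_ln_Psi_le:
  assumes "z \<le> y" "X \<ge> 1"
  shows "(\<Sum>p\<in>primes_in 0 z. ln (real p) * Psi (X / real p) y) \<le> ln X * Psi X y"
proof -
  have "(\<Sum>p\<in>primes_in 0 z. ln (real p) * Psi (X / real p) y) =
      (\<Sum>n\<in>smooth_upto X y. \<Sum>p\<in>{p\<in>primes_in 0 z. p dvd n}. ln (real p))"
    using assms by (intro sum_weights_smooth_multiples[symmetric]) (auto dest: primes_inD)
  also have "\<dots> \<le> (\<Sum>n\<in>smooth_upto X y. ln X)"
  proof (rule sum_mono)
    fix n assume n: "n \<in> smooth_upto X y"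
    have "(\<Sum>p\<in>{p\<in>primes_in 0 z. p dvd n}. ln (real p)) \<le> ln (real n)"
      using n by (intro sum_ln_primes_dvd_le) (auto dest: primes_inD simp: smooth_upto_def)
    also have "\<dots> \<le> ln X" by (rule ln_le_of_smooth[OF n])
    finally show "(\<Sum>p\<in>{p\<in>primes_in 0 z. p dvd n}. ln (real p)) \<le> ln X" .
  qed
  also have "\<dots> = ln X * Psi X y" by (simp add: Psi_eq_card)
  finally show ?thesis .
qed

text \<open>The source of all decay: once theta z >= c z, dividing X by z multiplies \<Psi> by at
  most ln X / (c z). Replacing each prime p <= z by z itself only shrinks the argument X /
  p.\<close>

lemma theta_Psi_le:
  assumes "z \<le> y" "z > 0" "X \<ge> 1"
  shows "theta z * Psi (X / z) y \<le> ln X * Psi X y"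
proof -
  have "theta z * Psi (X / z) y = (\<Sum>p\<in>primes_in 0 z. ln (real p) * Psi (X / z) y)"
    by (simp add: theta_def sum_distrib_right)
  also have "\<dots> \<le> (\<Sum>p\<in>primes_in 0 z. ln (real p) * Psi (X / real p) y)"
  proof (intro sum_mono mult_left_mono Psi_mono divide_left_mono)
    fix p assume "p \<in> primes_in 0 z"
    hence p: "p \<ge> 2" "real p \<le> z" by (auto dest: primes_inD)
    show "real p \<le> z" "0 \<le> ln (real p)" using p by auto
    show "0 < z * real p" using p assms by (intro mult_pos_pos) auto
  qed (use assms in auto)
  also have "\<dots> \<le> ln X * Psi X y" using assms by (intro sum_ln_Psi_le) auto
  finally show ?thesis .
qed

text \<open>The von Mangoldt expansion of ln n summed over smooth n, where the multiples of p^j are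
  counted by \<Psi>(X / p^j, y). It plays the part of Hildebrand's identity in the growth
  estimates.\<close>

lemma sum_ln_smooth:
  assumes "X < 2 ^ Suc J"
  shows "(\<Sum>n\<in>smooth_upto X y. ln (real n)) =
         (\<Sum>p\<in>primes_in 0 y. \<Sum>j=1..J. ln (real p) * Psi (X / real p ^ j) y)"
proof -
  have "(\<Sum>n\<in>smooth_upto X y. ln (real n)) =
        (\<Sum>n\<in>smooth_upto X y. \<Sum>p\<in>primes_in 0 y. \<Sum>j=1..J. if p ^ j dvd n then ln (real p) else 0)"
  proof (intro sum.cong refl ln_eq_sum_prime_powers)
    fix n assume n: "n \<in> smooth_upto X y"
    have "real n < real (2 ^ Suc J)" using n assms by (auto simp: smooth_upto_def)
    thus "n < 2 ^ Suc J" by (simp only: of_nat_less_iff)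
    show "\<And>p. prime p \<Longrightarrow> p dvd n \<Longrightarrow> p \<in> primes_in 0 y"
      using n by (auto simp: smooth_upto_def primes_in_def prime_gt_0_nat)
  qed (auto dest: primes_inD simp: smooth_upto_def)
  also have "\<dots> = (\<Sum>p\<in>primes_in 0 y. \<Sum>n\<in>smooth_upto X y. \<Sum>j=1..J. if p ^ j dvd n then ln (real p) else 0)"
    by (rule sum.swap)
  also have "\<dots> = (\<Sum>p\<in>primes_in 0 y. \<Sum>j=1..J. \<Sum>n\<in>smooth_upto X y. if p ^ j dvd n then ln (real p) else 0)"
    by (rule sum.cong[OF refl], rule sum.swap)
  also have "\<dots> = (\<Sum>p\<in>primes_in 0 y. \<Sum>j=1..J. ln (real p) * Psi (X / real p ^ j) y)"
  proof (intro sum.cong refl)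
    fix p j assume "p \<in> primes_in 0 y"
    thus "(\<Sum>n\<in>smooth_upto X y. if p ^ j dvd n then ln (real p) else 0) = ln (real p) * Psi (X / real p ^ j) y"
      using card_smooth_prime_power_multiples[of p y X j]
      by (simp add: sum.If_cases Int_def conj_commute finite_smooth_upto primes_in_def)
  qed
  finally show ?thesis .
qed

text \<open>Cauchy-Schwarz for W(n), the sum of ln p over the primes of the window dividing n. The
  sum of W is at least V \<Psi>(X / d, y). In the sum of squares, distinct p and r force a divisor
  pr > (d / K)^2, and the diagonal forces p > d / K. So decay at d is tied to decay at about
  d^2.\<close>

lemma Psi_second_moment:
  fixes d K X y :: real
  assumes "d > 0" "K > 0" "d \<le> y" "X \<ge> 0"
  defines "V \<equiv> (\<Sum>p\<in>primes_in (d / K) d. ln (real p))"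
  shows "(V * Psi (X / d) y)\<^sup>2 \<le>
           Psi X y * (V\<^sup>2 * Psi (X * K\<^sup>2 / d\<^sup>2) y + V * ln d * Psi (X * K / d) y)"
proof -
  define P where "P = primes_in (d / K) d"
  define S where "S = smooth_upto X y"
  define W where "W n = (\<Sum>p\<in>{p\<in>P. p dvd n}. ln (real p))" for n
  have P: "prime p" "real p \<le> y" "d / K < real p" "real p \<le> d" "p \<ge> 2" if "p \<in> P" for p
    using primes_inD[OF that[unfolded P_def]] assms(3) by auto
  have finP: "finite P" by (simp add: P_def)
  have "V * Psi (X / d) y = (\<Sum>p\<in>P. ln (real p) * Psi (X / d) y)"
    by (simp add: V_def sum_distrib_right P_def)
  also have "\<dots> \<le> (\<Sum>p\<in>P. ln (real p) * Psi (X / real p) y)"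
  proof (intro sum_mono mult_left_mono Psi_mono divide_left_mono)
    fix p assume "p \<in> P"
    hence p: "p \<ge> 2" "real p \<le> d" using P by auto
    show "real p \<le> d" "0 \<le> ln (real p)" using p by auto
    show "0 < d * real p" using p assms by (intro mult_pos_pos) auto
  qed (use assms in auto)
  also have "\<dots> = (\<Sum>n\<in>S. W n)" unfolding W_def S_def
    using P finP by (intro sum_weights_smooth_multiples[symmetric]) auto
  finally have "V * Psi (X / d) y \<le> (\<Sum>n\<in>S. W n)" .
  moreover have "V \<ge> 0" unfolding V_def by (rule sum_ln_primes_in_nonneg)
  ultimately have "(V * Psi (X / d) y)\<^sup>2 \<le> (\<Sum>n\<in>S. 1 * W n)\<^sup>2" by (intro power_mono) auto
  also have "\<dots> \<le> (\<Sum>n\<in>S. 1\<^sup>2) * (\<Sum>n\<in>S. (W n)\<^sup>2)" by (rule Cauchy_Schwarz_ineq_sum)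
  also have "(\<Sum>n\<in>S. 1\<^sup>2) = Psi X y" by (simp add: S_def Psi_eq_card)
  also have "(\<Sum>n\<in>S. (W n)\<^sup>2) \<le> V\<^sup>2 * Psi (X * K\<^sup>2 / d\<^sup>2) y + V * ln d * Psi (X * K / d) y"
  proof -
    have "(W n)\<^sup>2 = (\<Sum>p\<in>P. \<Sum>r\<in>P. if p dvd n \<and> r dvd n then ln (real p) * ln (real r) else 0)" for n
    proof -
      have "W n = (\<Sum>p\<in>P. if p dvd n then ln (real p) else 0)"
        using finP by (simp add: W_def sum.If_cases Int_def conj_commute)
      thus ?thesis unfolding power2_eq_square
        by (simp only: sum_product) (intro sum.cong refl, auto)
    qed
    hence "(\<Sum>n\<in>S. (W n)\<^sup>2) = (\<Sum>n\<in>S. \<Sum>p\<in>P. \<Sum>r\<in>P. if p dvd n \<and> r dvd n then ln (real p) * ln (real r) else 0)"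
      by (intro sum.cong refl)
    also have "\<dots> = (\<Sum>p\<in>P. \<Sum>n\<in>S. \<Sum>r\<in>P. if p dvd n \<and> r dvd n then ln (real p) * ln (real r) else 0)"
      by (rule sum.swap)
    also have "\<dots> = (\<Sum>p\<in>P. \<Sum>r\<in>P. \<Sum>n\<in>S. if p dvd n \<and> r dvd n then ln (real p) * ln (real r) else 0)"
      by (rule sum.cong[OF refl], rule sum.swap)
    also have "\<dots> \<le> (\<Sum>p\<in>P. \<Sum>r\<in>P. ln (real p) * ln (real r) * Psi (X * K\<^sup>2 / d\<^sup>2) y +
                       (if r = p then ln (real p) * ln d * Psi (X * K / d) y else 0))"
    proof (intro sum_mono)
      fix p r assume pr: "p \<in> P" "r \<in> P"
      have ln: "0 \<le> ln (real p)" "0 \<le> ln (real r)" "ln (real p) \<le> ln d" using P(4,5)[OF pr(1)] P(5)[OF pr(2)] by auto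
      have "(\<Sum>n\<in>S. if p dvd n \<and> r dvd n then ln (real p) * ln (real r) else 0) =
              ln (real p) * ln (real r) * real (card {n\<in>S. p dvd n \<and> r dvd n})"
        by (simp add: sum.If_cases Int_def conj_commute finite_smooth_upto S_def)
      also have "\<dots> \<le> ln (real p) * ln (real r) * Psi (X * K\<^sup>2 / d\<^sup>2) y +
                       (if r = p then ln (real p) * ln d * Psi (X * K / d) y else 0)"
      proof (cases "p = r")
        case True
        have "real (card {n\<in>S. p dvd n \<and> r dvd n}) = Psi (X / real p) y"
          using card_smooth_prime_power_multiples[OF P(1,2)[OF pr(1)], of X 1] True by (simp add: S_def)
        also have "\<dots> \<le> Psi (X / (d / K)) y"
          using P(3,5)[OF pr(1)] assms by (intro Psi_mono divide_left_mono) auto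
        finally have "ln (real p) * ln (real r) * real (card {n\<in>S. p dvd n \<and> r dvd n}) \<le>
            ln (real p) * ln d * Psi (X * K / d) y"
          using ln True by (intro mult_mono) auto
        thus ?thesis using True ln by (simp add: add_increasing)
      next
        case False
        have "{n\<in>S. p dvd n \<and> r dvd n} = {n\<in>S. p * r dvd n}"
          using False primes_coprime[OF P(1)[OF pr(1)] P(1)[OF pr(2)]]
          by (auto intro: divides_mult dest: dvd_mult_left dvd_mult_right)
        have "real (card {n\<in>S. p dvd n \<and> r dvd n}) = Psi (X / real (p * r)) y"
        proof -
          have "real q \<le> y" if "prime q" "q dvd p * r" for q
            using that P(1,2)[OF pr(1)] P(1,2)[OF pr(2)] primes_dvd_imp_eq[of q p] primes_dvd_imp_eq[of q r]
            by (auto simp: prime_dvd_mult_iff)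
          thus ?thesis using card_smooth_multiples[of "p * r" y X] P(5)[OF pr(1)] P(5)[OF pr(2)]
              \<open>{n\<in>S. p dvd n \<and> r dvd n} = {n\<in>S. p * r dvd n}\<close>
            by (simp add: S_def)
        qed
        also have "\<dots> \<le> Psi (X / (d / K * (d / K))) y"
          using P(3,5)[OF pr(1)] P(3,5)[OF pr(2)] assms unfolding of_nat_mult
          by (intro Psi_mono divide_left_mono mult_mono mult_pos_pos) auto
        also have "X / (d / K * (d / K)) = X * K\<^sup>2 / d\<^sup>2" using assms by (simp add: field_simps power2_eq_square)
        finally show ?thesis using False ln by (auto intro!: mult_left_mono)
      qed
      finally show "(\<Sum>n\<in>S. if p dvd n \<and> r dvd n then ln (real p) * ln (real r) else 0) \<le>
        ln (real p) * ln (real r) * Psi (X * K\<^sup>2 / d\<^sup>2) y +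
                       (if r = p then ln (real p) * ln d * Psi (X * K / d) y else 0)" .
    qed
    also have "\<dots> = V\<^sup>2 * Psi (X * K\<^sup>2 / d\<^sup>2) y + V * ln d * Psi (X * K / d) y"
    proof -
      have "(\<Sum>p\<in>P. \<Sum>r\<in>P. ln (real p) * ln (real r) * Psi (X * K\<^sup>2 / d\<^sup>2) y) = V\<^sup>2 * Psi (X * K\<^sup>2 / d\<^sup>2) y"
      proof -
        have "V\<^sup>2 = (\<Sum>p\<in>P. \<Sum>r\<in>P. ln (real p) * ln (real r))"
          by (simp only: V_def P_def power2_eq_square sum_product)
        thus ?thesis by (simp only: sum_distrib_right)
      qed
      moreover have "(\<Sum>p\<in>P. ln (real p) * ln d * Psi (X * K / d) y) = V * ln d * Psi (X * K / d) y"
        by (simp add: V_def P_def sum_distrib_right)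
      ultimately show ?thesis using finP by (simp add: sum.distrib)
    qed
    finally show ?thesis .
  qed
  finally show ?thesis by (simp add: mult_left_mono)
qed

section \<open>Chebyshev bounds\<close>

text \<open>The primes in (n, 2n] divide the central binomial coefficient, which is at most
  4^n.\<close>

lemma theta_double_le: "theta (2 * real n) - theta (real n) \<le> 2 * real n * ln 2"
proof (cases "n = 0")
  case False
  have "theta (2 * real n) - theta (real n) = (\<Sum>p\<in>primes_in n (2*n). ln (real p))"
    using theta_split[of "real n" "2 * real n"] by simp
  also have "\<dots> = (\<Sum>p\<in>{p\<in>primes_in n (2*n). p dvd (2*n choose n)}. ln (real p))"
  proof (rule sum.cong)
    have "p dvd (2*n choose n)" if "p \<in> primes_in n (2*n)" for p
    proof -
      have p: "prime p" "p > n" "p \<le> 2*n" using that by (auto simp: primes_in_def)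
      have "p dvd fact (2*n)" using p by (simp add: prime_dvd_fact_iff)
      also have "fact (2*n) = fact n * fact n * (2*n choose n)"
        using binomial_fact_lemma[of n "2*n"] by simp
      finally show ?thesis using p by (auto simp: prime_dvd_mult_iff prime_dvd_fact_iff)
    qed
    thus "primes_in n (2*n) = {p\<in>primes_in n (2*n). p dvd (2*n choose n)}" by auto
  qed auto
  also have "\<dots> \<le> ln (real (2*n choose n))"
    by (rule sum_ln_primes_dvd_le) (auto dest: primes_inD simp: Suc_le_eq)
  also have "\<dots> \<le> ln (2 ^ (2*n))"
  proof -
    have "(2*n choose n) \<le> 2 ^ (2*n)" by (rule binomial_le_pow2)
    hence "real (2*n choose n) \<le> 2 ^ (2*n)" using of_nat_le_iff by fastforce
    thus ?thesis by (simp add: ln_mono)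
  qed
  finally show ?thesis by (simp add: ln_realpow)
qed (auto simp: theta_def)

lemma theta_nat_le: "theta (real n) \<le> 6 * ln 2 * real n"
proof (induction n rule: less_induct)
  case (less n)
  consider "n = 0" | "n = 1" | "n \<ge> 2" by linarith
  thus ?case
  proof cases
    case 1
    have "primes_in 0 0 = {}" by (auto simp: primes_in_def)
    thus ?thesis using 1 by (simp add: theta_def)
  next
    case 2
    have "primes_in 0 1 = {}" by (auto simp: primes_in_def dest: prime_gt_1_nat)
    thus ?thesis using 2 by (simp add: theta_def)
  next
    case 3
    define m where "m = (n + 1) div 2"
    have m: "m < n" "n \<le> 2 * m" "2 * m \<le> n + 1" using 3 by (auto simp: m_def)
    have "theta (real n) \<le> theta (2 * real m)" using m by (intro theta_mono) simp
    also have "\<dots> \<le> theta (real m) + 2 * real m * ln 2" using theta_double_le[of m] by simp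
    also have "\<dots> \<le> 6 * ln 2 * real m + 2 * real m * ln 2" using less.IH[OF m(1)] by (intro add_right_mono)
    also have "\<dots> = 4 * ln 2 * (2 * real m)" by simp
    also have "\<dots> \<le> 4 * ln 2 * (real n + 1)" using m(3) by (intro mult_left_mono) auto
    \<comment> \<open>The constant a = 6 ln 2 solves (3/4) (a + 2 ln 2) = a, where 3/4 comes from m
      <= (n + 1) / 2 <= 3 n / 4 for n >= 2.\<close>
    also have "\<dots> \<le> 4 * ln 2 * (real n * (3/2))" 
      using 3 by (intro mult_left_mono) auto
    finally show ?thesis by (simp only: mult_ac)
  qed
qed

text \<open>Legendre's formula. The primes run up to M rather than N so that the formulas for n! and
  (2n)! can be subtracted term by term.\<close>

lemma ln_fact_eq_sum:
  assumes "M < 2 ^ Suc J" "N \<le> M"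
  shows "ln (fact N) = (\<Sum>p\<in>primes_in 0 (real M). \<Sum>j=1..J. ln (real p) * real (N div p ^ j))"
proof -
  have "ln (fact N :: real) = (\<Sum>m=1..N. ln (real m))"
    unfolding fact_prod of_nat_prod by (subst ln_prod) auto
  also have "{1..N} = smooth_upto (real N) (real M)" using assms(2) by (simp add: smooth_upto_eq_all)
  also have "(\<Sum>m\<in>\<dots>. ln (real m)) =
      (\<Sum>p\<in>primes_in 0 (real M). \<Sum>j=1..J. ln (real p) * Psi (real N / real p ^ j) (real M))"
  proof (rule sum_ln_smooth)
    have "real N < real (2 ^ Suc J)" using assms by (simp only: of_nat_less_iff)
    thus "real N < 2 ^ Suc J" by simp
  qed
  also have "\<dots> = (\<Sum>p\<in>primes_in 0 (real M). \<Sum>j=1..J. ln (real p) * real (N div p ^ j))"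
  proof (intro sum.cong refl)
    fix p j assume "p \<in> primes_in 0 (real M)"
    hence "1 \<le> real p ^ j" by (intro one_le_power) (auto dest: primes_inD(4))
    hence "real N / real p ^ j \<le> real M" using assms(2) by (intro divide_le_bound) auto
    hence "Psi (real N / real p ^ j) (real M) = real (N div p ^ j)"
      using floor_divide_of_nat_eq[of N "p ^ j", where ?'a = real] by (simp add: Psi_eq_card smooth_upto_eq_all)
    thus "ln (real p) * Psi (real N / real p ^ j) (real M) = ln (real p) * real (N div p ^ j)" by simp
  qed
  finally show ?thesis .
qed

lemma card_powers_le:
  assumes "p \<ge> (2::nat)" "N \<ge> 1"
  shows "real (card {j\<in>{1..J}. p ^ j \<le> N}) * ln (real p) \<le> ln (real N)"
proof (cases "{j\<in>{1..J}. p ^ j \<le> N} = {}")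
  case False
  define D where "D = {j\<in>{1..J}. p ^ j \<le> N}"
  have "finite D" "D \<noteq> {}" using False by (auto simp: D_def)
  hence "Max D \<in> D" by (rule Max_in)
  have "D \<subseteq> {1..Max D}" using \<open>finite D\<close> by (auto simp: D_def)
  hence "card D \<le> Max D" using card_mono[of "{1..Max D}" D] by simp
  hence "p ^ card D \<le> p ^ Max D" using assms by (intro power_increasing) auto
  also have "\<dots> \<le> N" using \<open>Max D \<in> D\<close> by (auto simp: D_def)
  finally have "real (p ^ card D) \<le> real N" by (simp only: of_nat_le_iff)
  hence "ln (real (p ^ card D)) \<le> ln (real N)" using assms by (subst ln_le_cancel_iff) auto
  thus ?thesis using assms by (simp add: ln_realpow D_def)
next
  case True
  thus ?thesis using assms by (simp only: True) simp
qed

text \<open>Chebyshev's lower bound: the central binomial coefficient is at least 2^n, and in its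
  factorization each prime power p^j <= 2n counts at most once. Powers with j >= 2 exist only for p
  <= sqrt (2n), and such a prime contributes at most ln (2n) in all.\<close>

lemma theta_double_ge:
  assumes "n \<ge> (1::nat)"
  shows "theta (2 * real n) \<ge> real n * ln 2 - sqrt (2 * real n) * ln (2 * real n)"
proof -
  define N where "N = 2 * n"
  define J where "J = N"
  have NJ: "N < 2 ^ Suc J" unfolding J_def by (rule less_trans[OF less_exp]) simp
  define P where "P = primes_in 0 (real N)"
  have "real n * ln 2 = ln (2 ^ n)" by (simp add: ln_realpow)
  also have "\<dots> \<le> ln (real (N choose n))"
  proof -
    have "2 ^ n \<le> (N choose n)"
      using binomial_ge_n_over_k_pow_k[of n N, where ?'a = real] assms by (simp add: N_def)
    thus ?thesis by (subst ln_le_cancel_iff) (auto simp: N_def)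
  qed
  also have "\<dots> = ln (fact N) - 2 * ln (fact n)"
  proof -
    have "real (N choose n) = fact N / (fact n * fact n)"
      using binomial_fact[of n N, where ?'a = real] by (simp add: N_def)
    thus ?thesis by (simp add: ln_div ln_mult)
  qed
  also have "\<dots> = (\<Sum>p\<in>P. \<Sum>j=1..J. ln (real p) * (real (N div p ^ j) - 2 * real (n div p ^ j)))"
    unfolding P_def using ln_fact_eq_sum[OF NJ, of N] ln_fact_eq_sum[OF NJ, of n]
    by (simp add: N_def sum_distrib_left right_diff_distrib sum_subtractf mult_ac)
  also have "\<dots> \<le> (\<Sum>p\<in>P. ln (real p) + (if real p \<le> sqrt (real N) then ln (real N) else 0))"
  proof (rule sum_mono)
    fix p assume "p \<in> P"
    hence p: "p \<ge> 2" "prime p" "p \<le> N" by (auto simp: P_def dest: primes_inD)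
    have "(\<Sum>j=1..J. ln (real p) * (real (N div p ^ j) - 2 * real (n div p ^ j))) \<le>
          (\<Sum>j=1..J. if p ^ j \<le> N then ln (real p) else 0)"
    proof (rule sum_mono)
      fix j
      have *: "N div p ^ j \<le> 2 * (n div p ^ j) + 1"
      proof -
        have "N mod p ^ j < p ^ j" "n mod p ^ j < p ^ j" using p by auto
        have "N < p ^ j * (2 * (n div p ^ j) + 2)"
          using \<open>n mod p ^ j < p ^ j\<close> mult_div_mod_eq[of "p ^ j" n] unfolding N_def distrib_left
          by (simp only: mult.left_commute[of _ 2])
        hence "N div p ^ j < 2 * (n div p ^ j) + 2"
          using p by (subst div_less_iff_less_mult) (auto simp: algebra_simps)
        thus ?thesis by simp
      qed
      show "ln (real p) * (real (N div p ^ j) - 2 * real (n div p ^ j)) \<le>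
              (if p ^ j \<le> N then ln (real p) else 0)"
      proof (cases "p ^ j \<le> N")
        case True
        have "real (N div p ^ j) - 2 * real (n div p ^ j) \<le> 1" using * by linarith
        hence "ln (real p) * (real (N div p ^ j) - 2 * real (n div p ^ j)) \<le> ln (real p) * 1"
          using p by (intro mult_left_mono) auto
        thus ?thesis using True by simp
      next
        case False
        hence "N div p ^ j = 0" by simp
        thus ?thesis using False p by (simp add: mult_nonneg_nonpos)
      qed
    qed
    also have "\<dots> = real (card {j\<in>{1..J}. p ^ j \<le> N}) * ln (real p)"
      by (simp add: sum.If_cases Int_def conj_commute)
    also have "\<dots> \<le> ln (real p) + (if real p \<le> sqrt (real N) then ln (real N) else 0)"
    proof (cases "real p \<le> sqrt (real N)")
      case True
      have "real (card {j\<in>{1..J}. p ^ j \<le> N}) * ln (real p) \<le> ln (real N)"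
        using p assms by (intro card_powers_le) (auto simp: N_def)
      thus ?thesis using True p by (simp add: add_increasing)
    next
      case False
      have "{j\<in>{1..J}. p ^ j \<le> N} \<subseteq> {1}"
      proof
        fix j assume j: "j \<in> {j\<in>{1..J}. p ^ j \<le> N}"
        show "j \<in> {1}"
        proof (rule ccontr)
          assume "j \<notin> {1}"
          hence "j \<ge> 2" using j by auto
          hence "p ^ 2 \<le> p ^ j" using p by (intro power_increasing) auto
          hence "p ^ 2 \<le> N" using j by simp
          hence "real p ^ 2 \<le> real N" by (metis of_nat_le_iff of_nat_power)
          hence "real p \<le> sqrt (real N)" by (rule real_le_rsqrt)
          thus False using False by simp
        qed
      qed
      hence "card {j\<in>{1..J}. p ^ j \<le> N} \<le> card {1::nat}" by (rule card_mono[rotated]) auto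
      hence "real (card {j\<in>{1..J}. p ^ j \<le> N}) * ln (real p) \<le> 1 * ln (real p)"
        using p by (intro mult_right_mono) auto
      thus ?thesis using False by simp
    qed
    finally show "(\<Sum>j=1..J. ln (real p) * (real (N div p ^ j) - 2 * real (n div p ^ j))) \<le>
      ln (real p) + (if real p \<le> sqrt (real N) then ln (real N) else 0)" .
  qed
  also have "\<dots> = theta (real N) + real (card {p\<in>P. real p \<le> sqrt (real N)}) * ln (real N)"
    by (simp add: sum.distrib theta_def P_def sum.If_cases Int_def conj_commute)
  also have "\<dots> \<le> theta (real N) + sqrt (real N) * ln (real N)"
  proof -
    have "{p\<in>P. real p \<le> sqrt (real N)} \<subseteq> {1..nat \<lfloor>sqrt (real N)\<rfloor>}"
      by (auto simp: P_def le_nat_floor dest!: primes_inD(4))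
    hence "card {p\<in>P. real p \<le> sqrt (real N)} \<le> nat \<lfloor>sqrt (real N)\<rfloor>"
      using card_mono[of "{1..nat \<lfloor>sqrt (real N)\<rfloor>}"] by fastforce
    hence "real (card {p\<in>P. real p \<le> sqrt (real N)}) \<le> sqrt (real N)"
      by (simp add: le_nat_iff le_floor_iff)
    moreover have "ln (real N) \<ge> 0" using assms by (simp add: N_def)
    ultimately show ?thesis by (intro add_left_mono mult_right_mono)
  qed
  finally show ?thesis by (simp add: N_def)
qed

lemma theta_ge: "\<exists>c>0. \<forall>z\<ge>2. theta z \<ge> c * z"
proof -
  have "eventually (\<lambda>n::nat. real n * ln 2 - sqrt (2 * real n) * ln (2 * real n) \<ge> real n * (1 / 3)) at_top"
  proof -
    have "eventually (\<lambda>n::nat. real n * 0.6 - sqrt (2 * real n) * ln (2 * real n) \<ge> real n * (1 / 3)) at_top"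
      by real_asymp
    thus ?thesis
    proof eventually_elim
      case (elim n)
      have "real n * 0.6 \<le> real n * ln 2" using ln2_ge_two_thirds by (intro mult_left_mono) auto
      thus ?case using elim by linarith
    qed
  qed
  then obtain N where N: "\<And>n. n \<ge> N \<Longrightarrow> real n * ln 2 - sqrt (2 * real n) * ln (2 * real n) \<ge> real n * (1 / 3)"
    by (auto simp: eventually_at_top_linorder)
  define M where "M = max N 1"
  \<comment> \<open>The second entry covers the bounded range n < M, where theta z >= theta 2 >= ln
    2 and z <= 2 M + 2.\<close>
  define c where "c = min (1/12) (ln 2 / (2 * real M + 2))"
  show ?thesis
  proof (rule exI[of _ c], intro conjI allI impI)
    show "c > 0" by (auto simp: c_def)
    fix z :: real assume z: "z \<ge> 2"
    define n where "n = nat \<lfloor>z / 2\<rfloor>"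
    have zn: "z / 2 - 1 \<le> real n" unfolding n_def by (rule real_nat_floor_ge)
    moreover have "real n \<le> z / 2" unfolding n_def using z by (intro of_nat_floor) simp
    moreover have "n \<ge> 1" using z by (simp add: n_def le_nat_iff le_floor_iff)
    ultimately have n: "n \<ge> 1" "2 * real n \<le> z" "z \<le> 4 * real n" using zn by auto
    show "theta z \<ge> c * z"
    proof (cases "n \<ge> M")
      case True
      have "c \<le> 1/12" unfolding c_def by (rule min.cobounded1)
      hence "c * z \<le> (1/12) * (4 * real n)" using z n by (intro mult_mono) auto
      also have "\<dots> = real n * (1/3)" by simp
      also have "\<dots> \<le> theta (2 * real n)"
        using N[of n] theta_double_ge[OF n(1)] True by (simp add: M_def)
      also have "\<dots> \<le> theta z" using n by (intro theta_mono) auto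
      finally show ?thesis .
    next
      case False
      have "c * z \<le> (ln 2 / (2 * real M + 2)) * (2 * real M + 2)" 
      proof (intro mult_mono)
        have "z \<le> 2 * (real n + 1)" using zn by simp
        also have "\<dots> \<le> 2 * real M + 2" using False by simp
        finally show "z \<le> 2 * real M + 2" by simp
      qed (use z in \<open>auto simp: c_def\<close>)
      also have "\<dots> = ln 2" by (simp add: add_nonneg_eq_0_iff)
      also have "\<dots> = (\<Sum>p\<in>{2::nat}. ln (real p))" by simp
      also have "\<dots> \<le> theta 2"
        unfolding theta_def by (intro sum_mono2) (auto simp: primes_in_def intro!: ln_ge_zero dest: prime_ge_1_nat)
      also have "\<dots> \<le> theta z" using z by (rule theta_mono)
      finally show ?thesis .
    qed
  qed
qed

lemma theta_le:
  assumes "z \<ge> 0"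
  shows "theta z \<le> 6 * z"
proof -
  have "primes_in 0 z \<subseteq> primes_in 0 (real (nat \<lfloor>z\<rfloor>))"
    by (auto simp: primes_in_def le_nat_floor simp del: of_nat_nat)
  hence "theta z \<le> theta (real (nat \<lfloor>z\<rfloor>))" unfolding theta_def
    by (intro sum_mono2 finite_primes_in) (auto simp: primes_in_def intro!: ln_ge_zero dest: prime_ge_1_nat)
  also have "\<dots> \<le> 6 * ln 2 * real (nat \<lfloor>z\<rfloor>)" by (rule theta_nat_le)
  also have "\<dots> \<le> 6 * 1 * z" using assms ln_2_less_1
    by (intro mult_mono) auto
  finally show ?thesis by simp
qed

text \<open>K >= 12 / c makes theta (z / K) <= 6 z / K at most half of the lower bound c z for theta
  z, so a fixed proportion of the weight lies in the window (z / K, z].\<close>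

lemma primes_in_window:
  obtains c K where "c > 0" "c \<le> 1" "K \<ge> 2" "\<And>z. z \<ge> 2 \<Longrightarrow> theta z \<ge> c * z"
    "\<And>d. d \<ge> 2 \<Longrightarrow> (\<Sum>p\<in>primes_in (d / K) d. ln (real p)) \<ge> c * d"
proof -
  obtain c where c: "c > 0" "\<And>z. z \<ge> 2 \<Longrightarrow> theta z \<ge> c * z" using theta_ge by blast
  define K where "K = max 2 (12 / c)"
  define c' where "c' = min 1 (c / 2)"
  show ?thesis
  proof (rule that[of c' K])
    fix z :: real assume z: "z \<ge> 2"
    have "c' * z \<le> c * z" using z c by (intro mult_right_mono) (auto simp: c'_def)
    thus "c' * z \<le> theta z" using c(2)[OF z] by simp
    have K: "K \<ge> 2" "K \<ge> 12 / c" by (auto simp: K_def)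
    have "z / K \<le> z" using z K by (simp add: field_simps)
    hence "(\<Sum>p\<in>primes_in (z / K) z. ln (real p)) = theta z - theta (z / K)"
      using theta_split[of "z / K" z] z K by simp
    also have "\<dots> \<ge> c * z - 6 * (z / K)" using c(2)[OF z] theta_le[of "z / K"] z K by simp
    also have "6 * (z / K) \<le> 6 * (z / (12 / c))"
      using K z c by (intro mult_left_mono divide_left_mono) auto
    hence "c * z - 6 * (z / K) \<ge> c * z - 6 * (z / (12 / c))" by linarith
    also have "c * z - 6 * (z / (12 / c)) = (c / 2) * z" using c by (simp add: field_simps)
    finally have "(c / 2) * z \<le> (\<Sum>p\<in>primes_in (z / K) z. ln (real p))" .
    moreover have "c' * z \<le> (c / 2) * z" using z by (intro mult_right_mono) (auto simp: c'_def)
    ultimately show "c' * z \<le> (\<Sum>p\<in>primes_in (z / K) z. ln (real p))" by linarith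
  qed (use c in \<open>auto simp: c'_def K_def\<close>)
qed

text \<open>The upper half of Mertens' estimate, from \<open>sum_ln_Psi_le\<close> at X = y: all
  integers up to y are y-smooth, so \<Psi>(y / p, y) >= y / (2p), while \<Psi>(y, y) <= y.\<close>

lemma sum_ln_div_primes_le:
  assumes "y \<ge> 1"
  shows "(\<Sum>p\<in>primes_in 0 y. ln (real p) / real p) \<le> 2 * ln y"
proof -
  have "y / 2 * (\<Sum>p\<in>primes_in 0 y. ln (real p) / real p) = (\<Sum>p\<in>primes_in 0 y. ln (real p) * (y / real p / 2))"
    by (simp add: sum_distrib_left mult_ac)
  also have "\<dots> \<le> (\<Sum>p\<in>primes_in 0 y. ln (real p) * Psi (y / real p) y)"
  proof (intro sum_mono mult_left_mono Psi_ge_half)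
    fix p assume "p \<in> primes_in 0 y"
    hence p: "p \<ge> 2" "real p \<le> y" by (auto dest: primes_inD)
    show "1 \<le> y / real p" "0 \<le> ln (real p)" using p by auto
    show "y / real p \<le> y" using p assms by (intro divide_le_bound) auto
  qed
  also have "\<dots> \<le> ln y * Psi y y" using assms by (intro sum_ln_Psi_le) auto
  also have "\<dots> \<le> ln y * y" using assms by (intro mult_left_mono Psi_le) auto
  also have "\<dots> = y / 2 * (2 * ln y)" by simp
  finally show ?thesis using assms by (subst (asm) mult_le_cancel_left_pos) auto
qed

section \<open>Decay of \<open>\<Psi>\<close> under division\<close>

text \<open>Fixing Chebyshev's constants once makes every later constant a function of c and K,
  hence absolute.\<close>

locale prime_windows =
  fixes c K :: real
  assumes c_pos: "c > 0" and c_le: "c \<le> 1" and K_ge: "K \<ge> 2"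
    and theta_lower: "\<And>z. z \<ge> 2 \<Longrightarrow> c * z \<le> theta z"
    and window: "\<And>d. d \<ge> 2 \<Longrightarrow> c * d \<le> (\<Sum>p\<in>primes_in (d / K) d. ln (real p))"
begin

text \<open>The coefficients produced by the second moment: K^2 by the off-diagonal part, 4 K / c by
  the diagonal, the 4 stemming from ln d <= 4 d^(1/4).\<close>

definition A :: real where "A = K\<^sup>2 + 4 * K / c"

lemma K_le_A: "K \<le> A"
proof -
  have "K * 1 \<le> K * K" using K_ge by (intro mult_left_mono) auto
  thus ?thesis using c_pos K_ge by (simp add: A_def power2_eq_square add_increasing2)
qed

lemma A_ge_1: "A \<ge> 1" using K_le_A K_ge by simp

text \<open>The factor uses ln x for every X <= x, so that the step can be repeated at X / z, X /
  z^2, ... with an unchanged factor.\<close>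

lemma Psi_step:
  assumes "2 \<le> z" "z \<le> y" "X \<le> x" "x \<ge> 1"
  shows "Psi (X / z) y \<le> ln x / (c * z) * Psi X y"
proof (cases "X \<ge> 1")
  case True
  have "c * z * Psi (X / z) y \<le> theta z * Psi (X / z) y"
    using assms by (intro mult_right_mono theta_lower) auto
  also have "\<dots> \<le> ln X * Psi X y" using assms True by (intro theta_Psi_le) auto
  also have "\<dots> \<le> ln x * Psi X y" using assms True by (intro mult_right_mono) auto
  finally show ?thesis using assms c_pos by (simp add: field_simps)
next
  case False
  have "Psi (X / z) y \<le> Psi X y" using assms by (intro Psi_div_le) auto
  thus ?thesis using False assms c_pos by (simp add: Psi_eq_0)
qed

end

text \<open>\<open>\<tau>\<close> is kept apart from \<open>y powr (-\<gamma>)\<close>: the power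
  governs general d, while for d with j prime factors above y the full \<open>\<tau> ^ j\<close> is
  retained. The bound 3/4 lets ln d be absorbed into d^(1-\<gamma>); the bound 1/2 lets decay be
  compared with square roots.\<close>

locale decay = prime_windows +
  fixes x y \<tau> \<gamma> :: real
  assumes \<gamma>: "1/2 \<le> \<gamma>" "\<gamma> \<le> 3/4" and y_ge: "y \<ge> 2" and x_ge: "x \<ge> 1"
    and \<tau>: "0 \<le> \<tau>" "\<tau> \<le> y powr (-\<gamma>)"
    and step: "\<And>X. X \<le> x \<Longrightarrow> Psi (X / y) y \<le> \<tau> * Psi X y"
begin

lemma div_y_le: "X \<le> x \<Longrightarrow> X / y \<le> x"
  using x_ge y_ge by (intro divide_le_bound) auto

text \<open>One division by y gains y^(-\<gamma>), exactly what passing from d / y to d asks for;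
  the range grows by a factor y and M stays the same.\<close>

lemma decay_extend:
  assumes M: "M \<ge> 0" and bound: "\<And>X d. X \<le> x \<Longrightarrow> 1 \<le> d \<Longrightarrow> d \<le> e \<Longrightarrow>
      Psi (X / d) y \<le> M * d powr (-\<gamma>) * Psi X y"
    and X: "X \<le> x" and d: "y \<le> d" "d \<le> y * e"
  shows "Psi (X / d) y \<le> M * d powr (-\<gamma>) * Psi X y"
proof -
  have "Psi (X / d) y = Psi ((X / y) / (d / y)) y" using y_ge by simp
  also have "\<dots> \<le> M * (d / y) powr (-\<gamma>) * Psi (X / y) y"
    using d y_ge by (intro bound div_y_le X) (auto simp: field_simps)
  also have "\<dots> \<le> M * (d / y) powr (-\<gamma>) * (y powr (-\<gamma>) * Psi X y)"
    using M order_trans[OF step[OF X] mult_right_mono[OF \<tau>(2)]] by (intro mult_left_mono) auto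
  also have "\<dots> = M * d powr (-\<gamma>) * Psi X y" using d y_ge by (simp add: powr_divide)
  finally show ?thesis .
qed

text \<open>Let \<open>M\<close> be the best constant. By the second moment the bound for \<open>d\<close> follows from the bound
  for \<open>d\<^sup>2 / K\<^sup>2\<close> with the square root of the constant, so \<open>M\<close> is at most a multiple of \<open>sqrt M\<close>.\<close>

lemma Psi_decay_short:
  assumes X: "X \<le> x" and d: "1 \<le> d" "d \<le> y"
  shows "Psi (X / d) y \<le> A * d powr (-\<gamma>) * Psi X y"
proof -
  define F where "F = (\<lambda>(X, d). Psi (X / d) y * d powr \<gamma> / Psi X y)"
  define I where "I = {1..x} \<times> {1..y}"
  define M where "M = (SUP i\<in>I. F i)"
  have trivial_bound: "F (X, d) \<le> d powr \<gamma>" if "X \<ge> 1" "d \<ge> 1" for X d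
    using Psi_div_le[OF that(2), of X] Psi_ge_1[OF that(1), of y] that(2)
    by (simp add: F_def divide_le_eq mult_right_mono mult.commute)
  \<comment> \<open>The trivial bound \<Psi>(X / d, y) <= \<Psi>(X, y) makes the supremum M finite
    before anything is known about its size.\<close>
  have bdd: "bdd_above (F ` I)"
  proof (rule bdd_aboveI2)
    fix i assume "i \<in> I"
    then obtain X d where i: "i = (X, d)" "1 \<le> X" "1 \<le> d" "d \<le> y" by (auto simp: I_def)
    have "d powr \<gamma> \<le> y powr \<gamma>" using i \<gamma> by (intro powr_mono2) auto
    thus "F i \<le> y powr \<gamma>" using trivial_bound[OF i(2,3)] i by simp
  qed
  have ne: "I \<noteq> {}" using x_ge y_ge by (auto simp: I_def)
  have "F (1, 1) \<le> M" unfolding M_def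
    by (rule cSUP_upper[OF _ bdd]) (use x_ge y_ge in \<open>auto simp: I_def\<close>)
  moreover have "F (1, 1) = 1" using Psi_ge_1[of 1 y] by (simp add: F_def)
  ultimately have M1: "M \<ge> 1" by simp
  have b1: "Psi (X / d) y \<le> M * d powr (-\<gamma>) * Psi X y" if "X \<le> x" "1 \<le> d" "d \<le> y" for X d
  proof (cases "X \<ge> 1")
    case True
    have "F (X, d) \<le> M" unfolding M_def
      by (rule cSUP_upper[OF _ bdd]) (use that True in \<open>auto simp: I_def\<close>)
    hence "Psi (X / d) y * d powr \<gamma> \<le> M * Psi X y"
      using Psi_ge_1[OF True, of y] by (simp add: F_def divide_le_eq)
    thus ?thesis using that by (simp add: powr_minus field_simps)
  next
    case False
    have "Psi (X / d) y \<le> Psi X y" by (rule Psi_div_le) fact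
    thus ?thesis using False by (simp add: Psi_eq_0)
  qed
  \<comment> \<open>The second moment at d <= y looks at (d / K)^2, which may approach y^2; one
    division by y covers this range with the same M.\<close>
  have b2: "Psi (X / d) y \<le> M * d powr (-\<gamma>) * Psi X y" if "X \<le> x" "1 \<le> d" "d \<le> y\<^sup>2" for X d
  proof (cases "d \<le> y")
    case False
    thus ?thesis using that M1 by (intro decay_extend[OF _ b1]) (auto simp: power2_eq_square)
  qed (use b1 that in auto)
  have "F i \<le> max K (sqrt (A * M))" if "i \<in> I" for i
  proof -
    obtain X d where i: "i = (X, d)" "1 \<le> X" "X \<le> x" "1 \<le> d" "d \<le> y"
      using \<open>i \<in> I\<close> by (auto simp: I_def)
    have P1: "Psi X y \<ge> 1" using i by (intro Psi_ge_1)
    show ?thesis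
    \<comment> \<open>Below K the trivial bound gives at most K. From K on, d / K >= 1 and d >= 2,
      so the bounds with M apply to d / K and its square.\<close>
    proof (cases "d < K")
      case True
      have "d powr \<gamma> \<le> K powr 1" using i True \<gamma> K_ge
        by (intro order_trans[OF powr_mono[of \<gamma> 1 d] powr_mono2]) auto
      thus ?thesis using trivial_bound[OF i(2,4)] i K_ge by simp
    next
      case False
      hence d: "d \<ge> K" "d \<ge> 2" "d > 0" using K_ge by auto
      define V where "V = (\<Sum>p\<in>primes_in (d / K) d. ln (real p))"
      have V: "V \<ge> c * d" unfolding V_def by (rule window) (use d in auto)
      have V0: "V > 0" using V mult_pos_pos[OF c_pos d(3)] by linarith
      define D where "D = d powr (-\<gamma>)"
      have D0: "D > 0" using d by (simp add: D_def)
      have t2: "Psi (X * K\<^sup>2 / d\<^sup>2) y \<le> M * K\<^sup>2 * D\<^sup>2 * Psi X y"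
      proof -
        have "d / K \<le> d" using d K_ge by (simp add: field_simps)
        hence "(d / K)\<^sup>2 \<le> y\<^sup>2" using i d K_ge by (intro power_mono) auto
        hence "Psi (X / (d / K)\<^sup>2) y \<le> M * ((d / K)\<^sup>2) powr (-\<gamma>) * Psi X y"
          using i d K_ge by (intro b2) auto
        also have "((d / K)\<^sup>2) powr (-\<gamma>) = (K powr \<gamma>)\<^sup>2 * D\<^sup>2"
          using d K_ge by (simp add: D_def powr_divide powr_minus power2_eq_square powr_mult field_simps)
        also have "M * ((K powr \<gamma>)\<^sup>2 * D\<^sup>2) * Psi X y \<le> M * ((K powr 1)\<^sup>2 * D\<^sup>2) * Psi X y"
          using M1 K_ge \<gamma> by (intro mult_right_mono mult_left_mono power_mono powr_mono) auto
        finally show ?thesis using K_ge by (simp add: power_divide mult_ac)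
      qed
      have t1: "Psi (X * K / d) y \<le> M * K * D * Psi X y"
      proof -
        have "d / K \<le> d" using d K_ge by (simp add: field_simps)
        hence "Psi (X / (d / K)) y \<le> M * (d / K) powr (-\<gamma>) * Psi X y"
          using i d K_ge by (intro b1) auto
        also have "(d / K) powr (-\<gamma>) = K powr \<gamma> * D"
          using d K_ge by (simp add: D_def powr_divide powr_minus field_simps)
        also have "M * (K powr \<gamma> * D) * Psi X y \<le> M * (K powr 1 * D) * Psi X y"
          using M1 K_ge \<gamma> D0 by (intro mult_right_mono mult_left_mono powr_mono) auto
        finally show ?thesis using K_ge by (simp add: mult_ac)
      qed
      \<comment> \<open>The diagonal carries only one factor V, against ln d. Since ln d <= 4
        d^(1/4) <= 4 d^(1-\<gamma>) and V >= c d, it takes the same shape V^2 D^2 as the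
        off-diagonal part.\<close>
      have lnd: "ln d \<le> V * (4 / c) * D"
      proof -
        have "ln d = 4 * ln (d powr (1/4))" using d by (simp add: ln_powr)
        also have "\<dots> \<le> 4 * d powr (1/4)" using d by (intro mult_left_mono less_imp_le ln_less_self) auto
        also have "\<dots> \<le> 4 * d powr (1 - \<gamma>)" using d \<gamma> by (intro mult_left_mono powr_mono) auto
        also have "\<dots> = (c * d) * (4 / c) * D"
          using d c_pos by (simp add: D_def powr_diff powr_minus field_simps)
        also have "\<dots> \<le> V * (4 / c) * D" using V c_pos D0 by (intro mult_right_mono) auto
        finally show ?thesis .
      qed
      have "(V * Psi (X / d) y)\<^sup>2 \<le>
           Psi X y * (V\<^sup>2 * Psi (X * K\<^sup>2 / d\<^sup>2) y + V * ln d * Psi (X * K / d) y)"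
        unfolding V_def using d i K_ge by (intro Psi_second_moment) auto
      also have "\<dots> \<le> Psi X y * (V\<^sup>2 * (M * K\<^sup>2 * D\<^sup>2 * Psi X y) + V * (V * (4 / c) * D) * (M * K * D * Psi X y))"
        using t1 t2 lnd V0 D0 M1 K_ge c_pos d 
        by (intro mult_left_mono add_mono mult_mono) auto
      also have "\<dots> = V\<^sup>2 * (D\<^sup>2 * (A * M) * (Psi X y)\<^sup>2)"
        by (simp add: A_def field_simps power2_eq_square)
      finally have "(Psi (X / d) y)\<^sup>2 \<le> D\<^sup>2 * (A * M) * (Psi X y)\<^sup>2"
        using V0 by (simp add: power_mult_distrib)
      also have "\<dots> = (D * sqrt (A * M) * Psi X y)\<^sup>2"
        using A_ge_1 M1 by (simp add: power_mult_distrib)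
      finally have "Psi (X / d) y \<le> D * sqrt (A * M) * Psi X y"
        by (rule power2_le_imp_le) (use A_ge_1 M1 D0 in auto)
      hence "F i \<le> sqrt (A * M)"
        using P1 d by (simp add: i F_def D_def powr_minus field_simps)
      thus ?thesis by simp
    qed
  qed
  hence "M \<le> max K (sqrt (A * M))" unfolding M_def using ne by (intro cSUP_least) auto
  hence "M \<le> A"
  proof (cases "M \<le> K")
    case False
    hence "M \<le> sqrt (A * M)" using \<open>M \<le> max K (sqrt (A * M))\<close> by auto
    hence "M\<^sup>2 \<le> A * M" using M1 by (simp add: real_le_rsqrt sqrt_ge_absD)
    thus ?thesis using M1 by (simp add: power2_eq_square)
  qed (use K_le_A in auto)
  have "Psi (X / d) y \<le> M * d powr (-\<gamma>) * Psi X y" by (rule b1) fact+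
  also have "\<dots> \<le> A * d powr (-\<gamma>) * Psi X y" using \<open>M \<le> A\<close> by (intro mult_right_mono) auto
  finally show ?thesis .
qed

lemma Psi_decay:
  assumes X: "X \<le> x" and d: "1 \<le> d"
  shows "Psi (X / d) y \<le> A * d powr (-\<gamma>) * Psi X y"
proof -
  have "Psi (X / d) y \<le> A * d powr (-\<gamma>) * Psi X y" if "X \<le> x" "1 \<le> d" "d \<le> y ^ n" for n X d
    using that
  proof (induction n arbitrary: X d)
    case 0
    hence "d = 1" by simp
    thus ?case using mult_right_mono[OF A_ge_1, of "Psi X y"] by simp
  next
    case (Suc n)
    show ?case
    proof (cases "d \<le> y")
      case False
      thus ?thesis using Suc.prems A_ge_1 by (intro decay_extend[OF _ Suc.IH]) auto
    qed (use Psi_decay_short Suc.prems in auto)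
  qed
  moreover obtain n where "d < y ^ n" using real_arch_pow[of y d] y_ge by auto
  ultimately show ?thesis using assms by (meson less_imp_le)
qed

text \<open>The first j divisions by y each gain the full \<open>\<tau>\<close>; only the remaining
  quotient d / y^j is measured with exponent \<gamma>.\<close>

lemma Psi_decay_rough:
  assumes "X \<le> x" "y ^ j \<le> d"
  shows "Psi (X / d) y \<le> A * \<tau> ^ j * (d / y ^ j) powr (-\<gamma>) * Psi X y"
  using assms
proof (induction j arbitrary: X d)
  case 0
  thus ?case using Psi_decay by simp
next
  case (Suc j)
  have "Psi (X / d) y = Psi ((X / y) / (d / y)) y" using y_ge by simp
  also have "\<dots> \<le> A * \<tau> ^ j * (d / y / y ^ j) powr (-\<gamma>) * Psi (X / y) y"
    using Suc.prems y_ge by (intro Suc.IH div_y_le) (auto simp: field_simps)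
  also have "\<dots> \<le> A * \<tau> ^ j * (d / y / y ^ j) powr (-\<gamma>) * (\<tau> * Psi X y)"
    using A_ge_1 \<tau> step[OF Suc.prems(1)] by (intro mult_left_mono) auto
  also have "\<dots> = A * \<tau> ^ Suc j * (d / y ^ Suc j) powr (-\<gamma>) * Psi X y"
    by (simp add: mult_ac)
  finally show ?case .
qed

end

section \<open>Growth of \<open>\<Psi>\<close>\<close>

lemma sum_inverse_powers_le:
  fixes r :: real
  assumes "0 \<le> r" "r \<le> 1/2"
  shows "(\<Sum>j=1..J. r ^ j) \<le> 2 * r"
proof -
  have "(\<Sum>j=1..J. r ^ j) \<le> 2 * r * (1 - (1/2) ^ J)"
  proof (induction J)
    case (Suc J)
    have "r * r ^ J \<le> r * (1/2) ^ J" using assms by (intro mult_left_mono power_mono) auto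
    thus ?case using Suc by (simp add: algebra_simps)
  qed auto
  also have "\<dots> \<le> 2 * r * 1" using assms by (intro mult_left_mono) auto
  finally show ?thesis by simp
qed

text \<open>At the first power above T the term is at most 1; from there on the ratio is 1 / sqrt b
  <= 3/4, and 4 is the sum of the geometric series.\<close>

lemma sum_sqrt_powers_le:
  fixes b T :: real
  assumes "b \<ge> 2" "T > 0"
  shows "(\<Sum>j=1..J. if b ^ j > T then sqrt (T / b ^ j) else 0) \<le> 4"
proof -
  define s where "s j = sqrt (T / b ^ j)" for j
  have s_nonneg: "s j \<ge> 0" for j using assms by (simp add: s_def)
  have s_Suc: "4 * s (Suc j) \<le> 3 * s j" for j
  proof -
    have "(4 * s (Suc j))\<^sup>2 = 16 / b * (T / b ^ j)" using assms by (simp add: s_def power_mult_distrib)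
    also have "\<dots> \<le> 9 * (T / b ^ j)" using assms by (intro mult_right_mono) (auto simp: field_simps)
    also have "\<dots> = (3 * s j)\<^sup>2" using assms by (simp add: s_def power_mult_distrib)
    finally show ?thesis by (rule power2_le_imp_le) (use s_nonneg in auto)
  qed
  \<comment> \<open>Subtracting 3 s(J) makes the bound inductive: adding s(J+1) turns 4 - 3 s(J)
    into at most 4 - 3 s(J+1), because 4 s(J+1) <= 3 s(J).\<close>
  have "if b ^ J > T then (\<Sum>j=1..J. if b ^ j > T then s j else 0) \<le> 4 - 3 * s J
        else (\<Sum>j=1..J. if b ^ j > T then s j else 0) = 0"
  proof (induction J)
    case 0
    have "T < 1 \<Longrightarrow> s 0 \<le> 1" using assms by (simp add: s_def)
    thus ?case by auto
  next
    case (Suc J)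
    show ?case
    proof (cases "b ^ Suc J > T")
      case False
      have "b ^ J \<le> b ^ Suc J" using assms by (intro power_increasing) auto
      thus ?thesis using Suc False by (auto split: if_splits)
    next
      case True
      have "T / b ^ Suc J \<le> 1" using True assms by (subst divide_le_eq_1) auto
      hence "s (Suc J) \<le> 1" unfolding s_def by (metis real_sqrt_le_iff real_sqrt_one)
      thus ?thesis using Suc s_Suc[of J] True by (auto split: if_splits)
    qed
  qed
  thus ?thesis using s_nonneg[of J] unfolding s_def[symmetric] by (auto split: if_splits)
qed

text \<open>Counting powers of 2 replaces the integral of dt / t: the logarithm becomes a sum of
  indicators that can be swapped with a sum over n.\<close>

lemma ln_le_card_powers:
  assumes "1 \<le> t" "t < (2::real) ^ k"
  shows "ln t \<le> real (card {i\<in>{..<k}. 2 ^ i \<le> t})"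
  using assms(2)
proof (induction k)
  case (Suc k)
  show ?case
  proof (cases "t < 2 ^ k")
    case True
    have "card {i\<in>{..<k}. 2 ^ i \<le> t} \<le> card {i\<in>{..<Suc k}. 2 ^ i \<le> t}"
      by (intro card_mono) auto
    thus ?thesis using Suc.IH[OF True] by linarith
  next
    case False
    have "(2::real) ^ i \<le> t" if "i < Suc k" for i
    proof -
      have "(2::real) ^ i \<le> 2 ^ k" using that by (intro power_increasing) auto
      thus ?thesis using False by linarith
    qed
    hence "{i\<in>{..<Suc k}. 2 ^ i \<le> t} = {..<Suc k}" by auto
    moreover have "ln t \<le> real (Suc k)"
    proof -
      have "ln t \<le> ln (2 ^ Suc k)" using Suc.prems assms(1) by (intro ln_mono) auto
      also have "\<dots> = real (Suc k) * ln 2" by (rule ln_realpow)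
      also have "\<dots> \<le> real (Suc k) * 1" using ln_2_less_1 by (intro mult_left_mono) auto
      finally show ?thesis by simp
    qed
    ultimately show ?thesis by simp
  qed
qed (use assms in auto)

lemma le_real_nat_floor_iff:
  assumes "b \<ge> 0"
  shows "real n \<le> real (nat \<lfloor>b\<rfloor>) \<longleftrightarrow> real n \<le> b"
  unfolding of_nat_le_iff using assms by (simp add: le_nat_iff le_floor_iff)

lemma primes_in_floor:
  assumes "a \<ge> 0" "b \<ge> 0"
  shows "primes_in (real (nat \<lfloor>a\<rfloor>)) (real (nat \<lfloor>b\<rfloor>)) = primes_in a b"
  unfolding primes_in_def not_le[symmetric] using assms by (simp only: le_real_nat_floor_iff)

lemma Psi_floor:
  assumes "y \<ge> 0"
  shows "Psi x (real (nat \<lfloor>y\<rfloor>)) = Psi x y"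
  unfolding Psi_eq_card smooth_upto_def using assms by (simp only: le_real_nat_floor_iff)

context decay
begin

text \<open>ln (Z / n) is at most the number of i with n <= Z / 2^i, so these deficits add up to at
  most the sum of \<Psi>(Z / 2^i, y), a convergent geometric series by the decay. On average ln n is
  thus within 4 A of ln Z.\<close>

lemma sum_ln_smooth_ge:
  assumes "1 \<le> Z" "Z \<le> x"
  shows "Psi Z y * (ln Z - 4 * A) \<le> (\<Sum>n\<in>smooth_upto Z y. ln (real n))"
proof -
  define S where "S = smooth_upto Z y"
  have S: "n > 0" "real n \<le> Z" if "n \<in> S" for n using that by (auto simp: S_def smooth_upto_def)
  have finS: "finite S" by (simp add: S_def finite_smooth_upto)
  obtain k where k: "Z < 2 ^ k" using real_arch_pow[of 2 Z] by auto
  have "(\<Sum>n\<in>S. ln Z - ln (real n)) \<le> (\<Sum>n\<in>S. \<Sum>i<k. if real n \<le> Z / 2 ^ i then 1 else 0)"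
  proof (rule sum_mono)
    fix n assume n: "n \<in> S"
    have "Z / real n \<le> Z / 1" using S[OF n] assms by (intro divide_left_mono) auto
    hence "ln (Z / real n) \<le> real (card {i\<in>{..<k}. 2 ^ i \<le> Z / real n})"
      using S[OF n] k by (intro ln_le_card_powers) auto
    also have "{i\<in>{..<k}. 2 ^ i \<le> Z / real n} = {i\<in>{..<k}. real n \<le> Z / 2 ^ i}"
      using S[OF n] by (auto simp: field_simps)
    finally show "ln Z - ln (real n) \<le> (\<Sum>i<k. if real n \<le> Z / 2 ^ i then 1 else 0)"
      using S[OF n] assms by (simp add: ln_div sum.If_cases Int_def)
  qed
  also have "\<dots> = (\<Sum>i<k. \<Sum>n\<in>S. if real n \<le> Z / 2 ^ i then 1 else 0)"
    by (rule sum.swap)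
  also have "\<dots> = (\<Sum>i<k. Psi (Z / 2 ^ i) y)"
  proof (rule sum.cong[OF refl])
    fix i
    have "Z / 2 ^ i \<le> Z / 1" using assms by (intro divide_left_mono) auto
    hence "{n\<in>S. real n \<le> Z / 2 ^ i} = smooth_upto (Z / 2 ^ i) y" by (auto simp: S_def smooth_upto_def)
    thus "(\<Sum>n\<in>S. if real n \<le> Z / 2 ^ i then 1 else 0) = Psi (Z / 2 ^ i) y"
      using finS by (simp add: sum.If_cases Int_def Psi_eq_card)
  qed
  also have "\<dots> \<le> (\<Sum>i<k. A * sqrt (1/2) ^ i * Psi Z y)"
  proof (rule sum_mono)
    fix i
    have "Psi (Z / 2 ^ i) y \<le> A * (2 ^ i) powr (-\<gamma>) * Psi Z y" using assms by (intro Psi_decay) auto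
    also have "\<dots> \<le> A * (2 ^ i) powr (-(1/2)) * Psi Z y"
      using A_ge_1 \<gamma> by (intro mult_right_mono mult_left_mono powr_mono) auto
    also have "(2 ^ i) powr (-(1/2)) = sqrt (1/2) ^ i"
      by (simp add: powr_minus powr_half_sqrt real_sqrt_power real_sqrt_divide power_divide field_simps)
    finally show "Psi (Z / 2 ^ i) y \<le> A * sqrt (1/2) ^ i * Psi Z y" .
  qed
  also have "\<dots> = A * Psi Z y * (\<Sum>i<k. sqrt (1/2) ^ i)"
    by (simp add: sum_distrib_left mult_ac)
  also have "\<dots> \<le> A * Psi Z y * 4"
  proof (intro mult_left_mono)
    have s: "sqrt (1/2) \<le> (3/4::real)" by (rule real_le_lsqrt) (auto simp: power2_eq_square)
    have "(\<Sum>i<k. sqrt (1/2) ^ i) \<le> (\<Sum>i<k. (3/4::real) ^ i)" by (intro sum_mono power_mono s) auto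
    also have "\<dots> \<le> 4" by (simp add: sum_gp_strict)
    finally show "(\<Sum>i<k. sqrt (1/2) ^ i) \<le> (4::real)" .
  qed (use A_ge_1 in auto)
  finally have "(\<Sum>n\<in>S. ln Z - ln (real n)) \<le> 4 * A * Psi Z y" by (simp add: mult_ac)
  moreover have "(\<Sum>n\<in>S. ln Z - ln (real n)) = Psi Z y * ln Z - (\<Sum>n\<in>S. ln (real n))"
    by (simp add: sum_subtractf Psi_eq_card S_def)
  ultimately show ?thesis by (simp add: S_def algebra_simps)
qed

lemma sum_ln_sqrt_powers_le:
  assumes "T > 0"
  shows "(\<Sum>p\<in>primes_in 0 y. ln (real p) * (\<Sum>j=1..J. if real p ^ j > T then sqrt (T / real p ^ j) else 0))
           \<le> 24 * y"
proof -
  have "(\<Sum>p\<in>primes_in 0 y. ln (real p) * (\<Sum>j=1..J. if real p ^ j > T then sqrt (T / real p ^ j) else 0)) \<le>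
      (\<Sum>p\<in>primes_in 0 y. ln (real p) * 4)"
    using assms by (intro sum_mono mult_left_mono sum_sqrt_powers_le) (auto dest: primes_inD(4))
  also have "\<dots> = 4 * theta y" by (simp add: theta_def sum_distrib_left mult_ac)
  finally show ?thesis using theta_le[of y] y_ge by simp
qed

text \<open>Induction on \<open>X\<close>, comparing the expansions of \<open>\<Sum> ln n\<close> over prime powers
  at \<open>e X\<close> and at \<open>X\<close>.\<close>

lemma Psi_dilate_large:
  assumes "ln e \<ge> 4 * A + 24" "e \<ge> 1" "1 \<le> X" "e * X \<le> x"
  shows "Psi (e * X) y \<le> 2 * e * Psi X y"
proof -
  have "Psi (e * X) y \<le> 2 * e * Psi X y" if "1 \<le> X" "e * X \<le> x" "X \<le> 2 ^ n" for X n
    using that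
  proof (induction n arbitrary: X)
    case (0 X)
    hence "X = 1" by simp
    hence "Psi (e * X) y \<le> e" using Psi_le[of e y] assms by simp
    also have "\<dots> \<le> 2 * e * Psi X y" using Psi_ge_1[of X y] 0 assms
      by (simp add: add_increasing)
    finally show ?case .
  next
    case (Suc n X)
    show ?case
    proof (cases "X \<le> y")
      case True
      have "Psi (e * X) y \<le> e * X" using assms Suc.prems by (intro Psi_le) auto
      also have "\<dots> \<le> e * (2 * Psi X y)"
        using Psi_ge_half[OF Suc.prems(1) True] assms by (intro mult_left_mono) auto
      finally show ?thesis by simp
    next
      case False
      define Z where "Z = e * X"
      have XZ: "X \<le> Z" using assms Suc.prems by (simp add: Z_def mult_le_cancel_right2)
      have Z1: "1 \<le> Z" using XZ Suc.prems by simp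
      obtain J where J: "Z < 2 ^ J" using real_arch_pow[of 2 Z] by auto
      hence J: "Z < 2 ^ Suc J" by (rule less_le_trans) auto
      let ?P = "primes_in 0 y"
      have "Psi Z y * (ln Z - 4 * A) \<le> (\<Sum>n\<in>smooth_upto Z y. ln (real n))"
        using Suc.prems by (intro sum_ln_smooth_ge Z1) (simp add: Z_def)
      also have "\<dots> = (\<Sum>p\<in>?P. \<Sum>j=1..J. ln (real p) * Psi (Z / real p ^ j) y)"
        by (rule sum_ln_smooth[OF J])
      also have "\<dots> \<le> (\<Sum>p\<in>?P. \<Sum>j=1..J. 2 * e * (ln (real p) * Psi (X / real p ^ j) y) +
            e * (ln (real p) * (if real p ^ j > X then sqrt (X / real p ^ j) else 0)))"
      proof (intro sum_mono)
        fix p j assume p: "p \<in> ?P" and j: "j \<in> {1..J}"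
        have p2: "real p \<ge> 2" using p by (auto dest: primes_inD)
        have "real p ^ 1 \<le> real p ^ j" using p2 j by (intro power_increasing) auto
        hence pj2: "real p ^ j \<ge> 2" unfolding power_one_right using p2 by linarith
        have "Psi (Z / real p ^ j) y \<le> 2 * e * Psi (X / real p ^ j) y +
            e * (if real p ^ j > X then sqrt (X / real p ^ j) else 0)"
        proof (cases "real p ^ j > X")
          case True
          \<comment> \<open>Here X / p^j < 1, so \<Psi>(X / p^j, y) = 0 gives no room, and the
            trivial bound Z / p^j = e t is used. Passing to sqrt t prepares
            \<open>sum_ln_sqrt_powers_le\<close>, which bounds all such terms by a multiple of
            y.\<close>
          define t where "t = X / real p ^ j"
          have t: "0 \<le> t" "t \<le> 1" using True Suc.prems pj2 unfolding t_def by (simp, subst divide_le_eq_1) auto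
          have "Psi (Z / real p ^ j) y \<le> Z / real p ^ j" using Z1 p2 by (intro Psi_le) auto
          also have "\<dots> = e * t" by (simp add: Z_def t_def)
          also have "t * t \<le> t * 1" using t by (intro mult_left_mono)
          hence "t \<le> sqrt t" using t by (intro real_le_rsqrt) (simp add: power2_eq_square)
          hence "e * t \<le> e * sqrt t" using assms by (intro mult_left_mono) auto
          finally show ?thesis using True assms by (simp add: t_def add_increasing)
        next
          case False
          have "X / real p ^ j \<le> X / 1" using pj2 p2 Suc.prems by (intro divide_left_mono) auto
          hence "e * (X / real p ^ j) \<le> e * X" using assms by (intro mult_left_mono) auto
          moreover have "X / real p ^ j \<le> 2 ^ Suc n / 2"
            using pj2 p2 Suc.prems by (intro frac_le) auto
          ultimately have "Psi (e * (X / real p ^ j)) y \<le> 2 * e * Psi (X / real p ^ j) y"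
            using False pj2 p2 Suc.prems by (intro Suc.IH) auto
          thus ?thesis using False by (simp add: Z_def)
        qed
        hence "ln (real p) * Psi (Z / real p ^ j) y \<le> ln (real p) * (2 * e * Psi (X / real p ^ j) y +
            e * (if real p ^ j > X then sqrt (X / real p ^ j) else 0))"
          using p2 by (intro mult_left_mono) auto
        thus "ln (real p) * Psi (Z / real p ^ j) y \<le> 2 * e * (ln (real p) * Psi (X / real p ^ j) y) +
            e * (ln (real p) * (if real p ^ j > X then sqrt (X / real p ^ j) else 0))"
          by (simp add: algebra_simps)
      qed
      also have "\<dots> = 2 * e * (\<Sum>p\<in>?P. \<Sum>j=1..J. ln (real p) * Psi (X / real p ^ j) y) +
            e * (\<Sum>p\<in>?P. ln (real p) * (\<Sum>j=1..J. if real p ^ j > X then sqrt (X / real p ^ j) else 0))"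
        by (simp only: sum.distrib sum_distrib_left)
      also have "(\<Sum>p\<in>?P. \<Sum>j=1..J. ln (real p) * Psi (X / real p ^ j) y) = (\<Sum>n\<in>smooth_upto X y. ln (real n))"
        by (rule sum_ln_smooth[symmetric]) (use J XZ in linarith)
      also have "\<dots> \<le> (\<Sum>n\<in>smooth_upto X y. ln X)" by (intro sum_mono ln_le_of_smooth)
      also have "\<dots> = Psi X y * ln X" by (simp add: Psi_eq_card)
      also have "(\<Sum>p\<in>?P. ln (real p) * (\<Sum>j=1..J. if real p ^ j > X then sqrt (X / real p ^ j) else 0)) \<le> 24 * y"
        using Suc.prems by (intro sum_ln_sqrt_powers_le) auto
      also have "\<dots> \<le> 48 * Psi X y"
      proof -
        have "y / 2 \<le> Psi y y" using y_ge by (intro Psi_ge_half) auto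
        also have "\<dots> \<le> Psi X y" using False by (intro Psi_mono) auto
        finally show ?thesis by simp
      qed
      finally have "Psi Z y * (ln Z - 4 * A) \<le> 2 * e * (Psi X y * ln X) + e * (48 * Psi X y)"
        using assms by (simp add: mult_left_mono)
      also have "\<dots> = 2 * e * Psi X y * (ln X + 24)" by (simp add: algebra_simps)
      \<comment> \<open>This is where ln e >= 4 A + 24 enters: ln Z = ln e + ln X, so ln X + 24 <=
        ln Z - 4 A and the constant 2 e reproduces itself.\<close>
      also have "\<dots> \<le> 2 * e * Psi X y * (ln Z - 4 * A)"
        using assms Suc.prems by (intro mult_left_mono) (auto simp: Z_def ln_mult)
      finally have "Psi Z y * (ln Z - 4 * A) \<le> 2 * e * Psi X y * (ln Z - 4 * A)" .
      moreover have "ln Z - 4 * A > 0"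
      proof -
        have "ln Z = ln e + ln X" using assms Suc.prems by (auto simp: Z_def ln_mult)
        moreover have "ln X \<ge> 0" using Suc.prems by simp
        ultimately show ?thesis using assms(1) by linarith
      qed
      ultimately show ?thesis by (simp add: Z_def)
    qed
  qed
  moreover obtain n where "X < 2 ^ n" using real_arch_pow[of 2 X] by auto
  ultimately show ?thesis using assms by (meson less_imp_le)
qed

end

definition (in prime_windows) E where "E = exp (4 * A + 24)"

lemma (in prime_windows) E_ge_1: "E \<ge> 1"
  using A_ge_1 by (simp add: E_def)

context decay
begin

text \<open>A dilation e below the threshold E is traded for one by E from the smaller point X' = e
  X / E <= X, at the cost of a factor E.\<close>

lemma Psi_dilate:
  assumes "e \<ge> 1" "1 \<le> X" "e * X \<le> x"
  shows "Psi (e * X) y \<le> 2 * E * e * Psi X y"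
proof -
  have P1: "Psi X y \<ge> 1" using assms by (intro Psi_ge_1)
  consider "e \<ge> E" | "e < E" "e * X < E" | "e < E" "e * X \<ge> E" by linarith
  thus ?thesis
  proof cases
    case 1
    have "ln e \<ge> ln E" using 1 E_ge_1 by (intro ln_mono) auto
    hence "Psi (e * X) y \<le> 2 * e * Psi X y" using assms by (intro Psi_dilate_large) (auto simp: E_def)
    also have "\<dots> \<le> E * (2 * e * Psi X y)" using assms E_ge_1 mult_right_mono[of 1 E "2 * e * Psi X y"] by simp
    finally show ?thesis by (simp add: mult_ac)
  next
    case 2
    have "Psi (e * X) y \<le> e * X" using assms by (intro Psi_le) auto
    also have "\<dots> \<le> E * 1 * 1" using 2 by simp
    also have "\<dots> \<le> E * (2 * e) * Psi X y" using assms E_ge_1 P1 by (intro mult_mono) auto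
    finally show ?thesis by (simp add: mult_ac)
  next
    case 3
    define X' where "X' = e * X / E"
    have X': "1 \<le> X'" "E * X' = e * X" using 3 E_ge_1 by (auto simp: X'_def)
    have "X' \<le> X"
    proof -
      have "e * X \<le> E * X" using 3 assms by (intro mult_right_mono) auto
      thus ?thesis using E_ge_1 by (simp add: X'_def field_simps)
    qed
    have "Psi (E * X') y \<le> 2 * E * Psi X' y"
      using X' assms E_ge_1 by (intro Psi_dilate_large) (auto simp: E_def)
    also have "\<dots> \<le> 2 * E * Psi X y" using \<open>X' \<le> X\<close> E_ge_1 by (intro mult_left_mono Psi_mono) auto
    also have "\<dots> \<le> e * (2 * E * Psi X y)"
      using assms E_ge_1 mult_right_mono[of 1 e "2 * E * Psi X y"] by simp
    finally show ?thesis using X' by (simp add: mult_ac)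
  qed
qed

text \<open>A converse to \<open>Psi_step\<close> up to a factor ln y. Every term of the expansion
  at x is compared with Q = \<Psi>(x / y, y): by dilation if p^j <= y, by decay if p^j > y. The
  factor ln y is the size of the sum of ln p / p up to y.\<close>

lemma Psi_step_lower:
  assumes "y \<le> x" "ln x \<ge> 8 * A" "ln y \<ge> 1"
  shows "ln x / ((16 * E + 48 * A) * y * ln y) * Psi x y \<le> Psi (x / y) y"
proof -
  obtain J where J: "x < 2 ^ J" using real_arch_pow[of 2 x] by auto
  hence J: "x < 2 ^ Suc J" by (rule less_le_trans) auto
  let ?P = "primes_in 0 y"
  define Q where "Q = Psi (x / y) y"
  have Q0: "Q \<ge> 0" by (simp add: Q_def)
  have "Psi x y * (ln x - 4 * A) \<le> (\<Sum>n\<in>smooth_upto x y. ln (real n))"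
    using x_ge by (intro sum_ln_smooth_ge) auto
  also have "\<dots> = (\<Sum>p\<in>?P. \<Sum>j=1..J. ln (real p) * Psi (x / real p ^ j) y)"
    by (rule sum_ln_smooth[OF J])
  also have "\<dots> \<le> (\<Sum>p\<in>?P. \<Sum>j=1..J. 2 * E * y * Q * (ln (real p) * (1 / real p) ^ j) +
        A * Q * (ln (real p) * (if real p ^ j > y then sqrt (y / real p ^ j) else 0)))"
  proof (intro sum_mono)
    fix p j assume p: "p \<in> ?P" and j: "j \<in> {1..J}"
    have p2: "real p \<ge> 2" using p by (auto dest: primes_inD)
    have "Psi (x / real p ^ j) y \<le> 2 * E * y * Q * (1 / real p) ^ j +
        A * Q * (if real p ^ j > y then sqrt (y / real p ^ j) else 0)"
    proof (cases "real p ^ j > y")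
      case True
      have "Psi (x / real p ^ j) y = Psi ((x / y) / (real p ^ j / y)) y" using y_ge by simp
      also have "\<dots> \<le> A * (real p ^ j / y) powr (-\<gamma>) * Q" unfolding Q_def
        using True y_ge by (intro Psi_decay div_y_le) auto
      also have "\<dots> \<le> A * (real p ^ j / y) powr (-(1/2)) * Q"
        using A_ge_1 \<gamma> Q0 True y_ge by (intro mult_right_mono mult_left_mono powr_mono) auto
      also have "(real p ^ j / y) powr (-(1/2)) = sqrt (y / real p ^ j)"
        using True y_ge p2 by (simp add: powr_minus powr_half_sqrt real_sqrt_divide field_simps)
      finally show ?thesis using True Q0 E_ge_1 y_ge p2 by (simp add: mult_ac add_increasing)
    next
      case False
      have "Psi ((y / real p ^ j) * (x / y)) y \<le> 2 * E * (y / real p ^ j) * Q" unfolding Q_def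
      proof (rule Psi_dilate)
        show "1 \<le> y / real p ^ j" "1 \<le> x / y" using False p2 y_ge assms by auto
        have "x / real p ^ j \<le> x / 1" using p2 x_ge by (intro divide_left_mono) auto
        thus "y / real p ^ j * (x / y) \<le> x" using y_ge by simp
      qed
      thus ?thesis using False y_ge p2 by (simp add: power_divide mult_ac)
    qed
    hence "ln (real p) * Psi (x / real p ^ j) y \<le> ln (real p) * (2 * E * y * Q * (1 / real p) ^ j +
        A * Q * (if real p ^ j > y then sqrt (y / real p ^ j) else 0))"
      using p2 by (intro mult_left_mono) auto
    thus "ln (real p) * Psi (x / real p ^ j) y \<le> 2 * E * y * Q * (ln (real p) * (1 / real p) ^ j) +
        A * Q * (ln (real p) * (if real p ^ j > y then sqrt (y / real p ^ j) else 0))"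
      by (simp add: algebra_simps)
  qed
  also have "\<dots> = 2 * E * y * Q * (\<Sum>p\<in>?P. ln (real p) * (\<Sum>j=1..J. (1 / real p) ^ j)) +
        A * Q * (\<Sum>p\<in>?P. ln (real p) * (\<Sum>j=1..J. if real p ^ j > y then sqrt (y / real p ^ j) else 0))"
    by (simp only: sum.distrib sum_distrib_left)
  also have "\<dots> \<le> 2 * E * y * Q * (4 * ln y) + A * Q * (24 * y)"
  proof (intro add_mono mult_left_mono)
    have "(\<Sum>p\<in>?P. ln (real p) * (\<Sum>j=1..J. (1 / real p) ^ j)) \<le> (\<Sum>p\<in>?P. ln (real p) * (2 * (1 / real p)))"
      by (intro sum_mono mult_left_mono sum_inverse_powers_le) (auto dest!: primes_inD(4) simp: field_simps)
    also have "\<dots> = 2 * (\<Sum>p\<in>?P. ln (real p) / real p)" by (simp add: sum_distrib_left mult_ac)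
    also have "\<dots> \<le> 2 * (2 * ln y)" using y_ge by (intro mult_left_mono sum_ln_div_primes_le) auto
    finally show "(\<Sum>p\<in>?P. ln (real p) * (\<Sum>j=1..J. (1 / real p) ^ j)) \<le> 4 * ln y" by simp
    show "(\<Sum>p\<in>?P. ln (real p) * (\<Sum>j=1..J. if real p ^ j > y then sqrt (y / real p ^ j) else 0)) \<le> 24 * y"
      using y_ge by (intro sum_ln_sqrt_powers_le) auto
  qed (use Q0 E_ge_1 A_ge_1 y_ge in auto)
  also have "\<dots> \<le> 2 * E * y * Q * (4 * ln y) + A * Q * (24 * y) * ln y"
    using assms(3) Q0 A_ge_1 y_ge mult_left_mono[of 1 "ln y" "A * Q * (24 * y)"] by simp
  also have "\<dots> = (8 * E + 24 * A) * y * ln y * Q" by (simp add: algebra_simps)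
  finally have *: "Psi x y * (ln x - 4 * A) \<le> (8 * E + 24 * A) * y * ln y * Q" .
  \<comment> \<open>8 A <= ln x gives ln x - 4 A >= ln x / 2, which doubles 8 E + 24 A to 16 E + 48
    A.\<close>
  have "Psi x y * (ln x / 2) \<le> Psi x y * (ln x - 4 * A)" using assms by (intro mult_left_mono) auto
  also note *
  finally have "Psi x y * ln x \<le> (16 * E + 48 * A) * y * ln y * Q" by (simp add: algebra_simps)
  moreover have "(16 * E + 48 * A) * y * ln y > 0"
    using assms(3) E_ge_1 A_ge_1 y_ge by (intro mult_pos_pos add_pos_pos) auto
  ultimately show ?thesis by (simp add: Q_def field_simps)
qed

end

section \<open>Growth of \<Psi> in the smoothness bound, by Buchstab's identity\<close>

lemma Psi_Suc:
  "Psi x (real (Suc w)) =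
     Psi x (real w) + (if prime (Suc w) then Psi (x / real (Suc w)) (real (Suc w)) else 0)"
proof -
  let ?S = "smooth_upto x (real (Suc w))"
  have *: "smooth_upto x (real w) = {n\<in>?S. \<not> (prime (Suc w) \<and> Suc w dvd n)}"
  proof (intro equalityI subsetI)
    fix n assume n: "n \<in> smooth_upto x (real w)"
    have "p \<le> w" if "prime p" "p dvd n" for p
      using n that by (auto simp: smooth_upto_def)
    hence "\<not> (prime (Suc w) \<and> Suc w dvd n)" "\<And>p. prime p \<Longrightarrow> p dvd n \<Longrightarrow> p \<le> Suc w"
      using not_less_eq_eq le_SucI by blast+
    thus "n \<in> {n\<in>?S. \<not> (prime (Suc w) \<and> Suc w dvd n)}"
      using n unfolding smooth_upto_def of_nat_le_iff by blast
  next
    fix n assume n: "n \<in> {n\<in>?S. \<not> (prime (Suc w) \<and> Suc w dvd n)}"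
    have "p \<le> w" if "prime p" "p dvd n" for p
    proof -
      have "p \<le> Suc w" using that n unfolding smooth_upto_def of_nat_le_iff by blast
      moreover have "p \<noteq> Suc w" using that n by auto
      ultimately show ?thesis by simp
    qed
    thus "n \<in> smooth_upto x (real w)" using n unfolding smooth_upto_def of_nat_le_iff by blast
  qed
  show ?thesis
  proof (cases "prime (Suc w)")
    case True
    have "?S = smooth_upto x (real w) \<union> {n\<in>?S. Suc w dvd n}"
      "smooth_upto x (real w) \<inter> {n\<in>?S. Suc w dvd n} = {}"
      using * True by auto
    hence "card ?S = card (smooth_upto x (real w)) + card {n\<in>?S. Suc w dvd n}"
      by (metis (no_types, lifting) card_Un_disjoint finite_Un finite_smooth_upto)
    thus ?thesis
      using card_smooth_prime_power_multiples[OF True, of "real (Suc w)" x 1] True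
      by (simp add: Psi_eq_card)
  next
    case False
    thus ?thesis using * by (simp add: Psi_eq_card)
  qed
qed

context prime_windows
begin

text \<open>For \<gamma> = 1/2 + 3 / (2 ln y) one has y^\<gamma> = sqrt y e^(3/2), and e^(3/2) < 5,
  so the last condition yields ln x / (c y) <= y^(-\<gamma>). The condition ln y >= 6 yields
  \<gamma> <= 3/4.\<close>

definition reg :: "real \<Rightarrow> real \<Rightarrow> bool" where
  "reg x y \<longleftrightarrow> 1 \<le> x \<and> 0 < y \<and> 6 \<le> ln y \<and> 5 / c * ln x \<le> sqrt y"

lemma reg_mono:
  assumes "reg x y" "y \<le> y'"
  shows "reg x y'"
proof -
  have "ln y \<le> ln y'" "sqrt y \<le> sqrt y'" using assms by (auto simp: reg_def intro: ln_mono)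
  thus ?thesis using assms by (auto simp: reg_def intro: order_trans)
qed

lemma reg_decay:
  assumes "reg x y"
  shows "decay c K x y (ln x / (c * y)) (1 / 2 + 3 / (2 * ln y))"
proof unfold_locales
  have y: "0 < y" "6 \<le> ln y" "1 \<le> x" "5 / c * ln x \<le> sqrt y" using assms by (auto simp: reg_def)
  have "ln y \<le> y - 1" using y by (intro ln_le_minus_one)
  thus y2: "2 \<le> y" using y by linarith
  show "1 \<le> x" by fact
  have "3 / (2 * ln y) \<le> 3 / (2 * 6)" using y y2 by (intro divide_left_mono mult_left_mono mult_pos_pos) auto
  thus "1 / 2 + 3 / (2 * ln y) \<le> 3 / 4" by simp
  show "1 / 2 \<le> 1 / 2 + 3 / (2 * ln y)" using y y2 by simp
  show "0 \<le> ln x / (c * y)" using y c_pos by simp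
  have e: "exp (3 / 2) \<le> (5::real)"
  proof -
    have "(exp (3 / 2) :: real)\<^sup>2 = exp 1 ^ 3"
      by (simp flip: exp_of_nat_mult exp_double)
    also have "\<dots> \<le> (272 / 100) ^ 3" using e_less_272 by (intro power_mono) auto
    also have "\<dots> \<le> 5\<^sup>2" by (simp add: power2_eq_square power3_eq_cube)
    finally show ?thesis by (rule power2_le_imp_le) auto
  qed
  have "y powr (3 / (2 * ln y)) = exp (3 / 2)" using y y2 by (simp add: powr_def)
  hence "y powr (-(1 / 2 + 3 / (2 * ln y))) = 1 / (sqrt y * exp (3 / 2))"
    using y by (simp only: powr_minus powr_add powr_half_sqrt inverse_eq_divide)
  also have "\<dots> \<ge> 1 / (sqrt y * 5)" using y e by (intro divide_left_mono mult_left_mono) auto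
  also have "1 / (sqrt y * 5) = sqrt y / (5 * y)"
    using y real_sqrt_mult_self[of y] by (simp add: field_simps del: real_sqrt_mult_self)
  also have "ln x / (c * y) \<le> sqrt y / (5 * y)"
    using y c_pos by (simp add: field_simps)
  finally show "ln x / (c * y) \<le> y powr (-(1 / 2 + 3 / (2 * ln y)))" .
  show "Psi (X / y) y \<le> ln x / (c * y) * Psi X y" if "X \<le> x" for X
    using that y y2 by (intro Psi_step) auto
qed

definition C4 :: real where "C4 = 16 * E + 48 * A"

lemma C4_pos: "C4 > 0" using E_ge_1 A_ge_1 by (simp add: C4_def)

text \<open>By Buchstab and the lower bound for \<Psi>(x / w, w), leaving out a prime w removes at
  least the proportion t = ln x / (C4 w ln w) of \<Psi>(x, w); then 1 - t <= exp (-t).\<close>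

lemma Psi_ratio_nat:
  assumes "reg x (real m)" "ln x \<ge> 8 * A" "m \<le> n" "real n \<le> x"
  shows "Psi x (real m) \<le>
           exp (- (\<Sum>p\<in>primes_in (real m) (real n). ln x / (C4 * real p * ln (real p)))) * Psi x (real n)"
  using assms(3,4)
proof (induction n rule: dec_induct)
  case base
  have "primes_in (real m) (real m) = {}" by (auto simp: primes_in_def)
  thus ?case by simp
next
  case (step n)
  note mn = step(1)
  have IH: "Psi x (real m) \<le>
       exp (- (\<Sum>p\<in>primes_in (real m) (real n). ln x / (C4 * real p * ln (real p)))) * Psi x (real n)"
    using step by auto
  show ?case
  proof (cases "prime (Suc n)")
    case False
    have "primes_in (real m) (real (Suc n)) = primes_in (real m) (real n)"
      using False unfolding primes_in_def of_nat_le_iff le_Suc_eq by auto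
    moreover have "Psi x (real (Suc n)) = Psi x (real n)" using Psi_Suc[of x n] False by simp
    ultimately show ?thesis using IH by (simp only:)
  next
    case True
    define w where "w = real (Suc n)"
    define t where "t = ln x / (C4 * w * ln w)"
    have rw: "reg x w" by (rule reg_mono[OF assms(1)]) (use step in \<open>simp add: w_def\<close>)
    interpret decay c K x w "ln x / (c * w)" "1 / 2 + 3 / (2 * ln w)" by (rule reg_decay[OF rw])
    have "t * Psi x w \<le> Psi (x / w) w" unfolding t_def C4_def
      using assms(2) step.prems rw by (intro Psi_step_lower) (auto simp: w_def reg_def)
    hence "Psi x (real n) \<le> (1 - t) * Psi x w"
      using Psi_Suc[of x n] True by (simp add: w_def algebra_simps)
    also have "\<dots> \<le> exp (- t) * Psi x w"
      using exp_ge_add_one_self[of "-t"] by (intro mult_right_mono) auto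
    finally have 1: "Psi x (real n) \<le> exp (- t) * Psi x w" .
    have "primes_in (real m) (real (Suc n)) = insert (Suc n) (primes_in (real m) (real n))"
      using True mn unfolding primes_in_def of_nat_le_iff of_nat_less_iff le_Suc_eq by auto
    moreover have "Suc n \<notin> primes_in (real m) (real n)" by (auto simp: primes_in_def)
    ultimately have 2: "(\<Sum>p\<in>primes_in (real m) (real (Suc n)). ln x / (C4 * real p * ln (real p))) =
        t + (\<Sum>p\<in>primes_in (real m) (real n). ln x / (C4 * real p * ln (real p)))"
      by (simp add: t_def w_def)
    note IH
    also have "exp (- (\<Sum>p\<in>primes_in (real m) (real n). ln x / (C4 * real p * ln (real p)))) * Psi x (real n) \<le>
       exp (- (\<Sum>p\<in>primes_in (real m) (real n). ln x / (C4 * real p * ln (real p)))) * (exp (- t) * Psi x w)"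
      by (intro mult_left_mono 1) auto
    also have "\<dots> = exp (- (\<Sum>p\<in>primes_in (real m) (real (Suc n)). ln x / (C4 * real p * ln (real p)))) * Psi x w"
      unfolding 2 by (simp add: exp_diff exp_minus field_simps)
    finally show ?thesis by (simp only: w_def)
  qed
qed

text \<open>Each of the m windows (P / K, P] contributes at least c: its weights ln p sum to at
  least c P, and p <= P throughout.\<close>

lemma sum_ln_div_window_ge:
  assumes "y \<ge> 2"
  shows "c * real m \<le> (\<Sum>p\<in>primes_in y (y * K ^ m). ln (real p) / real p)"
proof (induction m)
  case (Suc m)
  define P where "P = y * K ^ Suc m"
  have K1: "1 \<le> K ^ i" for i using K_ge by (intro one_le_power) auto
  have P: "P \<ge> 2" using assms mult_mono[of 2 y 1 "K ^ Suc m"] K1[of "Suc m"] by (simp add: P_def)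
  have PK: "P / K = y * K ^ m" using K_ge by (simp add: P_def)
  have y1: "y \<le> y * K ^ m" using assms K1[of m] by simp
  have y2: "y * K ^ m \<le> P" unfolding PK[symmetric] using P K_ge by (simp add: field_simps)
  have "c = c * P / P" using P by simp
  also have "\<dots> \<le> (\<Sum>p\<in>primes_in (P / K) P. ln (real p)) / P"
    using P by (intro divide_right_mono window) auto
  also have "\<dots> = (\<Sum>p\<in>primes_in (P / K) P. ln (real p) / P)" by (rule sum_divide_distrib)
  also have "\<dots> \<le> (\<Sum>p\<in>primes_in (P / K) P. ln (real p) / real p)"
  proof (intro sum_mono divide_left_mono)
    fix p assume "p \<in> primes_in (P / K) P"
    hence p: "p \<ge> 2" "real p \<le> P" by (auto dest: primes_inD)
    show "real p \<le> P" "0 \<le> ln (real p)" using p by auto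
    show "0 < P * real p" using p P by (intro mult_pos_pos) auto
  qed
  finally have "c \<le> (\<Sum>p\<in>primes_in (y * K ^ m) P. ln (real p) / real p)" by (simp only: PK)
  moreover have "primes_in y P = primes_in y (y * K ^ m) \<union> primes_in (y * K ^ m) P"
    "primes_in y (y * K ^ m) \<inter> primes_in (y * K ^ m) P = {}"
    using y1 y2 by (auto simp: primes_in_def)
  hence "(\<Sum>p\<in>primes_in y P. ln (real p) / real p) = (\<Sum>p\<in>primes_in y (y * K ^ m). ln (real p) / real p) +
     (\<Sum>p\<in>primes_in (y * K ^ m) P. ln (real p) / real p)" by (simp add: sum.union_disjoint)
  ultimately show ?case using Suc unfolding P_def by (simp add: algebra_simps)
next
  case 0
  have "primes_in y y = {}" by (auto simp: primes_in_def)
  thus ?case by simp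
qed

text \<open>The exponent comes from 1 / (p ln p) >= (ln p / p) / (ln Y)^2 for p <= Y. Regularity is
  asked at y - 1 because the product over integers starts from the floor of y.\<close>

lemma Psi_ratio:
  assumes "reg x (y - 1)" "ln x \<ge> 8 * A" "y * K ^ m \<le> Y" "Y \<le> x"
  shows "Psi x y \<le> exp (- (c / C4 * real m * ln x / (ln Y)\<^sup>2)) * Psi x Y"
proof -
  have r: "0 < y - 1" "1 \<le> x" "6 \<le> ln (y - 1)" using assms by (auto simp: reg_def)
  have y2: "y \<ge> 2" using ln_le_minus_one[of "y - 1"] r by linarith
  have K1: "1 \<le> K ^ m" using K_ge by (intro one_le_power) auto
  have yY: "y \<le> Y" 
  proof -
    have "y * 1 \<le> y * K ^ m" using y2 by (intro mult_left_mono K1) auto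
    thus ?thesis using assms(3) by linarith
  qed
  define u v where "u = nat \<lfloor>y\<rfloor>" and "v = nat \<lfloor>Y\<rfloor>"
  have u: "y - 1 \<le> real u" unfolding u_def by (rule real_nat_floor_ge)
  have uv: "u \<le> v" unfolding u_def v_def using yY by (intro nat_mono floor_mono)
  have vx: "real v \<le> x" using assms y2 yY by (simp add: v_def) linarith
  have ru: "reg x (real u)" by (rule reg_mono[OF assms(1) u])
  have lnY: "ln Y > 0" using y2 yY by simp
  have "c / C4 * real m * ln x / (ln Y)\<^sup>2 \<le>
          ln x / (C4 * (ln Y)\<^sup>2) * (\<Sum>p\<in>primes_in y (y * K ^ m). ln (real p) / real p)"
    using mult_left_mono[OF sum_ln_div_window_ge[OF y2, of m], of "ln x / (C4 * (ln Y)\<^sup>2)"] r C4_pos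
    by (simp add: field_simps)
  also have "\<dots> \<le> ln x / (C4 * (ln Y)\<^sup>2) * (\<Sum>p\<in>primes_in y Y. ln (real p) / real p)"
    using r C4_pos assms(3)
    by (intro mult_left_mono sum_mono2 finite_primes_in)
       (auto simp: primes_in_def intro!: divide_nonneg_nonneg ln_ge_zero dest: prime_ge_1_nat)
  also have "\<dots> = (\<Sum>p\<in>primes_in y Y. ln x / (C4 * (ln Y)\<^sup>2) * (ln (real p) / real p))"
    by (rule sum_distrib_left)
  also have "\<dots> \<le> (\<Sum>p\<in>primes_in y Y. ln x / (C4 * real p * ln (real p)))"
  proof (rule sum_mono)
    fix p assume p: "p \<in> primes_in y Y"
    hence p': "real p \<ge> 2" "real p \<le> Y" by (auto dest: primes_inD)
    have l: "0 < ln (real p)" "ln (real p) \<le> ln Y" using p' by auto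
    have "ln (real p) * ln (real p) \<le> (ln Y)\<^sup>2" using l unfolding power2_eq_square by (intro mult_mono) auto
    hence "ln (real p) / (ln Y)\<^sup>2 \<le> 1 / ln (real p)" using l lnY by (simp add: field_simps)
    hence "ln x / (C4 * real p) * (ln (real p) / (ln Y)\<^sup>2) \<le> ln x / (C4 * real p) * (1 / ln (real p))"
      using r C4_pos p' by (intro mult_left_mono) auto
    thus "ln x / (C4 * (ln Y)\<^sup>2) * (ln (real p) / real p) \<le> ln x / (C4 * real p * ln (real p))"
      by (simp add: mult_ac)
  qed
  finally have *: "c / C4 * real m * ln x / (ln Y)\<^sup>2 \<le> (\<Sum>p\<in>primes_in y Y. ln x / (C4 * real p * ln (real p)))" .
  have "Psi x (real u) \<le> exp (- (\<Sum>p\<in>primes_in (real u) (real v). ln x / (C4 * real p * ln (real p)))) * Psi x (real v)"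
    by (rule Psi_ratio_nat[OF ru assms(2) uv vx])
  also have "primes_in (real u) (real v) = primes_in y Y"
    unfolding u_def v_def by (rule primes_in_floor) (use y2 yY in auto)
  also have "Psi x (real u) = Psi x y" unfolding u_def by (rule Psi_floor) (use y2 in auto)
  also have "Psi x (real v) = Psi x Y" unfolding v_def by (rule Psi_floor) (use y2 yY in auto)
  also have "exp (- (\<Sum>p\<in>primes_in y Y. ln x / (C4 * real p * ln (real p)))) * Psi x Y \<le>
     exp (- (c / C4 * real m * ln x / (ln Y)\<^sup>2)) * Psi x Y"
    using * by (intro mult_right_mono) auto
  finally show ?thesis .
qed

end

section \<open>Ordered factorizations\<close>

definition rough_part :: "real \<Rightarrow> nat \<Rightarrow> nat" where
  "rough_part y n = prod_mset (filter_mset (\<lambda>p. y < real p) (prime_factorization n))"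

lemma prime_factorization_rough_part:
  "prime_factorization (rough_part y n) = filter_mset (\<lambda>p. y < real p) (prime_factorization n)"
  unfolding rough_part_def by (rule prime_factorization_prod_mset_primes) auto

lemma rough_part_mult:
  assumes "a > 0" "b > 0"
  shows "rough_part y (a * b) = rough_part y a * rough_part y b"
  using assms by (simp add: rough_part_def prime_factorization_mult)

lemma rough_part_1 [simp]: "rough_part y 1 = 1" "rough_part y (Suc 0) = 1"
  by (simp_all add: rough_part_def)

lemma rough_part_decompose:
  assumes "n > 0"
  obtains m where "n = rough_part y n * m" "m > 0" "\<And>p. prime p \<Longrightarrow> p dvd m \<Longrightarrow> real p \<le> y"
proof -
  define m where "m = prod_mset (filter_mset (\<lambda>p. \<not> y < real p) (prime_factorization n))"
  have "n = prod_mset (prime_factorization n)" using assms by (simp add: prod_mset_prime_factorization_nat)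
  also have "\<dots> = rough_part y n * m"
    unfolding rough_part_def m_def prod_mset.union[symmetric] multiset_partition[symmetric] ..
  finally have n: "n = rough_part y n * m" .
  have pf: "prime_factorization m = filter_mset (\<lambda>p. \<not> y < real p) (prime_factorization n)"
    unfolding m_def by (rule prime_factorization_prod_mset_primes) auto
  have "m > 0" using n assms by (cases m) auto
  moreover have "real p \<le> y" if "prime p" "p dvd m" for p
  proof -
    have "p \<in> prime_factors m" using that \<open>m > 0\<close> by (simp add: in_prime_factors_iff)
    thus ?thesis using pf by auto
  qed
  ultimately show ?thesis using that n by blast
qed

lemma rough_part_pos: "n > 0 \<Longrightarrow> rough_part y n > 0"
  by (metis rough_part_decompose gr0I mult_zero_left)

lemma rough_part_le: "n > 0 \<Longrightarrow> rough_part y n \<le> n"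
  by (metis rough_part_decompose dvd_imp_le dvd_triv_left)

lemma prime_dvd_rough_part:
  assumes "n > 0" "prime p" "p dvd rough_part y n"
  shows "y < real p"
proof -
  have "p \<in> prime_factors (rough_part y n)"
    using assms rough_part_pos[of n y] by (simp add: in_prime_factors_iff)
  thus ?thesis by (simp add: prime_factorization_rough_part)
qed

lemma rough_part_eq_1_iff:
  assumes "n > 0"
  shows "rough_part y n = 1 \<longleftrightarrow> (\<forall>p. prime p \<and> p dvd n \<longrightarrow> real p \<le> y)"
proof
  assume "rough_part y n = 1"
  thus "\<forall>p. prime p \<and> p dvd n \<longrightarrow> real p \<le> y"
    using rough_part_decompose[OF assms, of y] by (metis mult_1)
next
  assume *: "\<forall>p. prime p \<and> p dvd n \<longrightarrow> real p \<le> y"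
  have "filter_mset (\<lambda>p. y < real p) (prime_factorization n) = {#}"
    unfolding set_mset_eq_empty_iff[symmetric] using * by (auto simp: in_prime_factors_iff not_less)
  thus "rough_part y n = 1" unfolding rough_part_def by (simp only: prod_mset_empty)
qed

section \<open>Ordered factorizations as coefficients of k-th powers\<close>

lemma dvd_div_pos: "D > (0::nat) \<Longrightarrow> d dvd D \<Longrightarrow> D div d > 0"
  by (auto elim!: dvdE intro!: gr0I)

lemma sum_multiples_reindex:
  assumes "n > (0::nat)"
  shows "(\<Sum>N\<in>{N\<in>{1..Z}. n dvd N \<and> Q N}. f N) = (\<Sum>M\<in>{M\<in>{1..Z div n}. Q (n * M)}. f (n * M))"
proof (rule sum.reindex_bij_witness[of _ "\<lambda>M. n * M" "\<lambda>N. N div n"])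
  fix N assume "N \<in> {N\<in>{1..Z}. n dvd N \<and> Q N}"
  thus "n * (N div n) = N" "N div n \<in> {M\<in>{1..Z div n}. Q (n * M)}" "f (n * (N div n)) = f N"
    using assms by (auto simp: div_le_mono Suc_le_eq div_greater_zero_iff dvd_imp_le)
next
  fix M assume "M \<in> {M\<in>{1..Z div n}. Q (n * M)}"
  thus "n * M div n = M" "n * M \<in> {N\<in>{1..Z}. n dvd N \<and> Q N}"
    using assms by (auto simp: less_eq_div_iff_mult_less_eq mult.commute)
qed

text \<open>For \<open>B = UNIV\<close> this is the \<open>k\<close>-fold divisor function.\<close>

fun prod_reps :: "nat set \<Rightarrow> nat \<Rightarrow> nat \<Rightarrow> real" where
  "prod_reps B 0 N = (if N = 1 then 1 else 0)"
| "prod_reps B (Suc k) N = (\<Sum>n\<in>{n\<in>B. n dvd N}. prod_reps B k (N div n))"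

lemma prod_reps_nonneg: "prod_reps B k N \<ge> 0"
  by (induction k arbitrary: N) (auto intro!: sum_nonneg)

text \<open>Multiplying out the k-th power collects each product N as often as it has ordered
  factorizations into k elements of \<open>B\<close>; all products are at most X^k <= Z, so the
  range of N misses none.\<close>

lemma power_sum_eq_prod_reps:
  fixes \<xi> :: "nat \<Rightarrow> complex"
  assumes mult: "\<And>m n. \<xi> (m * n) = \<xi> m * \<xi> n" and one: "\<xi> 1 = 1"
    and B: "B \<subseteq> {1..X}" and Z: "X ^ k \<le> Z"
  shows "(\<Sum>n\<in>B. \<xi> n) ^ k = (\<Sum>N=1..Z. of_real (prod_reps B k N) * \<xi> N)"
  using Z
proof (induction k arbitrary: Z)
  case 0
  have "(\<Sum>N=1..Z. of_real (prod_reps B 0 N) * \<xi> N) = (\<Sum>N\<in>{1..Z}. if N = 1 then \<xi> 1 else 0)"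
    by (intro sum.cong) auto
  thus ?case using 0 one by (simp add: sum.delta)
next
  case (Suc k)
  have finB: "finite B" using B finite_subset by blast
  have "(\<Sum>N=1..Z. of_real (prod_reps B (Suc k) N) * \<xi> N) =
        (\<Sum>N=1..Z. \<Sum>n\<in>B. if n dvd N then of_real (prod_reps B k (N div n)) * \<xi> N else 0)"
    using finB by (simp add: sum_distrib_right sum.If_cases Int_def conj_commute)
  also have "\<dots> = (\<Sum>n\<in>B. \<Sum>N=1..Z. if n dvd N then of_real (prod_reps B k (N div n)) * \<xi> N else 0)"
    by (rule sum.swap)
  also have "\<dots> = (\<Sum>n\<in>B. \<xi> n * (\<Sum>n\<in>B. \<xi> n) ^ k)"
  proof (rule sum.cong[OF refl])
    fix n assume "n \<in> B"
    hence n: "n > 0" "n \<le> X" using B by auto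
    have "X ^ k * n \<le> X ^ k * X" using n by simp
    also have "\<dots> \<le> Z" using Suc.prems by (simp add: mult.commute)
    finally have "X ^ k * n \<le> Z" .
    hence Zn: "X ^ k \<le> Z div n" using n by (simp add: less_eq_div_iff_mult_less_eq)
    have "(\<Sum>N=1..Z. if n dvd N then of_real (prod_reps B k (N div n)) * \<xi> N else 0) =
          (\<Sum>N\<in>{N\<in>{1..Z}. n dvd N \<and> True}. of_real (prod_reps B k (N div n)) * \<xi> N)"
      by (simp add: sum.If_cases Int_def conj_commute)
    also have "\<dots> = (\<Sum>M\<in>{1..Z div n}. of_real (prod_reps B k M) * \<xi> (n * M))"
      using n by (subst sum_multiples_reindex) (auto intro!: sum.cong)
    also have "\<dots> = \<xi> n * (\<Sum>M=1..Z div n. of_real (prod_reps B k M) * \<xi> M)"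
      by (simp add: mult sum_distrib_left mult_ac)
    also have "\<dots> = \<xi> n * (\<Sum>n\<in>B. \<xi> n) ^ k" using Suc.IH[OF Zn] by simp
    finally show "(\<Sum>N=1..Z. if n dvd N then of_real (prod_reps B k (N div n)) * \<xi> N else 0) =
       \<xi> n * (\<Sum>n\<in>B. \<xi> n) ^ k" .
  qed
  finally show ?case by (simp add: sum_distrib_right)
qed

text \<open>A divisor of p D is a divisor of D or p times one; in terms of factorizations, the
  additional prime goes into one of the k factors.\<close>

lemma prod_reps_UNIV_prime_mult:
  assumes "prime p" "D > 0"
  shows "prod_reps UNIV k (p * D) \<le> real k * prod_reps UNIV k D"
  using assms(2)
proof (induction k arbitrary: D)
  case 0
  have "p * D \<noteq> 1" using assms(1) by auto
  thus ?case by simp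
next
  case (Suc k)
  have fin: "finite {d. d dvd D}" using Suc.prems by simp
  have "{d. d dvd p * D} \<subseteq> {d. d dvd D} \<union> (\<lambda>d. p * d) ` {d. d dvd D}"
  proof
    fix d assume d: "d \<in> {d. d dvd p * D}"
    show "d \<in> {d. d dvd D} \<union> (\<lambda>d. p * d) ` {d. d dvd D}"
    proof (cases "p dvd d")
      case True
      then obtain e where "d = p * e" by auto
      thus ?thesis using d assms(1) by auto
    next
      case False
      hence "coprime d p" using assms(1) prime_imp_coprime coprime_commute by blast
      thus ?thesis using d by (auto simp: coprime_dvd_mult_right_iff)
    qed
  qed
  hence "prod_reps UNIV (Suc k) (p * D) \<le> (\<Sum>d\<in>{d. d dvd D} \<union> (\<lambda>d. p * d) ` {d. d dvd D}. prod_reps UNIV k (p * D div d))"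
    using fin by (auto intro!: sum_mono2 prod_reps_nonneg)
  also have "\<dots> \<le> (\<Sum>d\<in>{d. d dvd D}. prod_reps UNIV k (p * D div d)) +
      (\<Sum>d\<in>(\<lambda>d. p * d) ` {d. d dvd D}. prod_reps UNIV k (p * D div d))"
    using fin by (subst sum.union_inter[symmetric]) (auto intro!: sum_nonneg prod_reps_nonneg)
  also have "(\<Sum>d\<in>(\<lambda>d. p * d) ` {d. d dvd D}. prod_reps UNIV k (p * D div d)) = 
      (\<Sum>d\<in>{d. d dvd D}. prod_reps UNIV k (D div d))"
    using assms(1) by (subst sum.reindex) (auto simp: inj_on_def)
  also have "(\<Sum>d\<in>{d. d dvd D}. prod_reps UNIV k (p * D div d)) \<le>
      (\<Sum>d\<in>{d. d dvd D}. real k * prod_reps UNIV k (D div d))"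
  proof (rule sum_mono)
    fix d assume d: "d \<in> {d. d dvd D}"
    hence "p * D div d = p * (D div d)" "D div d > 0" 
      using Suc.prems by (auto simp: div_mult_swap elim!: dvdE)
    thus "prod_reps UNIV k (p * D div d) \<le> real k * prod_reps UNIV k (D div d)"
      using Suc.IH by simp
  qed
  finally show ?case by (simp add: sum_distrib_left algebra_simps sum.distrib)
qed

definition bigomega :: "nat \<Rightarrow> nat" where "bigomega n = size (prime_factorization n)"

lemma bigomega_mult: "a > 0 \<Longrightarrow> b > 0 \<Longrightarrow> bigomega (a * b) = bigomega a + bigomega b"
  by (simp add: bigomega_def prime_factorization_mult)

lemma bigomega_prime: "prime p \<Longrightarrow> bigomega p = 1"
  by (simp add: bigomega_def prime_factorization_prime)

lemma bigomega_1 [simp]: "bigomega 1 = 0" "bigomega (Suc 0) = 0"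
  by (simp_all add: bigomega_def)

lemma nat_prime_induct [consumes 1, case_names one prime]:
  assumes "n > (0::nat)" "P 1" "\<And>p m. prime p \<Longrightarrow> m > 0 \<Longrightarrow> P m \<Longrightarrow> P (p * m)"
  shows "P n"
  using assms(1)
proof (induction n rule: less_induct)
  case (less n)
  show ?case
  proof (cases "n = 1")
    case False
    then obtain p where p: "prime p" "p dvd n" using prime_factor_nat by blast
    then obtain m where m: "n = p * m" by auto
    have "m > 0" using m less.prems by (cases m) auto
    moreover have "m < n" using m \<open>m > 0\<close> prime_gt_1_nat[OF p(1)] by simp
    ultimately show ?thesis using less.IH[of m] assms(3)[OF p(1), of m] m by simp
  qed (use assms(2) in simp)
qed

lemma prod_reps_UNIV_le:
  assumes "D > 0"
  shows "prod_reps UNIV k D \<le> real k ^ bigomega D"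
  using assms
proof (induction D rule: nat_prime_induct)
  case one
  have "prod_reps UNIV k (Suc 0) = 1" by (induction k) auto
  thus ?case by simp
next
  case (prime p m)
  have "prod_reps UNIV k (p * m) \<le> real k * prod_reps UNIV k m"
    by (rule prod_reps_UNIV_prime_mult) fact+
  also have "\<dots> \<le> real k * real k ^ bigomega m" using prime by (intro mult_left_mono) auto
  finally show ?case using prime by (simp add: bigomega_mult bigomega_prime prime_gt_0_nat)
qed

text \<open>The left side is the part of the expanded k-th power whose product lies in
  \<open>T\<close>. As \<open>T\<close> is closed under divisors, (D, d) -> (d, D / d) maps
  injectively into T \<times> T, and nonnegativity allows the remaining pairs to be added.\<close>

lemma sum_prod_reps_UNIV_le:
  fixes G :: "nat \<Rightarrow> real"
  assumes mult: "\<And>a b. a > 0 \<Longrightarrow> b > 0 \<Longrightarrow> G (a * b) = G a * G b" and one: "G 1 = 1"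
    and nonneg: "\<And>n. G n \<ge> 0"
    and T: "finite T" "0 \<notin> T" "\<And>d D. D \<in> T \<Longrightarrow> d dvd D \<Longrightarrow> d \<in> T"
  shows "(\<Sum>D\<in>T. G D * prod_reps UNIV k D) \<le> (\<Sum>D\<in>T. G D) ^ k"
proof (induction k)
  case 0
  have "(\<Sum>D\<in>T. G D * prod_reps UNIV 0 D) = (\<Sum>D\<in>T. if D = 1 then G 1 else 0)"
    by (intro sum.cong) auto
  thus ?case using one T(1) by (simp add: sum.delta)
next
  case (Suc k)
  have pos: "D > 0" if "D \<in> T" for D using that T(2) by (cases D) auto
  have "(\<Sum>D\<in>T. G D * prod_reps UNIV (Suc k) D) =
     (\<Sum>D\<in>T. \<Sum>d\<in>{d. d dvd D}. G D * prod_reps UNIV k (D div d))"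
    by (simp add: sum_distrib_left)
  also have "\<dots> = (\<Sum>(D, d)\<in>(SIGMA D:T. {d. d dvd D}). G D * prod_reps UNIV k (D div d))"
    using T pos by (subst sum.Sigma) auto
  also have "\<dots> = (\<Sum>(d, e)\<in>(\<lambda>(D, d). (d, D div d)) ` (SIGMA D:T. {d. d dvd D}). G d * (G e * prod_reps UNIV k e))"
  proof (subst sum.reindex)
    show "inj_on (\<lambda>(D, d). (d, D div d)) (SIGMA D:T. {d. d dvd D})"
      by (auto simp: inj_on_def) (metis dvd_mult_div_cancel)
    show "(\<Sum>(D, d)\<in>(SIGMA D:T. {d. d dvd D}). G D * prod_reps UNIV k (D div d)) =
       sum ((\<lambda>(d, e). G d * (G e * prod_reps UNIV k e)) \<circ> (\<lambda>(D, d). (d, D div d))) (SIGMA D:T. {d. d dvd D})"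
    proof (intro sum.cong refl)
      fix z assume "z \<in> (SIGMA D:T. {d. d dvd D})"
      then obtain D d where z: "z = (D, d)" "D \<in> T" "d dvd D" by auto
      have "D > 0" using pos z by auto
      hence "d > 0" "D div d > 0" using z by (auto simp: dvd_div_pos dvd_pos_nat)
      hence "G D = G d * G (D div d)" using mult[of d "D div d"] z by simp
      thus "(case z of (D, d) \<Rightarrow> G D * prod_reps UNIV k (D div d)) =
         ((\<lambda>(d, e). G d * (G e * prod_reps UNIV k e)) \<circ> (\<lambda>(D, d). (d, D div d))) z"
        by (simp add: z)
    qed
  qed
  also have "\<dots> \<le> (\<Sum>(d, e)\<in>T \<times> T. G d * (G e * prod_reps UNIV k e))"
  proof (rule sum_mono2)
    show "(\<lambda>(D, d). (d, D div d)) ` (SIGMA D:T. {d. d dvd D}) \<subseteq> T \<times> T"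
    proof clarify
      fix D d assume "D \<in> T" "d dvd D"
      thus "d \<in> T \<and> D div d \<in> T" using T(3)[of D d] T(3)[of D "D div d"] by auto
    qed
  qed (use T nonneg in \<open>auto intro!: mult_nonneg_nonneg prod_reps_nonneg\<close>)
  also have "\<dots> = (\<Sum>d\<in>T. G d) * (\<Sum>e\<in>T. G e * prod_reps UNIV k e)"
    by (simp add: sum_product sum.cartesian_product)
  also have "\<dots> \<le> (\<Sum>d\<in>T. G d) * (\<Sum>D\<in>T. G D) ^ k"
    using Suc nonneg by (intro mult_left_mono sum_nonneg) auto
  finally show ?case by simp
qed

text \<open>A finite Euler product, one prime at a time: an admissible D divisible by r is r times
  an admissible integer, so the sum S with r and the sum S' without r satisfy S <= S' + G(r) S. For
  G(r) <= 1/2 this gives S <= exp (2 G(r)) S'.\<close>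

lemma sum_multiplicative_le_exp:
  fixes G :: "nat \<Rightarrow> real"
  assumes mult: "\<And>a b. a > 0 \<Longrightarrow> b > 0 \<Longrightarrow> G (a * b) = G a * G b" and one: "G 1 = 1"
    and nonneg: "\<And>n. G n \<ge> 0"
    and Q: "finite Q" "\<And>p. p \<in> Q \<Longrightarrow> prime p \<and> G p \<le> 1/2"
  shows "(\<Sum>D\<in>{D\<in>{1..Z}. \<forall>p. prime p \<and> p dvd D \<longrightarrow> p \<in> Q}. G D) \<le> exp (2 * (\<Sum>p\<in>Q. G p))"
  using Q
proof (induction Q rule: finite_induct)
  case empty
  have "{D\<in>{1..Z}. \<forall>p. prime p \<and> p dvd D \<longrightarrow> p \<in> ({} :: nat set)} \<subseteq> {1}"
    using prime_factor_nat by fastforce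
  hence "(\<Sum>D\<in>{D\<in>{1..Z}. \<forall>p. prime p \<and> p dvd D \<longrightarrow> p \<in> ({} :: nat set)}. G D) \<le> (\<Sum>D\<in>{1}. G D)"
    using nonneg by (intro sum_mono2) auto
  thus ?case using one by simp
next
  case (insert r Q)
  define T where "T = (\<lambda>Q. {D\<in>{1..Z}. \<forall>p. prime p \<and> p dvd D \<longrightarrow> p \<in> Q})"
  have r: "prime r" "G r \<le> 1/2" using insert.prems by auto
  have fin: "finite (T Q')" for Q' by (simp add: T_def)
  have "T (insert r Q) \<subseteq> T Q \<union> (\<lambda>D. r * D) ` T (insert r Q)"
  proof
    fix D assume D: "D \<in> T (insert r Q)"
    show "D \<in> T Q \<union> (\<lambda>D. r * D) ` T (insert r Q)"
    proof (cases "r dvd D")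
      case True
      then obtain e where e: "D = r * e" by auto
      have "e \<le> D" "1 \<le> e" using D e by (auto simp: T_def Suc_le_eq)
      moreover from this have "e \<le> Z" using D by (simp add: T_def)
      ultimately have "e \<in> T (insert r Q)" using D e by (auto simp: T_def)
      thus ?thesis using e by auto
    next
      case False
      thus ?thesis using D by (auto simp: T_def)
    qed
  qed
  hence "sum G (T (insert r Q)) \<le> sum G (T Q \<union> (\<lambda>D. r * D) ` T (insert r Q))"
    using fin nonneg by (intro sum_mono2) auto
  also have "\<dots> \<le> sum G (T Q) + sum G ((\<lambda>D. r * D) ` T (insert r Q))"
    using fin nonneg by (subst sum.union_inter[symmetric]) (auto intro!: sum_nonneg)
  also have "sum G ((\<lambda>D. r * D) ` T (insert r Q)) = (\<Sum>D\<in>T (insert r Q). G (r * D))"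
    using prime_gt_0_nat[OF r(1)] by (subst sum.reindex) (auto simp: inj_on_def)
  also have "\<dots> = (\<Sum>D\<in>T (insert r Q). G r * G D)"
    using prime_gt_0_nat[OF r(1)] by (intro sum.cong mult) (auto simp: T_def)
  also have "\<dots> = G r * sum G (T (insert r Q))" by (simp add: sum_distrib_left)
  finally have "(1 - G r) * sum G (T (insert r Q)) \<le> sum G (T Q)" by (simp add: algebra_simps)
  also have "\<dots> \<le> exp (2 * (\<Sum>p\<in>Q. G p))" using insert by (simp add: T_def)
  finally have 1: "(1 - G r) * sum G (T (insert r Q)) \<le> exp (2 * (\<Sum>p\<in>Q. G p))" .
  have "1 \<le> (1 - G r) * (1 + 2 * G r)"
  proof -
    have "0 \<le> G r * (1 - 2 * G r)" using r nonneg by (intro mult_nonneg_nonneg) auto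
    thus ?thesis by (simp add: algebra_simps)
  qed
  also have "\<dots> \<le> (1 - G r) * exp (2 * G r)"
    using r by (intro mult_left_mono) (auto intro: exp_ge_add_one_self)
  finally have 2: "1 \<le> (1 - G r) * exp (2 * G r)" .
  have S0: "0 \<le> sum G (T (insert r Q))" using nonneg by (intro sum_nonneg) auto
  have "sum G (T (insert r Q)) \<le> (1 - G r) * exp (2 * G r) * sum G (T (insert r Q))"
    using mult_right_mono[OF 2 S0] by simp
  also have "\<dots> = exp (2 * G r) * ((1 - G r) * sum G (T (insert r Q)))" by simp
  also have "\<dots> \<le> exp (2 * G r) * exp (2 * (\<Sum>p\<in>Q. G p))" using 1 by (intro mult_left_mono) auto
  also have "\<dots> = exp (2 * (\<Sum>p\<in>insert r Q. G p))"
    using insert by (simp add: exp_add algebra_simps)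
  finally show ?case by (simp add: T_def)
qed

text \<open>The abstract form of the moment bound: P g(d) is a completely multiplicative majorant of
  \<Psi>(x / d, y) for rough d, and \<open>s\<close> compares the trivial count 1 with it, s < 1
  being a gain. Only d > 1 occurs, since \<open>B\<close> consists of integers that are not
  y-smooth.\<close>

context
  fixes x y P s :: real and g :: "nat \<Rightarrow> real" and X :: nat and B :: "nat set"
  assumes mult: "\<And>a b. a > 0 \<Longrightarrow> b > 0 \<Longrightarrow> g (a * b) = g a * g b" and one: "g 1 = 1"
    and nonneg: "\<And>n. g n \<ge> 0" and P0: "P \<ge> 0" and s0: "s \<ge> 0"
    and Psi_bound: "\<And>d. d > 1 \<Longrightarrow> real d \<le> x \<Longrightarrow> (\<And>p. prime p \<Longrightarrow> p dvd d \<Longrightarrow> y < real p) \<Longrightarrow>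
        Psi (x / real d) y \<le> P * g d"
    and trivial_bound: "\<And>d. d > 1 \<Longrightarrow> real d \<le> x \<Longrightarrow> (\<And>p. prime p \<Longrightarrow> p dvd d \<Longrightarrow> y < real p) \<Longrightarrow>
        1 \<le> s * P * g d"
  defines "X \<equiv> nat \<lfloor>x\<rfloor>" and "B \<equiv> {1..X} - smooth_upto x y"
begin

private lemma B_D:
  assumes "n \<in> B"
  shows "n > 0" "real n \<le> x" "rough_part y n > 1" "real (rough_part y n) \<le> x"
    "\<And>p. prime p \<Longrightarrow> p dvd rough_part y n \<Longrightarrow> y < real p"
proof -
  show n: "n > 0" using assms by (auto simp: B_def)
  have "n \<le> X" using assms by (auto simp: B_def)
  hence "int n \<le> \<lfloor>x\<rfloor>" using n unfolding X_def by linarith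
  thus nx: "real n \<le> x" by (simp add: le_floor_iff)
  have "rough_part y n \<noteq> 1"
    using assms n nx by (subst rough_part_eq_1_iff) (auto simp: B_def smooth_upto_def)
  thus "rough_part y n > 1" using rough_part_pos[OF n, of y] by linarith
  show "real (rough_part y n) \<le> x" using rough_part_le[OF n, of y] nx by linarith
  show "\<And>p. prime p \<Longrightarrow> p dvd rough_part y n \<Longrightarrow> y < real p"
    using prime_dvd_rough_part[OF n] by blast
qed

private lemma finite_B: "finite B" by (simp add: B_def)

private lemma card_rough_part_le:
  "real (card {n\<in>B. rough_part y n = d}) \<le> P * g d"
proof (cases "{n\<in>B. rough_part y n = d} = {}")
  case False
  then obtain n0 where n0: "n0 \<in> B" "rough_part y n0 = d" by auto
  have d: "d > 1" "real d \<le> x" "\<And>p. prime p \<Longrightarrow> p dvd d \<Longrightarrow> y < real p"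
    using B_D[OF n0(1)] n0(2) by auto
  have "{n\<in>B. rough_part y n = d} \<subseteq> (\<lambda>m. d * m) ` smooth_upto (x / real d) y"
  proof
    fix n assume n: "n \<in> {n\<in>B. rough_part y n = d}"
    have n0: "n > 0" "real n \<le> x" using n B_D(1,2) by auto
    obtain m where m: "n = d * m" "m > 0" "\<And>p. prime p \<Longrightarrow> p dvd m \<Longrightarrow> real p \<le> y"
      using rough_part_decompose[OF n0(1), of y] n by auto
    have "real m \<le> x / real d" using m n0 d by (simp add: field_simps)
    thus "n \<in> (\<lambda>m. d * m) ` smooth_upto (x / real d) y" using m by (auto simp: smooth_upto_def)
  qed
  hence "card {n\<in>B. rough_part y n = d} \<le> card ((\<lambda>m. d * m) ` smooth_upto (x / real d) y)"
    by (intro card_mono finite_imageI finite_smooth_upto)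
  also have "\<dots> \<le> card (smooth_upto (x / real d) y)" by (intro card_image_le finite_smooth_upto)
  finally have "real (card {n\<in>B. rough_part y n = d}) \<le> Psi (x / real d) y"
    by (simp add: Psi_eq_card)
  also have "\<dots> \<le> P * g d" by (rule Psi_bound) (use d in auto)
  finally show ?thesis .
next
  case True
  thus ?thesis using P0 nonneg by (simp only: True) simp
qed

text \<open>Given its rough part d, the first factor has at most P g(d) choices, and the product of
  the others has rough part D / d. By multiplicativity of g, each ordered factorization of D thus
  carries the same weight P^k g(D).\<close>

lemma sum_prod_reps_rough_part_le:
  assumes "D > 0"
  shows "(\<Sum>N\<in>{N\<in>{1..Z}. rough_part y N = D}. prod_reps B k N) \<le> P ^ k * (g D * prod_reps UNIV k D)"
  using assms
proof (induction k arbitrary: D Z)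
  case 0
  have "(\<Sum>N\<in>{N\<in>{1..Z}. rough_part y N = D}. prod_reps B 0 N) \<le> (\<Sum>N\<in>{1::nat}. if D = 1 then 1 else (0::real))"
  proof -
    have "(\<Sum>N\<in>{N\<in>{1..Z}. rough_part y N = D}. prod_reps B 0 N) =
          (\<Sum>N\<in>{N\<in>{1..Z}. rough_part y N = D} \<inter> {1}. if D = 1 then 1 else (0::real))"
      by (intro sum.mono_neutral_cong_right) auto
    also have "\<dots> \<le> (\<Sum>N\<in>{1::nat}. if D = 1 then 1 else (0::real))" by (intro sum_mono2) auto
    finally show ?thesis .
  qed
  thus ?case using one by simp
next
  case (Suc k)
  define H where "H = (\<lambda>d. if d dvd D then P ^ k * (g (D div d) * prod_reps UNIV k (D div d)) else 0)"
  have H0: "H d \<ge> 0" for d using P0 nonneg by (auto simp: H_def intro!: mult_nonneg_nonneg prod_reps_nonneg)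
  have "(\<Sum>N\<in>{N\<in>{1..Z}. rough_part y N = D}. prod_reps B (Suc k) N) =
        (\<Sum>N\<in>{N\<in>{1..Z}. rough_part y N = D}. \<Sum>n\<in>B. if n dvd N then prod_reps B k (N div n) else 0)"
    using finite_B by (simp add: sum.If_cases Int_def conj_commute)
  also have "\<dots> = (\<Sum>n\<in>B. \<Sum>N\<in>{N\<in>{1..Z}. rough_part y N = D}. if n dvd N then prod_reps B k (N div n) else 0)"
    by (rule sum.swap)
  also have "\<dots> \<le> (\<Sum>n\<in>B. H (rough_part y n))"
  proof (rule sum_mono)
    fix n assume n: "n \<in> B"
    have n0: "n > 0" by (rule B_D(1)[OF n])
    have r0: "rough_part y n > 0" using B_D(3)[OF n] by simp
    have "(\<Sum>N\<in>{N\<in>{1..Z}. rough_part y N = D}. if n dvd N then prod_reps B k (N div n) else 0) =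
          (\<Sum>N\<in>{N\<in>{1..Z}. n dvd N \<and> rough_part y N = D}. prod_reps B k (N div n))"
      by (intro sum.mono_neutral_cong_right) auto
    also have "\<dots> = (\<Sum>M\<in>{M\<in>{1..Z div n}. rough_part y (n * M) = D}. prod_reps B k M)"
      using n0 by (subst sum_multiples_reindex) auto
    also have "\<dots> \<le> H (rough_part y n)"
    proof (cases "rough_part y n dvd D")
      case True
      have D0: "D div rough_part y n > 0" using True Suc.prems r0 by (simp add: dvd_div_pos dvd_imp_le div_greater_zero_iff)
      have "{M\<in>{1..Z div n}. rough_part y (n * M) = D} \<subseteq> {M\<in>{1..Z div n}. rough_part y M = D div rough_part y n}"
        using n0 r0 by (auto simp: rough_part_mult)
      hence "(\<Sum>M\<in>{M\<in>{1..Z div n}. rough_part y (n * M) = D}. prod_reps B k M) \<le>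
             (\<Sum>M\<in>{M\<in>{1..Z div n}. rough_part y M = D div rough_part y n}. prod_reps B k M)"
        by (intro sum_mono2) (auto intro: prod_reps_nonneg)
      also have "\<dots> \<le> H (rough_part y n)" using Suc.IH[OF D0, of "Z div n"] True by (simp add: H_def)
      finally show ?thesis .
    next
      case False
      have "rough_part y (n * M) \<noteq> D" if "M \<in> {1..Z div n}" for M
        using that n0 False by (auto simp: rough_part_mult)
      hence "{M\<in>{1..Z div n}. rough_part y (n * M) = D} = {}" by auto
      thus ?thesis using H0 by (simp only: sum.empty)
    qed
    finally show "(\<Sum>N\<in>{N\<in>{1..Z}. rough_part y N = D}. if n dvd N then prod_reps B k (N div n) else 0) \<le> H (rough_part y n)" .
  qed
  also have "\<dots> = (\<Sum>d\<in>rough_part y ` B. \<Sum>n\<in>{n\<in>B. rough_part y n = d}. H (rough_part y n))"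
    by (rule sum.image_gen[OF finite_B])
  also have "\<dots> = (\<Sum>d\<in>rough_part y ` B. real (card {n\<in>B. rough_part y n = d}) * H d)" by simp
  also have "\<dots> \<le> (\<Sum>d\<in>rough_part y ` B. P * g d * H d)"
    using H0 by (intro sum_mono mult_right_mono card_rough_part_le)
  also have "\<dots> = (\<Sum>d\<in>{d\<in>rough_part y ` B. d dvd D}. P * g d * H d)"
    using finite_B by (intro sum.mono_neutral_right) (auto simp: H_def)
  also have "\<dots> \<le> (\<Sum>d\<in>{d. d dvd D}. P * g d * H d)"
    using Suc.prems H0 P0 nonneg by (intro sum_mono2) auto
  also have "\<dots> = (\<Sum>d\<in>{d. d dvd D}. P ^ Suc k * (g D * prod_reps UNIV k (D div d)))"
  proof (rule sum.cong[OF refl])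
    fix d assume d: "d \<in> {d. d dvd D}"
    hence "d > 0" "D div d > 0" "d * (D div d) = D" using Suc.prems by (auto simp: dvd_div_pos dvd_pos_nat)
    hence "g D = g d * g (D div d)" using mult[of d "D div d"] by simp
    thus "P * g d * H d = P ^ Suc k * (g D * prod_reps UNIV k (D div d))"
      using d by (simp add: H_def)
  qed
  finally show ?case by (simp add: sum_distrib_left)
qed

text \<open>The factor \<open>s\<close>: once all factors but the first are chosen, the first one is determined,
  so it may be bounded trivially.\<close>

lemma prod_reps_le:
  assumes "N > 0"
  shows "prod_reps B (Suc k) N \<le> s * P ^ Suc k * (g (rough_part y N) * prod_reps UNIV (Suc k) (rough_part y N))"
proof -
  define D where "D = rough_part y N"
  have D0: "D > 0" using rough_part_pos[OF assms] by (simp add: D_def)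
  define Bn where "Bn = {n\<in>B. n dvd N}"
  have finBn: "finite Bn" using finite_B by (simp add: Bn_def)
  have rd: "rough_part y n dvd D" "rough_part y (N div n) = D div rough_part y n"
    "N div n > 0" "rough_part y n > 0" if "n \<in> Bn" for n
  proof -
    have n: "n > 0" "N = n * (N div n)" using that B_D(1) by (auto simp: Bn_def)
    show N: "N div n > 0" using n assms by (metis gr0I mult_0_right)
    have "D = rough_part y n * rough_part y (N div n)"
      unfolding D_def by (subst n(2)) (rule rough_part_mult[OF n(1) N])
    moreover show r: "rough_part y n > 0" by (rule rough_part_pos[OF n(1)])
    ultimately show "rough_part y n dvd D" "rough_part y (N div n) = D div rough_part y n" by auto
  qed
  have "prod_reps B (Suc k) N = (\<Sum>n\<in>Bn. prod_reps B k (N div n))" by (simp add: Bn_def)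
  also have "\<dots> = (\<Sum>d\<in>rough_part y ` Bn. \<Sum>n\<in>{n\<in>Bn. rough_part y n = d}. prod_reps B k (N div n))"
    by (rule sum.image_gen[OF finBn])
  also have "\<dots> \<le> (\<Sum>d\<in>rough_part y ` Bn. s * P ^ Suc k * (g D * prod_reps UNIV k (D div d)))"
  proof (rule sum_mono)
    fix d assume "d \<in> rough_part y ` Bn"
    then obtain n0 where n0: "n0 \<in> Bn" "rough_part y n0 = d" by auto
    have n0B: "n0 \<in> B" using n0 by (simp add: Bn_def)
    have d: "d > 1" "real d \<le> x" "\<And>p. prime p \<Longrightarrow> p dvd d \<Longrightarrow> y < real p" "d dvd D"
      using B_D[OF n0B] n0(2) rd(1)[OF n0(1)] by auto
    have Dd: "D div d > 0" "d * (D div d) = D" using d D0 by (auto simp: dvd_div_pos dvd_imp_le div_greater_zero_iff)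
    have gD: "g D = g d * g (D div d)" using mult[of d "D div d"] d Dd by simp
    have inj: "inj_on (\<lambda>n. N div n) {n\<in>Bn. rough_part y n = d}"
    proof (rule inj_onI)
      fix a b assume ab: "a \<in> {n\<in>Bn. rough_part y n = d}" "b \<in> {n\<in>Bn. rough_part y n = d}" "N div a = N div b"
      have "a * (N div a) = b * (N div b)" using ab(1,2) by (simp add: Bn_def)
      thus "a = b" using ab rd(3)[of a] by auto
    qed
    have "(\<Sum>n\<in>{n\<in>Bn. rough_part y n = d}. prod_reps B k (N div n)) =
          (\<Sum>M\<in>(\<lambda>n. N div n) ` {n\<in>Bn. rough_part y n = d}. prod_reps B k M)"
      using inj by (simp add: sum.reindex)
    also have "\<dots> \<le> (\<Sum>M\<in>{M\<in>{1..N}. rough_part y M = D div d}. prod_reps B k M)"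
    proof (rule sum_mono2)
      show "(\<lambda>n. N div n) ` {n\<in>Bn. rough_part y n = d} \<subseteq> {M\<in>{1..N}. rough_part y M = D div d}"
        using rd by (force simp: Suc_le_eq)
    qed (auto intro: prod_reps_nonneg)
    also have "\<dots> \<le> P ^ k * (g (D div d) * prod_reps UNIV k (D div d))"
      by (rule sum_prod_reps_rough_part_le[OF Dd(1)])
    \<comment> \<open>Inserting s P g(d) >= 1 restores the weight of the first factor, so that the
      result is again proportional to g(D).\<close>
    also have "\<dots> \<le> (s * P * g d) * (P ^ k * (g (D div d) * prod_reps UNIV k (D div d)))"
    proof -
      have "1 \<le> s * P * g d" by (rule trivial_bound) (use d in auto)
      moreover have "0 \<le> P ^ k * (g (D div d) * prod_reps UNIV k (D div d))"
        using P0 nonneg by (intro mult_nonneg_nonneg prod_reps_nonneg) auto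
      ultimately show ?thesis by (metis mult_right_mono mult_1)
    qed
    finally show "(\<Sum>n\<in>{n\<in>Bn. rough_part y n = d}. prod_reps B k (N div n)) \<le>
       s * P ^ Suc k * (g D * prod_reps UNIV k (D div d))" by (simp add: gD mult_ac)
  qed
  also have "\<dots> \<le> (\<Sum>d\<in>{d. d dvd D}. s * P ^ Suc k * (g D * prod_reps UNIV k (D div d)))"
    using D0 rd(1) s0 P0 nonneg by (intro sum_mono2) (auto intro!: mult_nonneg_nonneg prod_reps_nonneg)
  finally show ?thesis by (simp add: D_def sum_distrib_left)
qed

text \<open>One copy of the count is bounded pointwise, the other on average over the N with rough
  part D, which leads to (g(D) d_k(D))^2 with d_k the k-fold divisor function. One d_k(D) is at most
  k^Omega(D) and joins g^2 in a multiplicative weight; the other comes from the k-th power of a sum,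
  bounded by the Euler product.\<close>

lemma sum_prod_reps_square_le:
  assumes k: "k > 0" and small: "\<And>p. p \<in> primes_in y (real Z) \<Longrightarrow> real k * (g p)\<^sup>2 \<le> 1 / 2"
    and \<sigma>: "(\<Sum>p\<in>primes_in y (real Z). real k * (g p)\<^sup>2) \<le> \<sigma>"
  shows "(\<Sum>N=1..Z. (prod_reps B k N)\<^sup>2) \<le> s * P ^ (2 * k) * exp (2 * real k * \<sigma>)"
proof -
  define T where "T = {D\<in>{1..Z}. \<forall>p. prime p \<and> p dvd D \<longrightarrow> p \<in> primes_in y (real Z)}"
  define G where "G = (\<lambda>D. real k ^ bigomega D * (g D)\<^sup>2)"
  have G_mult: "G (a * b) = G a * G b" if "a > 0" "b > 0" for a b
    using that by (simp add: G_def bigomega_mult mult power_add power_mult_distrib)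
  have G_one: "G 1 = 1" using one by (simp add: G_def)
  have G_nonneg: "G n \<ge> 0" for n by (simp add: G_def)
  have G_prime: "G p = real k * (g p)\<^sup>2" if "prime p" for p
    using that by (simp add: G_def bigomega_prime)
  have rT: "rough_part y ` {1..Z} \<subseteq> T"
  proof clarify
    fix N assume N: "N \<in> {1..Z}"
    hence "rough_part y N > 0" "rough_part y N \<le> N" using rough_part_pos rough_part_le by auto
    moreover have "p \<in> primes_in y (real Z)" if "prime p" "p dvd rough_part y N" for p
    proof -
      have "p \<le> rough_part y N" using that \<open>rough_part y N > 0\<close> by (intro dvd_imp_le)
      hence "p \<le> Z" using \<open>rough_part y N \<le> N\<close> N by auto
      thus ?thesis using that prime_dvd_rough_part[of N p y] N by (auto simp: primes_in_def)
    qed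
    ultimately show "rough_part y N \<in> T" using N by (auto simp: T_def)
  qed
  have finT: "finite T" by (simp add: T_def)
  have k': "k = Suc (k - 1)" using k by simp
  have "(\<Sum>N=1..Z. (prod_reps B k N)\<^sup>2) \<le>
     (\<Sum>N=1..Z. prod_reps B k N * (s * P ^ k * (g (rough_part y N) * prod_reps UNIV k (rough_part y N))))"
    unfolding power2_eq_square
  proof (intro sum_mono mult_left_mono prod_reps_nonneg)
    fix N assume "N \<in> {1..Z}"
    thus "prod_reps B k N \<le> s * P ^ k * (g (rough_part y N) * prod_reps UNIV k (rough_part y N))"
      by (subst (1 2 3) k', intro prod_reps_le) auto
  qed
  also have "\<dots> = (\<Sum>D\<in>rough_part y ` {1..Z}. \<Sum>N\<in>{N\<in>{1..Z}. rough_part y N = D}.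
      prod_reps B k N * (s * P ^ k * (g (rough_part y N) * prod_reps UNIV k (rough_part y N))))"
    by (rule sum.image_gen) auto
  also have "\<dots> = (\<Sum>D\<in>rough_part y ` {1..Z}. (\<Sum>N\<in>{N\<in>{1..Z}. rough_part y N = D}. prod_reps B k N) *
      (s * P ^ k * (g D * prod_reps UNIV k D)))"
    by (intro sum.cong refl) (simp add: sum_distrib_right)
  also have "\<dots> \<le> (\<Sum>D\<in>rough_part y ` {1..Z}. (P ^ k * (g D * prod_reps UNIV k D)) * (s * P ^ k * (g D * prod_reps UNIV k D)))"
    using s0 P0 nonneg
    by (intro sum_mono mult_right_mono sum_prod_reps_rough_part_le)
       (auto intro!: mult_nonneg_nonneg prod_reps_nonneg rough_part_pos)
  also have "\<dots> = (\<Sum>D\<in>rough_part y ` {1..Z}. s * P ^ (2 * k) * ((g D)\<^sup>2 * (prod_reps UNIV k D)\<^sup>2))"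
  proof -
    have "P ^ (2 * k) = P ^ k * P ^ k" by (simp add: mult_2 power_add)
    thus ?thesis by (intro sum.cong refl) (simp only: power2_eq_square mult_ac)
  qed
  also have "\<dots> \<le> (\<Sum>D\<in>T. s * P ^ (2 * k) * ((g D)\<^sup>2 * (prod_reps UNIV k D)\<^sup>2))"
    using rT finT s0 P0 by (intro sum_mono2) auto
  also have "\<dots> \<le> (\<Sum>D\<in>T. s * P ^ (2 * k) * (G D * prod_reps UNIV k D))"
  proof (intro sum_mono mult_left_mono)
    fix D assume "D \<in> T"
    hence "D > 0" by (auto simp: T_def)
    hence "prod_reps UNIV k D * prod_reps UNIV k D \<le> real k ^ bigomega D * prod_reps UNIV k D"
      by (intro mult_right_mono prod_reps_UNIV_le prod_reps_nonneg)
    hence "(g D)\<^sup>2 * (prod_reps UNIV k D * prod_reps UNIV k D) \<le> (g D)\<^sup>2 * (real k ^ bigomega D * prod_reps UNIV k D)"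
      by (intro mult_left_mono) auto
    thus "(g D)\<^sup>2 * (prod_reps UNIV k D)\<^sup>2 \<le> G D * prod_reps UNIV k D"
      by (simp add: G_def power2_eq_square mult_ac)
  qed (use s0 P0 in auto)
  also have "\<dots> = s * P ^ (2 * k) * (\<Sum>D\<in>T. G D * prod_reps UNIV k D)" by (rule sum_distrib_left[symmetric])
  also have "\<dots> \<le> s * P ^ (2 * k) * (\<Sum>D\<in>T. G D) ^ k"
  proof (intro mult_left_mono sum_prod_reps_UNIV_le[of G])
    show "d \<in> T" if "D \<in> T" "d dvd D" for d D
    proof -
      have "D > 0" using that by (auto simp: T_def)
      hence "0 < d" "d \<le> D" using that(2) by (auto intro: dvd_pos_nat dvd_imp_le)
      thus ?thesis using that dvd_trans[OF _ that(2)] by (auto simp: T_def)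
    qed
  qed (use s0 P0 finT G_mult G_one G_nonneg in \<open>auto simp: T_def\<close>)
  also have "\<dots> \<le> s * P ^ (2 * k) * exp (2 * \<sigma>) ^ k"
  proof (intro mult_left_mono power_mono sum_nonneg G_nonneg)
    have "(\<Sum>D\<in>T. G D) \<le> exp (2 * (\<Sum>p\<in>primes_in y (real Z). G p))"
      unfolding T_def
    proof (intro sum_multiplicative_le_exp G_mult G_one G_nonneg)
      fix p assume p: "p \<in> primes_in y (real Z)"
      show "prime p \<and> G p \<le> 1/2" using small[OF p] G_prime[of p] primes_inD(1)[OF p] by simp
    qed auto
    also have "(\<Sum>p\<in>primes_in y (real Z). G p) = (\<Sum>p\<in>primes_in y (real Z). real k * (g p)\<^sup>2)"
      by (intro sum.cong refl G_prime) (auto dest: primes_inD(1))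
    finally show "(\<Sum>D\<in>T. G D) \<le> exp (2 * \<sigma>)" using \<sigma> by (elim order_trans) simp
  qed (use s0 P0 in auto)
  also have "exp (2 * \<sigma>) ^ k = exp (2 * real k * \<sigma>)" by (simp flip: exp_of_nat_mult add: mult_ac)
  finally show ?thesis .
qed

end

section \<open>Orthogonality of characters\<close>

lemma dirichlet_characterD:
  assumes "\<xi> \<in> dirichlet_characters q"
  shows "\<xi> (m * n) = \<xi> m * \<xi> n" "\<xi> 1 = 1" "\<xi> (n mod q) = \<xi> n" "\<xi> n \<noteq> 0 \<longleftrightarrow> coprime n q"
proof -
  show mult: "\<xi> (m * n) = \<xi> m * \<xi> n" for m n using assms by (simp add: dirichlet_characters_def)
  show nz: "\<xi> n \<noteq> 0 \<longleftrightarrow> coprime n q" for n using assms by (simp add: dirichlet_characters_def)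
  show "\<xi> 1 = 1" using mult[of 1 1] nz[of 1] by simp
  have "\<xi> (m + k * q) = \<xi> m" for m k
  proof (induction k)
    case (Suc k)
    have "\<xi> (m + Suc k * q) = \<xi> ((m + k * q) + q)" by (simp add: algebra_simps)
    with Suc assms show ?case unfolding dirichlet_characters_def by simp
  qed simp
  from this[of "n mod q" "n div q"] show "\<xi> (n mod q) = \<xi> n" by simp
qed

lemma norm_dirichlet_character:
  assumes "\<xi> \<in> dirichlet_characters q" "coprime n q"
  shows "norm (\<xi> n) = 1"
proof -
  note \<xi> = dirichlet_characterD[OF assms(1)]
  have "\<xi> (n ^ k) = \<xi> n ^ k" for k by (induction k) (use \<xi>(1,2) in simp_all)
  moreover have "n ^ totient q mod q = 1 mod q"
    using euler_theorem[OF assms(2)] by (simp add: cong_def)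
  ultimately have "\<xi> n ^ totient q = 1" using \<xi>(2) \<xi>(3)[of "n ^ totient q"] \<xi>(3)[of 1] by metis
  show ?thesis
  proof (cases "q = 0")
    case True
    thus ?thesis using assms(2) \<xi>(2) by simp
  next
    case False
    hence "totient q > 0" by simp
    thus ?thesis using \<open>\<xi> n ^ totient q = 1\<close>
      by (metis norm_ge_zero norm_one norm_power power_eq_1_iff less_irrefl)
  qed
qed

text \<open>Multiplication by a unit a with \<xi>(a) \<noteq> \<psi>(a) permutes the residues and
  multiplies the sum by \<xi>(a) times the conjugate of \<psi>(a), which differs from 1.\<close>

lemma dirichlet_characters_orthogonal:
  assumes "\<xi> \<in> dirichlet_characters q" "\<psi> \<in> dirichlet_characters q" "\<xi> \<noteq> \<psi>" "q > 0"
  shows "(\<Sum>n<q. \<xi> n * cnj (\<psi> n)) = 0"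
proof -
  note \<xi> = dirichlet_characterD[OF assms(1)]
  note \<psi> = dirichlet_characterD[OF assms(2)]
  obtain a where a: "\<xi> a \<noteq> \<psi> a" using assms(3) by blast
  have cop: "coprime a q" using a \<xi>(4)[of a] \<psi>(4)[of a] by metis
  define F where "F n = \<xi> n * cnj (\<psi> n)" for n
  define u where "u = \<xi> a * cnj (\<psi> a)"
  have bij: "bij_betw (\<lambda>n. a * n mod q) {..<q} {..<q}"
  proof -
    have "inj_on (\<lambda>n. a * n mod q) {..<q}"
    proof (rule inj_onI)
      fix m n assume mn: "m \<in> {..<q}" "n \<in> {..<q}" "a * m mod q = a * n mod q"
      hence "[a * m = a * n] (mod q)" by (simp add: cong_def)
      hence "[m = n] (mod q)" using cong_mult_lcancel_nat[OF cop] by blast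
      thus "m = n" using mn by (simp add: cong_def)
    qed
    moreover have "(\<lambda>n. a * n mod q) ` {..<q} \<subseteq> {..<q}" using assms(4) by auto
    ultimately show ?thesis by (simp add: bij_betw_def endo_inj_surj)
  qed
  have "(\<Sum>n<q. F n) = (\<Sum>n<q. F (a * n mod q))"
    using sum.reindex_bij_betw[OF bij, of F] by simp
  also have "\<dots> = (\<Sum>n<q. u * F n)"
    by (intro sum.cong refl) (simp add: F_def u_def \<xi>(3) \<psi>(3) \<xi>(1) \<psi>(1))
  also have "\<dots> = u * (\<Sum>n<q. F n)" by (simp add: sum_distrib_left)
  finally have "(u - 1) * (\<Sum>n<q. F n) = 0" by (simp add: algebra_simps)
  moreover have "u \<noteq> 1"
  proof
    assume "u = 1"
    have "\<psi> a * cnj (\<psi> a) = 1"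
      using norm_dirichlet_character[OF assms(2) cop] by (simp add: complex_norm_square[symmetric])
    hence "\<xi> a * (cnj (\<psi> a) * \<psi> a) = \<xi> a" by (simp add: mult.commute)
    moreover have "\<xi> a * (cnj (\<psi> a) * \<psi> a) = u * \<psi> a" by (simp add: u_def)
    ultimately show False using a \<open>u = 1\<close> by simp
  qed
  ultimately show ?thesis by (simp add: F_def)
qed

lemma norm_dirichlet_character_le: "\<xi> \<in> dirichlet_characters q \<Longrightarrow> norm (\<xi> n) \<le> 1"
  using norm_dirichlet_character[of \<xi> q n] dirichlet_characterD(4)[of \<xi> q n]
  by (cases "coprime n q") auto

text \<open>Bessel's inequality by duality: orthogonality of distinct characters over the residues n
  controls the adjoint sums W(n), and Cauchy-Schwarz then bounds T^2 by q T times the sum of the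
  squares of the coefficients.\<close>

lemma dirichlet_characters_bessel:
  fixes a :: "nat \<Rightarrow> complex"
  assumes "q > 0"
  shows "(\<Sum>\<xi>\<in>dirichlet_characters q. (norm (\<Sum>n<q. a n * \<xi> n))\<^sup>2) \<le> real q * (\<Sum>n<q. (norm (a n))\<^sup>2)"
proof -
  define Ch where "Ch = dirichlet_characters q"
  have fin: "finite Ch" unfolding Ch_def by (rule finite_dirichlet_characters[OF assms])
  define b where "b \<xi> = (\<Sum>n<q. a n * \<xi> n)" for \<xi>
  define T where "T = (\<Sum>\<xi>\<in>Ch. (norm (b \<xi>))\<^sup>2)"
  define W where "W n = (\<Sum>\<xi>\<in>Ch. cnj (b \<xi>) * \<xi> n)" for n
  have T0: "T \<ge> 0" by (simp add: T_def sum_nonneg)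
  have W2: "(\<Sum>n<q. (norm (W n))\<^sup>2) \<le> real q * T"
  proof -
    have "of_real (\<Sum>n<q. (norm (W n))\<^sup>2) = (\<Sum>n<q. W n * cnj (W n))"
      unfolding of_real_sum complex_norm_square ..
    also have "\<dots> = (\<Sum>n<q. \<Sum>\<xi>\<in>Ch. \<Sum>\<psi>\<in>Ch. cnj (b \<xi>) * b \<psi> * (\<xi> n * cnj (\<psi> n)))"
      by (simp add: W_def sum_product mult_ac)
    also have "\<dots> = (\<Sum>\<xi>\<in>Ch. \<Sum>n<q. \<Sum>\<psi>\<in>Ch. cnj (b \<xi>) * b \<psi> * (\<xi> n * cnj (\<psi> n)))"
      by (rule sum.swap)
    also have "\<dots> = (\<Sum>\<xi>\<in>Ch. \<Sum>\<psi>\<in>Ch. \<Sum>n<q. cnj (b \<xi>) * b \<psi> * (\<xi> n * cnj (\<psi> n)))"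
      by (rule sum.cong[OF refl], rule sum.swap)
    also have "\<dots> = (\<Sum>\<xi>\<in>Ch. \<Sum>\<psi>\<in>Ch. if \<psi> = \<xi> then cnj (b \<xi>) * b \<xi> * (\<Sum>n<q. \<xi> n * cnj (\<xi> n)) else 0)"
      using dirichlet_characters_orthogonal assms
      by (intro sum.cong refl) (auto simp: Ch_def simp flip: sum_distrib_left)
    also have "\<dots> = (\<Sum>\<xi>\<in>Ch. cnj (b \<xi>) * b \<xi> * (\<Sum>n<q. \<xi> n * cnj (\<xi> n)))"
      using fin by simp
    also have "\<dots> = of_real (\<Sum>\<xi>\<in>Ch. (norm (b \<xi>))\<^sup>2 * (\<Sum>n<q. (norm (\<xi> n))\<^sup>2))"
      unfolding of_real_sum of_real_mult complex_norm_square by (simp add: mult_ac)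
    finally have "(\<Sum>n<q. (norm (W n))\<^sup>2) = (\<Sum>\<xi>\<in>Ch. (norm (b \<xi>))\<^sup>2 * (\<Sum>n<q. (norm (\<xi> n))\<^sup>2))"
      by (simp only: of_real_eq_iff)
    also have "\<dots> \<le> (\<Sum>\<xi>\<in>Ch. (norm (b \<xi>))\<^sup>2 * (\<Sum>n<q. 1\<^sup>2))"
      using norm_dirichlet_character_le
      by (intro sum_mono mult_left_mono power_mono) (auto simp: Ch_def)
    also have "\<dots> = real q * T" by (simp add: T_def sum_distrib_left mult.commute)
    finally show ?thesis .
  qed
  have "of_real T = (\<Sum>\<xi>\<in>Ch. cnj (b \<xi>) * b \<xi>)"
    unfolding T_def of_real_sum complex_norm_square by (simp add: mult.commute)
  also have "\<dots> = (\<Sum>\<xi>\<in>Ch. \<Sum>n<q. cnj (b \<xi>) * (a n * \<xi> n))"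
    by (subst (2) b_def) (simp add: sum_distrib_left)
  also have "\<dots> = (\<Sum>n<q. \<Sum>\<xi>\<in>Ch. cnj (b \<xi>) * (a n * \<xi> n))" by (rule sum.swap)
  also have "\<dots> = (\<Sum>n<q. a n * W n)" by (simp add: W_def sum_distrib_left mult_ac)
  finally have "T = norm (\<Sum>n<q. a n * W n)" using T0 by (metis norm_of_real abs_of_nonneg)
  also have "\<dots> \<le> (\<Sum>n<q. norm (a n) * norm (W n))"
    by (rule order_trans[OF norm_sum]) (simp add: norm_mult)
  finally have "T\<^sup>2 \<le> (\<Sum>n<q. norm (a n) * norm (W n))\<^sup>2" using T0 by (intro power_mono) auto
  also have "\<dots> \<le> (\<Sum>n<q. (norm (a n))\<^sup>2) * (\<Sum>n<q. (norm (W n))\<^sup>2)" by (rule Cauchy_Schwarz_ineq_sum)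
  also have "\<dots> \<le> (\<Sum>n<q. (norm (a n))\<^sup>2) * (real q * T)" using W2 by (intro mult_left_mono sum_nonneg) auto
  finally have *: "T * T \<le> (real q * (\<Sum>n<q. (norm (a n))\<^sup>2)) * T" by (simp add: power2_eq_square mult_ac)
  have "T \<le> real q * (\<Sum>n<q. (norm (a n))\<^sup>2)"
  proof (cases "T = 0")
    case True
    thus ?thesis by (simp add: sum_nonneg)
  next
    case False
    thus ?thesis using * T0 by simp
  qed
  thus ?thesis by (simp add: T_def b_def Ch_def)
qed

text \<open>X^k <= q keeps the k-th power within a single period, so distinct products N fall into
  distinct residues and Bessel applies to the counts themselves.\<close>

lemma sum_characters_power_le:
  assumes "q \<ge> 2" "B \<subseteq> {1..X}" "X ^ k \<le> q"
  shows "(\<Sum>\<xi>\<in>dirichlet_characters q. norm (\<Sum>n\<in>B. \<xi> n) ^ (2 * k)) \<le>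
           real q * (\<Sum>N=1..q. (prod_reps B k N)\<^sup>2)"
proof -
  define a :: "nat \<Rightarrow> complex" where "a n = (if n = 0 then 0 else of_real (prod_reps B k n))" for n
  have "norm (\<Sum>n\<in>B. \<xi> n) ^ (2 * k) = (norm (\<Sum>n<q. a n * \<xi> n))\<^sup>2"
    if \<xi>: "\<xi> \<in> dirichlet_characters q" for \<xi>
  proof -
    note D = dirichlet_characterD[OF \<xi>]
    \<comment> \<open>The range 1..q becomes 0..q-1: the term N = q vanishes because q >= 2 is not
      coprime to itself.\<close>
    have z: "\<xi> q = 0" using D(4)[of q] assms(1) by auto
    have "(\<Sum>n\<in>B. \<xi> n) ^ k = (\<Sum>N=1..q. of_real (prod_reps B k N) * \<xi> N)"
      by (rule power_sum_eq_prod_reps[OF D(1,2) assms(2,3)])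
    also have "\<dots> = (\<Sum>N\<in>insert q {1..<q}. of_real (prod_reps B k N) * \<xi> N)"
      using assms(1) by (intro sum.cong) auto
    also have "\<dots> = (\<Sum>N\<in>{1..<q}. a N * \<xi> N)" using z by (simp add: a_def)
    also have "\<dots> = (\<Sum>n<q. a n * \<xi> n)"
      by (intro sum.mono_neutral_left) (auto simp: a_def)
    finally have "(\<Sum>n\<in>B. \<xi> n) ^ k = (\<Sum>n<q. a n * \<xi> n)" .
    hence "norm (\<Sum>n\<in>B. \<xi> n) ^ k = norm (\<Sum>n<q. a n * \<xi> n)" by (metis norm_power)
    thus ?thesis by (simp add: mult.commute[of 2] power_mult)
  qed
  hence "(\<Sum>\<xi>\<in>dirichlet_characters q. norm (\<Sum>n\<in>B. \<xi> n) ^ (2 * k)) =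
     (\<Sum>\<xi>\<in>dirichlet_characters q. (norm (\<Sum>n<q. a n * \<xi> n))\<^sup>2)"
    by (intro sum.cong refl)
  also have "\<dots> \<le> real q * (\<Sum>n<q. (norm (a n))\<^sup>2)"
    using assms(1) by (intro dirichlet_characters_bessel) auto
  also have "\<dots> \<le> real q * (\<Sum>N=1..q. (prod_reps B k N)\<^sup>2)"
  proof (intro mult_left_mono)
    have "(\<Sum>n<q. (norm (a n))\<^sup>2) = (\<Sum>n\<in>{1..<q}. (norm (a n))\<^sup>2)"
      by (intro sum.mono_neutral_right) (auto simp: a_def)
    also have "\<dots> = (\<Sum>n\<in>{1..<q}. (prod_reps B k n)\<^sup>2)" by (intro sum.cong) (auto simp: a_def)
    also have "\<dots> \<le> (\<Sum>N=1..q. (prod_reps B k N)\<^sup>2)" by (intro sum_mono2) auto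
    finally show "(\<Sum>n<q. (norm (a n))\<^sup>2) \<le> (\<Sum>N=1..q. (prod_reps B k N)\<^sup>2)" .
  qed auto
  finally show ?thesis .
qed

section \<open>Moments of character sums\<close>

lemma power_bigomega_le:
  assumes "d > 0" "y \<ge> 0" "\<And>p. prime p \<Longrightarrow> p dvd d \<Longrightarrow> y < real p"
  shows "y ^ bigomega d \<le> real d"
  using assms(1,3)
proof (induction d rule: nat_prime_induct)
  case (prime p m)
  have "y ^ bigomega (p * m) = y * y ^ bigomega m"
    using prime by (simp add: bigomega_mult bigomega_prime prime_gt_0_nat)
  also have "\<dots> \<le> real p * real m"
    using prime assms(2) by (intro mult_mono) (auto simp: less_imp_le)
  finally show ?case by simp
qed auto

lemma bigomega_pos: "d > 1 \<Longrightarrow> bigomega d > 0"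
  by (metis bigomega_def gr0I less_numeral_extra(4) prime_factorization_empty_iff
      not_less_zero size_eq_0_iff_empty nat_dvd_1_iff_1)

text \<open>Comparison with the integral of t^(-1-\<eta>) in telescoped form: each term is at most
  ((n-1)^(-\<eta>) - n^(-\<eta>)) / \<eta>.\<close>

lemma sum_powr_le:
  assumes "1 \<le> a" "a \<le> b" "\<eta> > 0"
  shows "(\<Sum>n\<in>{a<..b}. real n powr (-1-\<eta>)) \<le> (real a powr (-\<eta>) - real b powr (-\<eta>)) / \<eta>"
  using assms(2)
proof (induction b rule: dec_induct)
  case (step b)
  define n where "n = Suc b"
  have n: "real n \<ge> 2" using step assms by (simp add: n_def)
  have "real b / real n = 1 - 1 / real n" using n by (simp add: n_def field_simps)
  hence "ln (real b / real n) \<le> - (1 / real n)"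
    using ln_le_minus_one[of "real b / real n"] step assms n by simp
  hence "\<eta> * (1 / real n) \<le> \<eta> * (- ln (real b / real n))"
    using assms(3) by (intro mult_left_mono) auto
  hence "1 + \<eta> / real n \<le> exp (- \<eta> * ln (real b / real n))"
    by (intro order_trans[OF _ exp_ge_add_one_self]) simp
  also have "\<dots> = (real b / real n) powr (-\<eta>)" using step assms n by (simp add: powr_def)
  also have "\<dots> = real b powr (-\<eta>) / real n powr (-\<eta>)" using n by (simp add: powr_divide)
  finally have e1: "(1 + \<eta> / real n) * real n powr (-\<eta>) \<le> real b powr (-\<eta>)"
    using n by (simp add: field_simps)
  have e2: "(1 + \<eta> / real n) * real n powr (-\<eta>) =
      real n powr (-\<eta>) + \<eta> * (real n powr (-\<eta>) / real n)" by (simp add: algebra_simps)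
  have e3: "real n powr (-\<eta>) / real n = real n powr (-1-\<eta>)"
    using n by (simp add: powr_diff powr_minus field_simps)
  have "\<eta> * real n powr (-1-\<eta>) \<le> real b powr (-\<eta>) - real n powr (-\<eta>)"
    using e1 unfolding e2 e3 by simp
  hence "real n powr (-1-\<eta>) \<le> (real b powr (-\<eta>) - real n powr (-\<eta>)) / \<eta>"
    using assms(3) by (simp add: le_divide_eq mult.commute)
  moreover have "{a<..Suc b} = insert n {a<..b}" using step by (auto simp: n_def)
  ultimately show ?case using step by (simp add: n_def diff_divide_distrib)
qed auto

abbreviation rough_sum :: "real \<Rightarrow> real \<Rightarrow> (nat \<Rightarrow> complex) \<Rightarrow> complex" where
  "rough_sum x y f \<equiv> (\<Sum>n = 1..nat \<lfloor>x\<rfloor>. f n) - Psi_sum x y f"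

lemma card_mult_power_le_sum:
  fixes f :: "'a \<Rightarrow> real"
  assumes "finite S" "v \<ge> 0" "\<And>i. i \<in> S \<Longrightarrow> f i \<ge> 0"
  shows "real (card {i\<in>S. v < f i}) * v ^ m \<le> (\<Sum>i\<in>S. f i ^ m)"
proof -
  have "real (card {i\<in>S. v < f i}) * v ^ m = (\<Sum>i\<in>{i\<in>S. v < f i}. v ^ m)" by simp
  also have "\<dots> \<le> (\<Sum>i\<in>{i\<in>S. v < f i}. f i ^ m)" using assms by (intro sum_mono power_mono) auto
  also have "\<dots> \<le> (\<Sum>i\<in>S. f i ^ m)" using assms by (intro sum_mono2) auto
  finally show ?thesis .
qed

context prime_windows
begin

text \<open>The choice \<open>s = 1\<close> is always available; the other one saves
  a power of \<open>log q\<close> when \<open>k\<close> is small.\<close>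

lemma few_characters_large:
  fixes x y lam \<sigma> v s W :: real and q k :: nat
  assumes reg: "reg x y" and k: "k > 0" and q: "q \<ge> 2" and xq: "x ^ k \<le> real q" and lam: "lam \<ge> 1"
    and W: "real k * ln x \<le> W" "exp 3 / c\<^sup>2 * lam\<^sup>2 * (W * ln x * ln y / y) \<le> \<sigma>"
    and small: "2 * \<sigma> \<le> y"
    and s: "s = 1 \<or> s = A * x powr (-(1 / (2 * ln y)))" and v: "v > 0"
  shows "real (card {\<xi>\<in>dirichlet_characters q. v < norm (rough_sum x y \<xi>)})
           \<le> real q * s * (A * Psi x y * exp \<sigma> / (lam * v)) ^ (2 * k)"
proof -
  define \<tau> where "\<tau> = ln x / (c * y)"
  define \<gamma> where "\<gamma> = 1 / 2 + 3 / (2 * ln y)"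
  \<comment> \<open>Only \<gamma>' = \<gamma> - 1 / ln y goes into \<open>g\<close>. It still has 2
    \<gamma>' = 1 + 1 / ln y, enough for the prime sum; the remaining 1 / ln y is a reserve for the
    choice of \<open>s\<close>.\<close>
  define \<gamma>' where "\<gamma>' = 1 / 2 + 1 / (2 * ln y)"
  \<comment> \<open>Since y^(1 / ln y) = e, this is \<open>\<tau>\<close> y^\<gamma>: j divisions by
    y beat the general decay by w^j.\<close>
  define w where "w = exp 1 * \<tau> * y powr \<gamma>'"
  define g where "g d = (lam * w) ^ bigomega d * real d powr (-\<gamma>')" for d
  define P where "P = A * Psi x y / lam"
  define X where "X = nat \<lfloor>x\<rfloor>"
  define B where "B = {1..X} - smooth_upto x y"
  interpret decay c K x y \<tau> \<gamma> unfolding \<gamma>_def \<tau>_def by (rule reg_decay[OF reg])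
  have y: "y > 0" "ln y \<ge> 6" "y \<ge> 2" "x \<ge> 1" using reg y_ge by (auto simp: reg_def)
  have \<sigma>: "exp 3 * real k * lam\<^sup>2 * \<tau>\<^sup>2 * y * ln y \<le> \<sigma>"
  proof -
    have "exp 3 * real k * lam\<^sup>2 * \<tau>\<^sup>2 * y * ln y =
        exp 3 / c\<^sup>2 * lam\<^sup>2 * ((real k * ln x) * ln x * ln y / y)"
      using y c_pos by (simp add: \<tau>_def power2_eq_square mult_ac)
    also have "\<dots> \<le> exp 3 / c\<^sup>2 * lam\<^sup>2 * (W * ln x * ln y / y)"
      using y W(1) by (intro mult_left_mono divide_right_mono mult_right_mono) auto
    also note W(2)
    finally show ?thesis .
  qed
  have y_pow: "y powr (1 / ln y) = exp 1" using y by (simp add: powr_def)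
  have \<gamma>_eq: "\<gamma> = \<gamma>' + 1 / ln y" by (simp add: \<gamma>_def \<gamma>'_def field_simps)
  have y\<gamma>: "y powr \<gamma> = y powr \<gamma>' * exp 1" unfolding \<gamma>_eq powr_add y_pow ..
  have w0: "w \<ge> 0" using \<tau> by (simp add: w_def)
  have \<gamma>'0: "\<gamma>' > 0" using y unfolding \<gamma>'_def by (intro add_pos_nonneg) auto
  have P0: "P \<ge> 0" using A_ge_1 lam by (simp add: P_def)
  have s0: "s \<ge> 0" using s A_ge_1 by auto
  have g_nonneg: "g n \<ge> 0" for n using w0 lam by (simp add: g_def)
  have strong: "Psi (x / real d) y \<le> P * g d * real d powr (-(1 / ln y))"
    if d: "d > 1" "\<And>p. prime p \<Longrightarrow> p dvd d \<Longrightarrow> y < real p" for d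
  proof -
    define j where "j = bigomega d"
    have "y ^ j \<le> real d" unfolding j_def using d y by (intro power_bigomega_le) auto
    hence "Psi (x / real d) y \<le> A * \<tau> ^ j * (real d / y ^ j) powr (-\<gamma>) * Psi x y"
      by (intro Psi_decay_rough) auto
    also have "(real d / y ^ j) powr (-\<gamma>) = real d powr (-\<gamma>) * (y powr \<gamma>) ^ j"
      using y d by (simp add: powr_divide powr_minus powr_power field_simps powr_realpow[symmetric] powr_powr)
    also have "real d powr (-\<gamma>) = real d powr (-\<gamma>') * real d powr (-(1 / ln y))"
      unfolding \<gamma>_eq by (simp flip: powr_add)
    also have "A * \<tau> ^ j * (real d powr (-\<gamma>') * real d powr (-(1 / ln y)) * (y powr \<gamma>) ^ j) * Psi x y =
        (A * Psi x y * w ^ j * real d powr (-\<gamma>') * real d powr (-(1 / ln y))) * 1"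
      unfolding y\<gamma> by (simp add: w_def power_mult_distrib mult_ac)
    \<comment> \<open>d > 1 has j >= 1 prime factors, so the inserted lam^j / lam is at least 1. The
      division by lam is the gain in \<open>P\<close>; lam^j is multiplicative and goes into
      \<open>g\<close>.\<close>
    also have "\<dots> \<le> (A * Psi x y * w ^ j * real d powr (-\<gamma>') * real d powr (-(1 / ln y))) * (lam ^ j / lam)"
    proof (rule mult_left_mono)
      have "lam ^ 1 \<le> lam ^ j" using lam bigomega_pos[OF d(1)] unfolding j_def by (intro power_increasing) auto
      thus "1 \<le> lam ^ j / lam" using lam by simp
    qed (use A_ge_1 w0 in auto)
    also have "\<dots> = P * g d * real d powr (-(1 / ln y))"
      by (simp add: P_def g_def j_def power_mult_distrib)
    finally show ?thesis .
  qed
  have Psi_bound: "Psi (x / real d) y \<le> P * g d"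
    if d: "d > 1" "real d \<le> x" "\<And>p. prime p \<Longrightarrow> p dvd d \<Longrightarrow> y < real p" for d
  proof -
    have "real d powr (-(1 / ln y)) \<le> real d powr 0" using d y by (intro powr_mono) auto
    hence "P * g d * real d powr (-(1 / ln y)) \<le> P * g d * 1"
      using P0 g_nonneg d by (intro mult_left_mono) auto
    thus ?thesis using strong[OF d(1,3)] by simp
  qed
  have trivial_bound: "1 \<le> s * P * g d"
    if d: "d > 1" "real d \<le> x" "\<And>p. prime p \<Longrightarrow> p dvd d \<Longrightarrow> y < real p" for d
    using s
  proof
    assume "s = 1"
    have "1 \<le> Psi (x / real d) y" using d by (intro Psi_ge_1) auto
    thus ?thesis using Psi_bound[OF d] \<open>s = 1\<close> by simp
  next
    assume s: "s = A * x powr (-(1 / (2 * ln y)))"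
    \<comment> \<open>For d >= sqrt x the reserve d^(-1 / ln y) is small enough; for smaller d,
      \<Psi>(x / d, y) is itself large, by the decay from sqrt x to 1.\<close>
    define t where "t = sqrt x"
    have t: "t \<ge> 1" "t * t = x" using y by (auto simp: t_def)
    hence "t \<le> x" using mult_left_mono[of 1 t t] by simp
    note t = t this
    have tx: "t powr (-(1 / ln y)) = x powr (-(1 / (2 * ln y)))"
    proof -
      define u where "u = -(1 / (2 * ln y))"
      have "x powr u = t powr (u + u)" unfolding powr_add t(2)[symmetric] using t by (intro powr_mult)
      moreover have "u + u = -(1 / ln y)" using y by (simp add: u_def field_simps)
      ultimately show ?thesis by (simp add: u_def)
    qed
    show ?thesis
    proof (cases "real d \<ge> t")
      case True
      have "1 \<le> Psi (x / real d) y" using d by (intro Psi_ge_1) auto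
      also have "\<dots> \<le> P * g d * real d powr (-(1 / ln y))" by (rule strong[OF d(1,3)])
      also have "\<dots> \<le> P * g d * t powr (-(1 / ln y))"
        using P0 g_nonneg True t y by (intro mult_left_mono powr_mono2') auto
      also have "\<dots> \<le> A * (P * g d * t powr (-(1 / ln y)))"
        using A_ge_1 P0 g_nonneg mult_right_mono[of 1 A "P * g d * t powr (-(1 / ln y))"] by simp
      finally show ?thesis by (simp add: s tx mult_ac)
    next
      case False
      have "t = x / t" using t by (simp add: field_simps)
      also have "\<dots> \<le> x / real d" using False d t y by (intro divide_left_mono) auto
      finally have td: "t \<le> x / real d" .
      have "1 \<le> Psi (t / t) y" using t by (intro Psi_ge_1) auto
      also have "\<dots> \<le> A * t powr (-\<gamma>) * Psi t y" using t by (intro Psi_decay) auto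
      also have "\<dots> \<le> A * t powr (-\<gamma>) * Psi (x / real d) y"
        using A_ge_1 td by (intro mult_left_mono Psi_mono) auto
      also have "\<dots> \<le> A * t powr (-\<gamma>) * (P * g d)"
        using A_ge_1 Psi_bound[OF d] by (intro mult_left_mono) auto
      also have "\<dots> \<le> A * t powr (-(1 / ln y)) * (P * g d)"
        using A_ge_1 P0 g_nonneg t \<gamma>'0 by (intro mult_right_mono mult_left_mono powr_mono) (auto simp: \<gamma>_eq)
      finally show ?thesis by (simp add: s tx mult_ac)
    qed
  qed
  have g_sq: "real k * (g p)\<^sup>2 = real k * lam\<^sup>2 * exp 2 * \<tau>\<^sup>2 * ((y powr \<gamma>')\<^sup>2 * (real p powr (-\<gamma>'))\<^sup>2)"
    if "prime p" for p
    using that by (simp add: g_def bigomega_prime w_def power_mult_distrib mult_ac flip: exp_double)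
  have small': "real k * (g p)\<^sup>2 \<le> 1 / 2" if p: "p \<in> primes_in y (real q)" for p
  proof -
    have p': "prime p" "y < real p" using p by (auto dest: primes_inD)
    have "y powr \<gamma>' * real p powr (-\<gamma>') \<le> y powr \<gamma>' * y powr (-\<gamma>')"
      using p' y \<gamma>'0 by (intro mult_left_mono powr_mono2') auto
    also have "\<dots> = 1" using y by (simp flip: powr_add)
    finally have "(y powr \<gamma>' * real p powr (-\<gamma>'))\<^sup>2 \<le> 1" by (simp add: power_le_one)
    hence "real k * lam\<^sup>2 * exp 2 * \<tau>\<^sup>2 * ((y powr \<gamma>')\<^sup>2 * (real p powr (-\<gamma>'))\<^sup>2) \<le> real k * lam\<^sup>2 * exp 2 * \<tau>\<^sup>2 * 1"
      by (intro mult_left_mono) (auto simp: power_mult_distrib)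
    also have "\<dots> \<le> 1 / 2"
    proof -
      have "real k * lam\<^sup>2 * exp 2 * \<tau>\<^sup>2 * (y * 1) \<le> real k * lam\<^sup>2 * exp 3 * \<tau>\<^sup>2 * (y * ln y)"
        using y by (intro mult_mono) auto
      also have "\<dots> \<le> y / 2" using \<sigma> small by (simp add: mult_ac)
      finally show ?thesis using y by simp
    qed
    finally show ?thesis unfolding g_sq[OF p'(1)] .
  qed
  \<comment> \<open>Primes are replaced by all integers above y. With \<eta> = 1 / ln y the sum of
    n^(-1-\<eta>) is about y^(-\<eta>) / \<eta> = ln y / e, and the e absorbs the loss from using
    only a >= y / 2.\<close>
  have sum_primes: "(\<Sum>p\<in>primes_in y (real q). (real p powr (-\<gamma>'))\<^sup>2) \<le> ln y"
  proof -
    define \<eta> where "\<eta> = 1 / ln y"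
    define a where "a = nat \<lfloor>y\<rfloor>"
    have \<eta>: "\<eta> > 0" "\<eta> \<le> 1" using y by (auto simp: \<eta>_def)
    have a: "real a \<ge> y / 2" "a \<ge> 1" using real_nat_floor_ge[of y] y unfolding a_def by linarith+
    have "(\<Sum>p\<in>primes_in y (real q). (real p powr (-\<gamma>'))\<^sup>2) = (\<Sum>p\<in>primes_in y (real q). real p powr (-1-\<eta>))"
    proof (intro sum.cong refl)
      fix p
      have "-\<gamma>' + -\<gamma>' = -1 - \<eta>" by (simp add: \<gamma>'_def \<eta>_def field_simps)
      thus "(real p powr (-\<gamma>'))\<^sup>2 = real p powr (-1-\<eta>)"
        unfolding power2_eq_square powr_add[symmetric] by (simp only:)
    qed
    also have "\<dots> \<le> (\<Sum>n\<in>{a<..max a q}. real n powr (-1-\<eta>))"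
    proof (rule sum_mono2)
      show "primes_in y (real q) \<subseteq> {a<..max a q}"
      proof
        fix p assume "p \<in> primes_in y (real q)"
        hence "y < real p" "p \<le> q" by (auto simp: primes_in_def)
        moreover have "real a \<le> y" using y by (simp add: a_def)
        ultimately have "real a < real p" by linarith
        thus "p \<in> {a<..max a q}" using \<open>p \<le> q\<close> by simp
      qed
    qed auto
    also have "\<dots> \<le> (real a powr (-\<eta>) - real (max a q) powr (-\<eta>)) / \<eta>"
      using a \<eta> by (intro sum_powr_le) auto
    also have "\<dots> \<le> (y / 2) powr (-\<eta>) / \<eta>"
    proof (rule divide_right_mono)
      have "real a powr (-\<eta>) \<le> (y / 2) powr (-\<eta>)" using a y \<eta> by (intro powr_mono2') auto
      thus "real a powr (-\<eta>) - real (max a q) powr (-\<eta>) \<le> (y / 2) powr (-\<eta>)"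
        using powr_ge_zero[of "real (max a q)" "-\<eta>"] by linarith
    qed (use \<eta> in auto)
    also have "(y / 2) powr (-\<eta>) = 2 powr \<eta> / exp 1"
      using y y_pow by (simp add: powr_divide powr_minus \<eta>_def field_simps)
    also have "\<dots> \<le> 1"
    proof -
      have "(2::real) powr \<eta> \<le> 2 powr 1" using \<eta> by (intro powr_mono) auto
      also have "\<dots> \<le> exp 1" using exp_ge_add_one_self[of 1] by simp
      finally show ?thesis by simp
    qed
    hence "2 powr \<eta> / exp 1 / \<eta> \<le> 1 / \<eta>" using \<eta> by (intro divide_right_mono) auto
    finally show ?thesis by (simp add: \<eta>_def)
  qed
  have sum_g: "(\<Sum>p\<in>primes_in y (real q). real k * (g p)\<^sup>2) \<le> \<sigma>"
  proof -
    have "(\<Sum>p\<in>primes_in y (real q). real k * (g p)\<^sup>2) =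
        real k * lam\<^sup>2 * exp 2 * \<tau>\<^sup>2 * (y powr \<gamma>')\<^sup>2 * (\<Sum>p\<in>primes_in y (real q). (real p powr (-\<gamma>'))\<^sup>2)"
      unfolding sum_distrib_left using g_sq by (intro sum.cong refl) (auto dest: primes_inD(1) simp: mult_ac)
    also have "\<dots> \<le> real k * lam\<^sup>2 * exp 2 * \<tau>\<^sup>2 * (y powr \<gamma>')\<^sup>2 * ln y"
      by (intro mult_left_mono sum_primes) auto
    \<comment> \<open>The origin of exp 3: two factors e come from w^2 and one from here.\<close>
    also have "(y powr \<gamma>')\<^sup>2 = y * exp 1"
    proof -
      have "(y powr \<gamma>')\<^sup>2 = y powr (1 + 1 / ln y)"
        unfolding power2_eq_square \<gamma>'_def by (simp flip: powr_add)
      thus ?thesis using y y_pow by (simp add: powr_add)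
    qed
    also have "real k * lam\<^sup>2 * exp 2 * \<tau>\<^sup>2 * (y * exp 1) * ln y = exp 3 * real k * lam\<^sup>2 * \<tau>\<^sup>2 * y * ln y"
    proof -
      have "exp 3 = exp 2 * exp (1::real)" by (simp flip: exp_add)
      thus ?thesis by (simp add: mult_ac)
    qed
    also have "\<dots> \<le> \<sigma>" by (rule \<sigma>)
    finally show ?thesis .
  qed
  have "(\<Sum>N=1..q. (prod_reps B k N)\<^sup>2) \<le> s * P ^ (2 * k) * exp (2 * real k * \<sigma>)"
    unfolding B_def X_def
  proof (rule sum_prod_reps_square_le[of g P s x y])
    show "g (a * b) = g a * g b" if "a > 0" "b > 0" for a b
      using that by (simp add: g_def bigomega_mult power_add powr_mult)
  qed (use P0 s0 g_nonneg Psi_bound trivial_bound k small' sum_g in \<open>auto simp: g_def\<close>)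
  hence moment: "(\<Sum>\<xi>\<in>dirichlet_characters q. norm (\<Sum>n\<in>B. \<xi> n) ^ (2 * k)) \<le>
      real q * (s * P ^ (2 * k) * exp (2 * real k * \<sigma>))"
  proof (intro order_trans[OF sum_characters_power_le[of q B X k]] mult_left_mono)
    have "real X \<le> x" using y by (simp add: X_def)
    hence "real X ^ k \<le> x ^ k" by (intro power_mono) auto
    hence "real (X ^ k) \<le> real q" using xq unfolding of_nat_power by linarith
    thus "X ^ k \<le> q" by (simp only: of_nat_le_iff)
  qed (use q in \<open>auto simp: B_def\<close>)
  have diff: "rough_sum x y \<xi> = (\<Sum>n\<in>B. \<xi> n)" for \<xi> :: "nat \<Rightarrow> complex"
  proof -
    have "smooth_upto x y \<subseteq> {1..X}" by (auto simp: smooth_upto_def X_def le_nat_floor)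
    thus ?thesis by (simp add: B_def Psi_sum_def X_def sum_diff)
  qed
  have "real (card {\<xi>\<in>dirichlet_characters q. v < norm (\<Sum>n\<in>B. \<xi> n)}) * v ^ (2 * k) \<le>
      real q * (s * P ^ (2 * k) * exp (2 * real k * \<sigma>))"
    using v q by (intro order_trans[OF card_mult_power_le_sum moment] finite_dirichlet_characters) auto
  hence "real (card {\<xi>\<in>dirichlet_characters q. v < norm (\<Sum>n\<in>B. \<xi> n)}) \<le>
      real q * (s * P ^ (2 * k) * exp (2 * real k * \<sigma>)) / v ^ (2 * k)"
    using v by (simp add: field_simps)
  also have "exp (2 * real k * \<sigma>) = exp \<sigma> ^ (2 * k)" by (simp flip: exp_of_nat_mult)
  also have "real q * (s * P ^ (2 * k) * exp \<sigma> ^ (2 * k)) / v ^ (2 * k) =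
     real q * s * (A * Psi x y * exp \<sigma> / (lam * v)) ^ (2 * k)"
    by (simp add: P_def power_divide power_mult_distrib)
  finally show ?thesis by (simp only: diff)
qed

end

section \<open>Exceptional characters\<close>

text \<open>For t <= 1 the factor 1 / t makes up for exp (G t) - 1 being only of order G t; for t >
  1 the exponential wins. Of the exponent 2 t + 1, the part t + 1 is the loss in the moment and t
  the saving asked for in the exceptional set.\<close>

lemma gain_beats_loss:
  fixes t G A :: real
  assumes "t > 0" "A \<ge> 0" "G \<ge> A * exp 3 + 2"
  shows "A * exp (2 * t + 1) \<le> (1 + 1 / t) * (exp (G * t) - 1)"
proof (cases "t \<le> 1")
  case True
  have "A * exp (2 * t + 1) \<le> A * exp 3" using True assms by (intro mult_left_mono) auto
  also have "\<dots> \<le> G" using assms by simp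
  also have "\<dots> = 1 / t * (G * t)" using assms by simp
  also have "\<dots> \<le> (1 + 1 / t) * (exp (G * t) - 1)"
  proof (intro mult_mono)
    have "0 \<le> A * exp 3" using assms by simp
    hence "0 \<le> G" using assms by linarith
    thus "0 \<le> G * t" using assms by simp
    show "G * t \<le> exp (G * t) - 1" using exp_ge_add_one_self[of "G * t"] by linarith
  qed (use assms in auto)
  finally show ?thesis .
next
  case False
  have "A * exp 3 \<ge> 0" using assms by simp
  hence G2: "G \<ge> 2" using assms(3) by linarith
  have "A * exp 1 \<le> A * exp 3" using assms by (intro mult_left_mono) auto
  hence "A * exp 1 + 1 \<le> G - 1" using assms by simp
  also have "\<dots> \<le> exp (G - 2)" using exp_ge_add_one_self[of "G - 2"] by simp
  also have "\<dots> \<le> exp ((G - 2) * t)"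
  proof -
    have "(G - 2) * 1 \<le> (G - 2) * t" using G2 False by (intro mult_left_mono) auto
    thus ?thesis by simp
  qed
  finally have "exp (2 * t) * (A * exp 1 + 1) \<le> exp (2 * t) * exp ((G - 2) * t)"
    by (intro mult_left_mono) auto
  also have "\<dots> = exp (G * t)" by (simp add: exp_add[symmetric] algebra_simps)
  finally have 1: "exp (2 * t) * (A * exp 1) + exp (2 * t) \<le> exp (G * t)" by (simp add: distrib_left)
  have "A * exp (2 * t + 1) + 1 \<le> exp (2 * t) * (A * exp 1) + exp (2 * t)"
    using assms by (intro add_mono) (auto simp: exp_add)
  also note 1
  finally have "A * exp (2 * t + 1) \<le> 1 * (exp (G * t) - 1)" by simp
  also have "\<dots> \<le> (1 + 1 / t) * (exp (G * t) - 1)"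
  proof (intro mult_right_mono)
    show "0 \<le> exp (G * t) - 1" using G2 assms by simp
  qed (use assms in auto)
  finally show ?thesis .
qed

lemma powr_one_minus:
  fixes q a :: real
  assumes "q > 0"
  shows "q powr (1 - a) = q * exp (- (ln q * a))"
proof -
  have "q powr (1 - a) = q / q powr a" using assms by (simp add: powr_diff)
  also have "q powr a = exp (ln q * a)" using assms by (simp add: powr_def mult.commute)
  finally show ?thesis by (simp add: exp_minus divide_inverse)
qed

lemma norm_character_sums_le:
  assumes "\<xi> \<in> dirichlet_characters q"
  shows "norm (\<Sum>n\<in>S. \<xi> n) \<le> real (card S)"
  using sum_norm_le[of S \<xi> "\<lambda>_. 1"] norm_dirichlet_character_le[OF assms] by simp

lemma sum_minus_Psi_sum_eq_0:
  fixes f :: "nat \<Rightarrow> complex"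
  assumes "0 \<le> x" "x \<le> y"
  shows "rough_sum x y f = 0"
  by (simp add: Psi_sum_def smooth_upto_eq_all[OF assms])

text \<open>k is the integer part of ln q / ln x. As this ratio is at least 1, rounding loses at
  most a factor 2, which the moment exponent 2 k makes up for.\<close>

lemma moment_exponent:
  fixes x q :: real
  assumes "1 < x" "x \<le> q"
  obtains k where "k > 0" "real k * ln x \<le> ln q" "ln q \<le> 2 * real k * ln x" "x ^ k \<le> q"
proof -
  define k where "k = nat \<lfloor>ln q / ln x\<rfloor>"
  have l: "ln x > 0" "ln x \<le> ln q" using assms by auto
  have ge1: "1 \<le> ln q / ln x" using l by simp
  have k1: "k \<ge> 1" using ge1 by (simp add: k_def le_nat_iff le_floor_iff)
  have "real k \<le> ln q / ln x" using ge1 by (simp add: k_def)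
  hence kl: "real k * ln x \<le> ln q" using l by (simp add: le_divide_eq)
  have "ln q / ln x \<le> real k + 1" using ge1 by (simp add: k_def)
  also have "\<dots> \<le> 2 * real k" using k1 by simp
  finally have kl2: "ln q \<le> 2 * real k * ln x" using l by (simp add: divide_le_eq)
  have "ln (x ^ k) \<le> ln q" using kl assms by (simp add: ln_realpow)
  hence "x ^ k \<le> q" using assms by (subst (asm) ln_le_cancel_iff) auto
  thus ?thesis using that[of k] k1 kl kl2 by auto
qed

section \<open>The second assertion: comparison of two smoothness bounds\<close>

context prime_windows
begin

text \<open>Here \<open>Y / sqrt L\<close> is used as the smoothness bound: replacing it by \<open>Y\<close> gains a factor
  \<open>exp (G t)\<close> with \<open>G\<close> of order \<open>ln L\<close> and \<open>t = ln x / L\<^sup>2\<close>, which exceeds what the moment loses.\<close>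

lemma few_characters_exceed_Psi:
  fixes x L :: real and q :: nat
  defines "Y \<equiv> (exp L + (ln x)\<^sup>2) * L ^ 5"
  assumes Lq: "ln (real q) = exp L" and q: "q \<ge> 2" and x: "1 \<le> x" "x \<le> real q"
    and L: "L \<ge> 6" "L \<ge> 5 / c" "L \<ge> 8 * A" "L \<ge> 4 * (3 * exp 3 / c\<^sup>2)\<^sup>2" "L \<ge> 3 * exp 3 / c\<^sup>2"
      "2 * L ^ 5 \<le> exp L" "ln L \<ge> 4 * ln K"
      "c / (36 * C4 * ln K) * ln L \<ge> A * exp 3 + 2"
  shows "real (card {\<xi> \<in> dirichlet_characters q. \<not> norm (\<Sum>n = 1..nat \<lfloor>x\<rfloor>. \<xi> n) \<le> Psi x Y})
           \<le> real q powr (1 - 1 / L\<^sup>2)"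
proof (cases "x \<le> Y")
  case True
  have "norm (\<Sum>n = 1..nat \<lfloor>x\<rfloor>. \<xi> n) \<le> Psi x Y" if "\<xi> \<in> dirichlet_characters q" for \<xi>
    using norm_character_sums_le[OF that, of "{1..nat \<lfloor>x\<rfloor>}"] x True
    by (simp add: Psi_eq_card smooth_upto_eq_all)
  hence "{\<xi> \<in> dirichlet_characters q. \<not> norm (\<Sum>n = 1..nat \<lfloor>x\<rfloor>. \<xi> n) \<le> Psi x Y} = {}" by blast
  thus ?thesis by (simp only: card.empty) simp
next
  case False
  define l where "l = ln x"
  define t where "t = l / L\<^sup>2"
  define y where "y = Y / sqrt L"
  \<comment> \<open>For small t, exp (G t) - 1 is only of order t, so the twist grows as 1 / t. The
    cost is moderate: lam^2 t = t + 2 + 1 / t <= t + 2 L, because t > 1 / L.\<close>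
  define lam where "lam = 1 + 1 / t"
  define D where "D = 3 * exp 3 / c\<^sup>2"
  \<comment> \<open>36 = 4 * 9, with 4 from m >= ln L / (4 ln K) and 9 from ln Y <= 3 L.\<close>
  define G where "G = c / (36 * C4 * ln K) * ln L"
  have L0: "L > 0" "L \<ge> 2" "sqrt L \<le> L" "sqrt L \<ge> 1" "sqrt L * sqrt L = L"
    using L(1) real_sqrt_le_mono[of L "L * L"] by auto
  have eL: "exp L \<ge> 7" using L(1) exp_ge_add_one_self[of L] by linarith
  have L5: "L ^ 5 = L ^ 4 * L" by (simp add: eval_nat_numeral)
  have L4: "L ^ 4 \<ge> 2 ^ 4" using L0 by (intro power_mono) auto
  have l0: "l \<ge> 0" using x by (simp add: l_def)
  have "exp L * 1 \<le> exp L * L ^ 5" using L0 by (intro mult_left_mono one_le_power) auto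
  also have "\<dots> \<le> Y" unfolding Y_def distrib_right using L0 by simp
  finally have "exp L < x" using False by simp
  hence "ln (exp L) < ln x" using x by (subst ln_less_cancel_iff) auto
  hence lL: "l > L" by (simp add: l_def)
  have lq: "l \<le> exp L" using x Lq by (metis l_def ln_mono less_le_trans zero_less_one order.trans)
  have t0: "t > 0" using lL L0 by (simp add: t_def)
  have y_ge: "y \<ge> (exp L + l\<^sup>2) * L ^ 4"
  proof -
    have "(exp L + l\<^sup>2) * L ^ 4 * sqrt L \<le> (exp L + l\<^sup>2) * L ^ 4 * L" using L0 by (intro mult_left_mono) auto
    also have "\<dots> = Y" by (simp add: Y_def L5 l_def)
    finally show ?thesis using L0 by (simp add: y_def le_divide_eq)
  qed
  have y_ge1: "y \<ge> 16 * exp L" "y \<ge> l\<^sup>2 * L ^ 4"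
  proof -
    have "exp L * 16 \<le> (exp L + l\<^sup>2) * L ^ 4" using L4 by (intro mult_mono) auto
    thus "y \<ge> 16 * exp L" using y_ge by simp
    have "l\<^sup>2 * L ^ 4 \<le> (exp L + l\<^sup>2) * L ^ 4" using L0 by (intro mult_right_mono) auto
    thus "y \<ge> l\<^sup>2 * L ^ 4" using y_ge by simp
  qed
  have y1: "y - 1 \<ge> exp L" "y - 1 \<ge> y / 2" "y \<ge> 112" using y_ge1 eL by linarith+
  have reg1: "reg x (y - 1)"
    unfolding reg_def
  proof (intro conjI)
    have "ln (exp L) \<le> ln (y - 1)" using y1 by (intro ln_mono) auto
    thus "6 \<le> ln (y - 1)" using L(1) by simp
    have "5 / c * ln x \<le> L * l" unfolding l_def using L(2) x by (intro mult_right_mono) auto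
    also have "\<dots> \<le> sqrt (y - 1)"
    proof (rule real_le_rsqrt)
      have "2 \<le> L * L" using L0 mult_mono[of 2 L 1 L] by simp
      hence "(L * l)\<^sup>2 * 2 \<le> (L * l)\<^sup>2 * L\<^sup>2" unfolding power2_eq_square[of L] by (intro mult_left_mono) auto
      also have "\<dots> = l\<^sup>2 * L ^ 4" by (simp add: power_mult_distrib mult_ac flip: power_add)
      finally have "(L * l)\<^sup>2 * 2 \<le> y" using y_ge1 by linarith
      thus "(L * l)\<^sup>2 \<le> y - 1" using y1 by linarith
    qed
    finally show "5 / c * ln x \<le> sqrt (y - 1)" .
  qed (use x y1 in auto)
  have reg: "reg x y" by (rule reg_mono[OF reg1]) simp
  have yY: "y \<le> Y"
  proof -
    have "y * 1 \<le> y * sqrt L" using L0 y1 by (intro mult_left_mono) auto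
    thus ?thesis using L0 by (simp add: y_def)
  qed
  have Y3: "Y \<le> exp L ^ 3"
  proof -
    have "exp L * 1 \<le> exp L * exp L" using L0 by (intro mult_left_mono) auto
    moreover have "l * l \<le> exp L * exp L" using lq l0 by (intro mult_mono) auto
    ultimately have "exp L + (ln x)\<^sup>2 \<le> 2 * (exp L * exp L)"
      unfolding power2_eq_square l_def by linarith
    hence "Y \<le> (2 * (exp L * exp L)) * L ^ 5" unfolding Y_def using L0 by (intro mult_right_mono) auto
    also have "\<dots> = (exp L * exp L) * (2 * L ^ 5)" by simp
    also have "\<dots> \<le> (exp L * exp L) * exp L" using L(6) by (intro mult_left_mono) auto
    finally show ?thesis by (simp add: power3_eq_cube)
  qed
  have Y0: "Y > 1" using yY y1 by linarith
  have lnY: "ln Y \<le> 3 * L" "ln Y > 0"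
    using Y3 Y0 ln_mono[of Y "exp L ^ 3"] by (auto simp flip: exp_of_nat_mult)
  have lny: "0 < ln y" "ln y \<le> 3 * L"
  proof -
    have "ln y \<le> ln Y" using yY y1 by (intro ln_mono) auto
    thus "ln y \<le> 3 * L" using lnY by simp
    show "0 < ln y" using y1 by simp
  qed
  have lnK: "ln K > 0" using K_ge by simp
  \<comment> \<open>A number of windows of ratio K that fit between y and Y = y sqrt L, since K^m <=
    sqrt L.\<close>
  define m where "m = nat \<lfloor>ln L / (2 * ln K)\<rfloor>"
  have lnL2: "2 \<le> ln L / (2 * ln K)" using L(7) lnK by (simp add: le_divide_eq)
  hence m: "real m \<le> ln L / (2 * ln K)" by (simp add: m_def)
  have m': "real m \<ge> ln L / (4 * ln K)"
  proof -
    have "ln L / (2 * ln K) \<le> real m + 1" using lnL2 by (simp add: m_def)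
    moreover have "ln L / (4 * ln K) = ln L / (2 * ln K) / 2" by simp
    ultimately show ?thesis using lnL2 by linarith
  qed
  have "y * K ^ m \<le> Y"
  proof -
    have "real m * ln K \<le> ln L / 2" using m lnK by (simp add: field_simps)
    hence "ln (K ^ m) \<le> ln (sqrt L)" using K_ge L0 by (simp add: ln_realpow ln_sqrt)
    hence "K ^ m \<le> sqrt L" using K_ge L0 by (subst (asm) ln_le_cancel_iff) auto
    hence "y * K ^ m \<le> y * sqrt L" using y1 by (intro mult_left_mono) auto
    thus ?thesis using L0 by (simp add: y_def)
  qed
  hence "Psi x y \<le> exp (- (c / C4 * real m * ln x / (ln Y)\<^sup>2)) * Psi x Y"
    using False L(3) lL by (intro Psi_ratio reg1) (auto simp: l_def)
  also have "\<dots> \<le> exp (- (G * t)) * Psi x Y"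
  proof -
    have "G * t = c / C4 * (ln L / (4 * ln K)) * l / (3 * L)\<^sup>2"
      by (simp add: G_def t_def power_mult_distrib)
    also have "\<dots> \<le> c / C4 * real m * l / (ln Y)\<^sup>2"
      using m' c_pos C4_pos l0 lnY L0 by (intro frac_le mult_right_mono mult_left_mono power_mono) auto
    finally show ?thesis unfolding l_def by (intro mult_right_mono) auto
  qed
  finally have ratio: "exp (G * t) * Psi x y \<le> Psi x Y" by (simp add: exp_minus field_simps)
  \<comment> \<open>If the full sum exceeds \<Psi>(x, Y), its part over integers that are not
    y-smooth exceeds v, since the y-smooth part is at most \<Psi>(x, y).\<close>
  define v where "v = Psi x Y - Psi x y"
  have P1: "Psi x y \<ge> 1" using x by (intro Psi_ge_1)
  have v_ge: "v \<ge> (exp (G * t) - 1) * Psi x y" using ratio by (simp add: v_def algebra_simps)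
  have "A * exp 3 > 0" using A_ge_1 by simp
  hence G0: "G > 0" using L(8) unfolding G_def by linarith
  have v0: "v > 0"
  proof -
    have "0 < (exp (G * t) - 1) * Psi x y" using G0 t0 P1 by (intro mult_pos_pos) auto
    thus ?thesis using v_ge by linarith
  qed
  have lam: "lam > 1" using t0 by (simp add: lam_def)
  have x1: "1 < x" using \<open>exp L < x\<close> eL by linarith
  obtain k where k: "k > 0" "real k * l \<le> exp L" "exp L \<le> 2 * real k * l" "x ^ k \<le> real q"
    using moment_exponent[OF x1 x(2)] Lq by (auto simp: l_def)
  have D: "D > 0" "D \<le> L" "4 * D\<^sup>2 \<le> L" using L(4,5) c_pos by (auto simp: D_def)
  have main: "exp 3 / c\<^sup>2 * lam\<^sup>2 * (exp L * ln x * ln y / y) \<le> t + 1"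
  proof -
    have "exp 3 / c\<^sup>2 * lam\<^sup>2 * (exp L * ln x * ln y / y) \<le> exp 3 / c\<^sup>2 * lam\<^sup>2 * (exp L * l * (3 * L) / y)"
      using lny l0 y1 unfolding l_def by (intro mult_left_mono divide_right_mono mult_mono) auto
    also have "\<dots> \<le> exp 3 / c\<^sup>2 * lam\<^sup>2 * (exp L * l * (3 * L) / (exp L * L ^ 5 / sqrt L))"
    proof (intro mult_left_mono divide_left_mono)
      show "exp L * L ^ 5 / sqrt L \<le> y" unfolding y_def Y_def
        using L0 by (intro divide_right_mono mult_right_mono) auto
      show "0 < y * (exp L * L ^ 5 / sqrt L)" using y1 L0 by (intro mult_pos_pos divide_pos_pos) auto
    qed (use l0 L0 in auto)
    also have "exp L * l * (3 * L) / (exp L * L ^ 5 / sqrt L) = 3 * (t * sqrt L / L\<^sup>2)"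
      using L0(1) by (simp add: t_def field_simps eval_nat_numeral)
    also have "exp 3 / c\<^sup>2 * lam\<^sup>2 * (3 * (t * sqrt L / L\<^sup>2)) = (lam\<^sup>2 * t) * (D * sqrt L / L\<^sup>2)"
      by (simp add: D_def)
    also have "lam\<^sup>2 * t = t + 2 + 1 / t" using t0 by (simp add: lam_def power2_eq_square field_simps)
    also have "(t + 2 + 1 / t) * (D * sqrt L / L\<^sup>2) \<le> (t + 2 * L) * (D * sqrt L / L\<^sup>2)"
    proof (intro mult_right_mono)
      have "1 / t = L * (L / l)" by (simp add: t_def power2_eq_square)
      also have "\<dots> \<le> L * 1" using lL L0 by (intro mult_left_mono) auto
      finally show "t + 2 + 1 / t \<le> t + 2 * L" using L0 by simp
    qed (use D L0 in auto)
    also have "\<dots> = t * (D * sqrt L / L\<^sup>2) + 2 * D * (sqrt L * L / L\<^sup>2)"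
      by (simp add: ring_distribs add_divide_distrib mult_ac)
    also have "\<dots> \<le> t * 1 + 1"
    proof (intro add_mono mult_left_mono)
      have "D * sqrt L \<le> L * L" using D L0 by (intro mult_mono) auto
      thus "D * sqrt L / L\<^sup>2 \<le> 1" using L0 by (simp add: power2_eq_square)
      have "(2 * D)\<^sup>2 \<le> L" using D by (simp add: power_mult_distrib)
      hence "2 * D \<le> sqrt L" by (rule real_le_rsqrt)
      hence "2 * D * sqrt L \<le> L" using mult_right_mono[of "2 * D" "sqrt L" "sqrt L"] L0 by simp
      thus "2 * D * (sqrt L * L / L\<^sup>2) \<le> 1" using L0 by (simp add: power2_eq_square)
    qed (use t0 in auto)
    finally show ?thesis by simp
  qed
  have small: "2 * (t + 1) \<le> y"
  proof -
    have "t \<le> l / 1" unfolding t_def using l0 L0 by (intro divide_left_mono one_le_power) auto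
    hence "t \<le> exp L" using lq by simp
    hence "2 * t + 2 \<le> y" using y_ge1(1) eL by linarith
    thus ?thesis by simp
  qed
  have "{\<xi> \<in> dirichlet_characters q. \<not> norm (\<Sum>n = 1..nat \<lfloor>x\<rfloor>. \<xi> n) \<le> Psi x Y} \<subseteq>
      {\<xi> \<in> dirichlet_characters q. v < norm (rough_sum x y \<xi>)}"
  proof clarify
    fix \<xi> assume \<xi>: "\<xi> \<in> dirichlet_characters q" "\<not> norm (\<Sum>n = 1..nat \<lfloor>x\<rfloor>. \<xi> n) \<le> Psi x Y"
    have "norm (Psi_sum x y \<xi>) \<le> Psi x y"
      unfolding Psi_eq_card Psi_sum_def by (rule norm_character_sums_le[OF \<xi>(1)])
    thus "v < norm (rough_sum x y \<xi>)"
      using \<xi>(2) norm_triangle_sub[of "\<Sum>n = 1..nat \<lfloor>x\<rfloor>. \<xi> n" "Psi_sum x y \<xi>"] by (simp add: v_def)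
  qed
  hence "real (card {\<xi> \<in> dirichlet_characters q. \<not> norm (\<Sum>n = 1..nat \<lfloor>x\<rfloor>. \<xi> n) \<le> Psi x Y}) \<le>
      real (card {\<xi> \<in> dirichlet_characters q. v < norm (rough_sum x y \<xi>)})"
    using finite_dirichlet_characters[of q] q by (intro of_nat_mono card_mono) auto
  also have "\<dots> \<le> real q * 1 * (A * Psi x y * exp (t + 1) / (lam * v)) ^ (2 * k)"
    using lam v0 main small k q reg by (intro few_characters_large[where W = "exp L"]) (auto simp: l_def)
  \<comment> \<open>The gain \<Psi>(x, Y) / \<Psi>(x, y) brings the base of the power down to exp
    (-t), and 2 k t >= ln q / L^2.\<close>
  also have "\<dots> \<le> real q * 1 * exp (- t) ^ (2 * k)"
  proof (intro mult_left_mono power_mono)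
    have "A * exp (2 * t + 1) \<le> lam * (exp (G * t) - 1)" unfolding lam_def
      using t0 A_ge_1 L(8) unfolding G_def by (intro gain_beats_loss) auto
    hence "A * exp (2 * t + 1) * Psi x y \<le> lam * (exp (G * t) - 1) * Psi x y" by (intro mult_right_mono) auto
    also have "\<dots> \<le> lam * v" using v_ge lam by (simp add: mult.assoc)
    finally have "A * exp (2 * t + 1) * Psi x y \<le> lam * v" .
    moreover have "exp (2 * t + 1) = exp (t + 1) * exp t" by (simp flip: exp_add)
    ultimately have "A * Psi x y * exp (t + 1) * exp t \<le> lam * v" by (simp only: mult_ac)
    thus "A * Psi x y * exp (t + 1) / (lam * v) \<le> exp (- t)"
      using lam v0 by (simp add: exp_minus field_simps)
  qed (use A_ge_1 lam v0 in auto)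
  also have "exp (- t) ^ (2 * k) = exp (- (2 * real k * l / L\<^sup>2))"
    by (simp add: t_def flip: exp_of_nat_mult)
  also have "real q * 1 * \<dots> \<le> real q * exp (- (exp L / L\<^sup>2))"
  proof -
    have "exp L / L\<^sup>2 \<le> 2 * real k * l / L\<^sup>2" using k(3) by (intro divide_right_mono) auto
    thus ?thesis by (simp only: mult_1_right) (intro mult_left_mono, auto)
  qed
  also have "\<dots> = real q powr (1 - 1 / L\<^sup>2)"
    using q Lq powr_one_minus[of "real q" "1 / L\<^sup>2"] by simp
  finally show ?thesis .
qed

end

section \<open>The first assertion: uniformity in y\<close>

lemma norm_Psi_sum_diff_le:
  assumes "\<xi> \<in> dirichlet_characters q" "a \<le> y"
  shows "norm (Psi_sum x y \<xi> - Psi_sum x a \<xi>) \<le> Psi x y - Psi x a"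
proof -
  have sub: "smooth_upto x a \<subseteq> smooth_upto x y" using assms(2) by (auto simp: smooth_upto_def intro: order_trans)
  have "Psi_sum x y \<xi> - Psi_sum x a \<xi> = (\<Sum>n\<in>smooth_upto x y - smooth_upto x a. \<xi> n)"
    unfolding Psi_sum_def using sub by (subst sum_diff) (auto simp: finite_smooth_upto)
  hence "norm (Psi_sum x y \<xi> - Psi_sum x a \<xi>) \<le> real (card (smooth_upto x y - smooth_upto x a))"
    using norm_character_sums_le[OF assms(1)] by metis
  also have "\<dots> = Psi x y - Psi x a"
    using card_mono[OF finite_smooth_upto sub] card_Diff_subset[OF finite_smooth_upto sub]
    by (simp add: Psi_eq_card)
  finally show ?thesis .
qed

lemma card_primes_in_le:
  assumes "0 \<le> a" "a \<le> b"
  shows "real (card (primes_in a b)) \<le> b - a + 1"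
proof -
  define u v where "u = nat \<lfloor>a\<rfloor>" and "v = nat \<lfloor>b\<rfloor>"
  have u: "a - 1 \<le> real u" unfolding u_def by (rule real_nat_floor_ge)
  have v: "real v \<le> b" using assms by (simp add: v_def)
  have uv: "u \<le> v" unfolding u_def v_def using assms by (intro nat_mono floor_mono)
  have "primes_in a b \<subseteq> {u<..v}"
  proof
    fix p assume p: "p \<in> primes_in a b"
    hence "real u < real p" using assms by (auto simp: primes_in_def u_def) linarith
    moreover have "p \<le> v" using p by (auto simp: primes_in_def v_def le_nat_floor)
    ultimately show "p \<in> {u<..v}" by simp
  qed
  hence "card (primes_in a b) \<le> v - u" using card_mono[of "{u<..v}"] by fastforce
  thus ?thesis using u v uv by linarith
qed

text \<open>A y-smooth n that is not a-smooth has a prime factor p in (a, y], and \<Psi>(x / p, y)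
  <= \<Psi>(x / a, y). The number of such p is bounded by the number of integers in the
  interval.\<close>

lemma Psi_increment_le:
  assumes "0 < a" "a \<le> y" "0 \<le> x"
  shows "Psi x y - Psi x a \<le> (y - a + 1) * Psi (x / a) y"
proof -
  have "smooth_upto x y \<subseteq> smooth_upto x a \<union> (\<Union>p\<in>primes_in a y. {n\<in>smooth_upto x y. p dvd n})"
    by (auto simp: smooth_upto_def primes_in_def)
  hence "card (smooth_upto x y) \<le> card (smooth_upto x a \<union> (\<Union>p\<in>primes_in a y. {n\<in>smooth_upto x y. p dvd n}))"
    by (intro card_mono) (auto simp: finite_smooth_upto)
  also have "\<dots> \<le> card (smooth_upto x a) + card (\<Union>p\<in>primes_in a y. {n\<in>smooth_upto x y. p dvd n})"
    by (rule card_Un_le)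
  also have "card (\<Union>p\<in>primes_in a y. {n\<in>smooth_upto x y. p dvd n}) \<le>
      (\<Sum>p\<in>primes_in a y. card {n\<in>smooth_upto x y. p dvd n})" by (rule card_UN_le) simp
  finally have "Psi x y \<le> Psi x a + (\<Sum>p\<in>primes_in a y. real (card {n\<in>smooth_upto x y. p dvd n}))"
    unfolding Psi_eq_card by (simp flip: of_nat_sum of_nat_add)
  also have "(\<Sum>p\<in>primes_in a y. real (card {n\<in>smooth_upto x y. p dvd n})) \<le> (\<Sum>p\<in>primes_in a y. Psi (x / a) y)"
  proof (rule sum_mono)
    fix p assume p: "p \<in> primes_in a y"
    have "real (card {n\<in>smooth_upto x y. p dvd n}) = Psi (x / real p) y"
      using card_smooth_prime_power_multiples[of p y x 1] primes_inD(1,3)[OF p] by simp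
    also have "\<dots> \<le> Psi (x / a) y"
      using primes_inD(2)[OF p] assms by (intro Psi_mono divide_left_mono mult_pos_pos) auto
    finally show "real (card {n\<in>smooth_upto x y. p dvd n}) \<le> Psi (x / a) y" .
  qed
  also have "\<dots> = real (card (primes_in a y)) * Psi (x / a) y" by simp
  also have "\<dots> \<le> (y - a + 1) * Psi (x / a) y"
    using card_primes_in_le[of a y] assms by (intro mult_right_mono) auto
  finally show ?thesis by simp
qed

text \<open>The index is bounded through ln (1 + \<delta>) >= \<delta> / 2, valid for \<delta> <=
  1.\<close>

lemma geometric_grid:
  fixes y y0 \<delta> :: real
  assumes "0 < y0" "y0 \<le> y" "0 < \<delta>" "\<delta> \<le> 1"
  obtains i where "y0 * (1 + \<delta>) ^ i \<le> y" "y \<le> y0 * (1 + \<delta>) ^ i * (1 + \<delta>)" "real i \<le> 2 * ln (y / y0) / \<delta>"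
proof -
  define r where "r = 1 + \<delta>"
  define i where "i = (LEAST n. y < y0 * r ^ Suc n)"
  have "r > 1" using assms by (simp add: r_def)
  obtain n where "y / y0 < r ^ n" using real_arch_pow[OF \<open>r > 1\<close>] by blast
  also have "r ^ n \<le> r ^ Suc n" using \<open>r > 1\<close> by (intro power_increasing) auto
  finally have "y < y0 * r ^ Suc n" using assms by (simp add: field_simps)
  hence 1: "y < y0 * r ^ Suc i" unfolding i_def by (rule LeastI)
  have 2: "y0 * r ^ i \<le> y"
  proof (cases i)
    case (Suc j)
    thus ?thesis using not_less_Least[of j "\<lambda>n. y < y0 * r ^ Suc n"] by (simp add: i_def not_less)
  qed (use assms in simp)
  have "ln (1 / r) \<le> 1 / r - 1" using \<open>r > 1\<close> by (intro ln_le_minus_one) auto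
  hence "\<delta> / r \<le> ln r" using \<open>r > 1\<close> by (simp add: ln_div r_def field_simps)
  moreover have "\<delta> / 2 \<le> \<delta> / r" using assms by (intro divide_left_mono) (auto simp: r_def)
  ultimately have "\<delta> / 2 \<le> ln r" by linarith
  hence "real i * (\<delta> / 2) \<le> real i * ln r" by (rule mult_left_mono) simp
  also have "\<dots> = ln (r ^ i)" using \<open>r > 1\<close> by (simp add: ln_realpow)
  also have "\<dots> \<le> ln (y / y0)" using 2 assms \<open>r > 1\<close> by (intro ln_mono) (auto simp: field_simps)
  finally have "real i \<le> 2 * ln (y / y0) / \<delta>" using assms by (simp add: field_simps)
  thus ?thesis using that[of i] 1 2 by (simp add: r_def mult_ac)
qed

context prime_windows
begin

text \<open>With u = y / y0, the 5 bounds ln y / (L sqrt u): 3 from ln y0 <= 3 L and 2 from ln u <=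
  2 sqrt u.\<close>

definition \<sigma>\<^sub>0 where "\<sigma>\<^sub>0 = 5 * exp 3 / c\<^sup>2"

text \<open>The extra exp 5 makes the base of the power 2 k at most exp (-5). Of the resulting exp
  (-10 k), the factor exp (-2 k) is the target; the rest can pay for the grid.\<close>

definition C1 where "C1 = A * exp (\<sigma>\<^sub>0 + 5)"

text \<open>The factor exp (-4 L) is reserved for the union over a grid of y. It comes from exp (-10
  k) if k >= L, from a power of y / y0 if ln y >= 20 L, and otherwise from s = A x^(-1 / (2 ln y)):
  then k < L makes ln x at least exp L / (2 L), while ln y < 20 L.\<close>

lemma few_characters_far_from_smooth_sum_at:
  fixes x y L :: real and q k :: nat
  defines "y0 \<equiv> exp L * ln x * L ^ 5"
  assumes q: "q \<ge> 2" and x: "1 < x" and l: "L \<le> ln x" "ln x \<le> exp L" and y: "y0 \<le> y"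
    and k: "k > 0" "real k * ln x \<le> exp L" "exp L \<le> 2 * real k * ln x" "x ^ k \<le> real q"
    and L: "L \<ge> 6" "L \<ge> 5 / c" "L ^ 5 \<le> exp L" "2 * \<sigma>\<^sub>0 \<le> exp L"
      "A * exp (- (exp L / (80 * L\<^sup>2))) \<le> exp (- 4 * L)"
  shows "real (card {\<xi>\<in>dirichlet_characters q.
            C1 * Psi x y / L\<^sup>2 < norm (rough_sum x y \<xi>)})
           \<le> real q * exp (- 2 * real k - 4 * L)"
proof -
  define l where "l = ln x"
  define u where "u = y / y0"
  \<comment> \<open>lam^2 then grows only as sqrt u, while y contributes a full factor u; the
    surplus sqrt u absorbs the ln u contained in ln y, uniformly in y.\<close>
  define \<rho> where "\<rho> = u powr (1 / 4)"
  define lam where "lam = L\<^sup>2 * \<rho>"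
  have L0: "L > 0" "L \<ge> 1" using L by auto
  have eL: "exp L \<ge> 7" using L(1) exp_ge_add_one_self[of L] by linarith
  have l0: "l \<ge> 6" using l L by (simp add: l_def)
  have lq: "l \<le> exp L" using l by (simp add: l_def)
  have L2: "L\<^sup>2 \<ge> 1" using L0 by (intro one_le_power)
  have L52: "L\<^sup>2 \<le> L ^ 5" using L0 by (intro power_increasing) auto
  have y0_ge: "y0 \<ge> exp L" "y0 \<ge> l\<^sup>2 * L\<^sup>2" "y0 \<le> exp L ^ 3"
  proof -
    have "exp L * 1 * 1 \<le> exp L * l * L ^ 5" using l0 L0 by (intro mult_mono one_le_power) auto
    thus "y0 \<ge> exp L" by (simp add: y0_def l_def)
    have "l * l * L\<^sup>2 \<le> exp L * l * L ^ 5" using lq l0 L52 by (intro mult_mono) auto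
    thus "y0 \<ge> l\<^sup>2 * L\<^sup>2" by (simp add: y0_def l_def power2_eq_square)
    have "exp L * l * L ^ 5 \<le> exp L * exp L * exp L" using lq l0 L by (intro mult_mono) auto
    thus "y0 \<le> exp L ^ 3" by (simp add: y0_def l_def power3_eq_cube)
  qed
  have y0pos: "y0 > 0" using y0_ge eL by linarith
  have ypos: "y \<ge> exp L" "y > 1" using y y0_ge eL by linarith+
  have u1: "u \<ge> 1" using y y0pos by (simp add: u_def)
  have yu: "y = y0 * u" using y0pos by (simp add: u_def)
  have \<rho>1: "\<rho> \<ge> 1" using u1 by (simp add: \<rho>_def ge_one_powr_ge_zero)
  have \<rho>2: "\<rho>\<^sup>2 = sqrt u" using u1 by (simp add: \<rho>_def powr_half_sqrt power2_eq_square flip: powr_add)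
  have lny0: "ln y0 \<le> 3 * L"
    using ln_mono[of y0 "exp L ^ 3"] y0_ge y0pos by (simp flip: exp_of_nat_mult)
  have lny: "ln y = ln y0 + ln u" using y0pos u1 by (simp add: yu ln_mult)
  have reg: "reg x y" unfolding reg_def
  proof (intro conjI)
    have "ln (exp L) \<le> ln y" using ypos by (intro ln_mono) auto
    thus "6 \<le> ln y" using L(1) by simp
    have "5 / c * ln x \<le> L * l" unfolding l_def using L(2) x by (intro mult_right_mono) auto
    also have "\<dots> \<le> sqrt y" using y0_ge(2) y by (intro real_le_rsqrt) (simp add: power_mult_distrib mult.commute)
    finally show "5 / c * ln x \<le> sqrt y" .
  qed (use x ypos in auto)
  have lam: "lam \<ge> 1" using mult_mono[OF L2 \<rho>1] L2 by (simp add: lam_def)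
  have main: "exp 3 / c\<^sup>2 * lam\<^sup>2 * (exp L * ln x * ln y / y) \<le> \<sigma>\<^sub>0"
  proof -
    have "lam\<^sup>2 = L ^ 4 * sqrt u" by (simp add: lam_def power_mult_distrib \<rho>2 flip: power_mult)
    moreover have "exp L * ln x * ln y / y = ln y / (L ^ 5 * u)"
      using l0 by (simp add: yu l_def) (simp add: y0_def)
    ultimately have "exp 3 / c\<^sup>2 * lam\<^sup>2 * (exp L * ln x * ln y / y) =
        exp 3 / c\<^sup>2 * (L ^ 4 * sqrt u) * (ln y / (L ^ 5 * u))" by simp
    also have "exp 3 / c\<^sup>2 * (L ^ 4 * sqrt u) * (ln y / (L ^ 5 * u)) = exp 3 / c\<^sup>2 * (ln y / (L * sqrt u))"
    proof -
      have "sqrt u * sqrt u = u" using u1 by simp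
      hence "sqrt u / u = 1 / sqrt u" using u1 by (simp add: field_simps)
      moreover have "L ^ 4 / L ^ 5 = 1 / L" using L0 by (simp add: eval_nat_numeral)
      moreover have "(L ^ 4 * sqrt u) * (ln y / (L ^ 5 * u)) = ln y * (L ^ 4 / L ^ 5) * (sqrt u / u)" by simp
      ultimately have "(L ^ 4 * sqrt u) * (ln y / (L ^ 5 * u)) = ln y / (L * sqrt u)" by simp
      thus ?thesis by (simp only: mult.assoc)
    qed
    also have "\<dots> \<le> exp 3 / c\<^sup>2 * 5"
    proof (intro mult_left_mono)
      have "ln u = 2 * ln (sqrt u)" using u1 by (simp add: ln_sqrt)
      also have "\<dots> \<le> 2 * sqrt u" using u1 by (intro mult_left_mono less_imp_le ln_less_self) auto
      also have "\<dots> \<le> 2 * (L * sqrt u)" using L0 u1 by simp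
      finally have "ln u \<le> 2 * (L * sqrt u)" .
      moreover have "ln y0 \<le> 3 * (L * sqrt u)"
      proof -
        have "L * 1 \<le> L * sqrt u" using L0 u1 by (intro mult_left_mono) auto
        thus ?thesis using lny0 by linarith
      qed
      ultimately have "ln y \<le> 5 * (L * sqrt u)" using lny by linarith
      thus "ln y / (L * sqrt u) \<le> 5" using L0 u1 by (simp add: divide_le_eq)
    qed auto
    also have "\<dots> = \<sigma>\<^sub>0" by (simp add: \<sigma>\<^sub>0_def)
    finally show ?thesis .
  qed
  have small: "2 * \<sigma>\<^sub>0 \<le> y" using L(4) ypos by linarith
  have P1: "Psi x y \<ge> 1" using x by (intro Psi_ge_1) auto
  have C1: "C1 > 0" using A_ge_1 by (simp add: C1_def)
  have v0: "C1 * Psi x y / L\<^sup>2 > 0" using C1 P1 L0 by (intro divide_pos_pos mult_pos_pos) auto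
  have ratio: "A * Psi x y * exp \<sigma>\<^sub>0 / (lam * (C1 * Psi x y / L\<^sup>2)) = exp (- 5) / \<rho>"
  proof -
    have "A * Psi x y * exp \<sigma>\<^sub>0 / (lam * (C1 * Psi x y / L\<^sup>2)) = A * exp \<sigma>\<^sub>0 / (\<rho> * C1)"
      using P1 L0 by (simp add: lam_def)
    also have "\<dots> = exp (- 5) / \<rho>" using A_ge_1 by (simp add: C1_def exp_add exp_minus field_simps)
    finally show ?thesis .
  qed
  have bound: "real (card {\<xi>\<in>dirichlet_characters q.
            C1 * Psi x y / L\<^sup>2 < norm (rough_sum x y \<xi>)})
      \<le> real q * s * (exp (- 5) / \<rho>) ^ (2 * k)"
    if s: "s = 1 \<or> s = A * x powr (-(1 / (2 * ln y)))" for s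
    unfolding ratio[symmetric]
    using s lam v0 main small k q reg by (intro few_characters_large[where W = "exp L"]) auto
  have e10: "exp (- 5 :: real) ^ (2 * k) = exp (- 10 * real k)" by (simp flip: exp_of_nat_mult)
  have \<rho>k: "0 \<le> 1 / \<rho> ^ (2 * k)" "1 / \<rho> ^ (2 * k) \<le> 1" using \<rho>1 by (auto simp: divide_le_eq)
  have ek: "exp (- 10 * real k) * exp (- 4 * L) \<le> exp (- 2 * real k - 4 * L)" by (simp flip: exp_add)
  consider "real k \<ge> L" | "real k < L" "ln y \<ge> 20 * L" | "real k < L" "ln y < 20 * L" by linarith
  thus ?thesis
  proof cases
    case 1
    have "1 * (exp (- 5) / \<rho>) ^ (2 * k) = exp (- 10 * real k) * (1 / \<rho> ^ (2 * k))"
      by (simp add: power_divide e10)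
    also have "\<dots> \<le> exp (- 10 * real k) * 1" using \<rho>k by (intro mult_left_mono) auto
    also have "\<dots> \<le> exp (- 2 * real k - 4 * L)" using 1 by simp
    finally have "real q * (1 * (exp (- 5) / \<rho>) ^ (2 * k)) \<le> real q * exp (- 2 * real k - 4 * L)"
      by (intro mult_left_mono) auto
    thus ?thesis using bound[of 1] by (simp only: mult.assoc) linarith
  next
    case 2
    have "1 / \<rho> ^ (2 * k) \<le> exp (- 4 * L)"
    proof -
      have "exp (8 * L) \<le> sqrt u"
      proof (rule real_le_rsqrt)
        have "16 * L \<le> ln u" using 2 lny lny0 L0 by linarith
        hence "exp (16 * L) \<le> exp (ln u)" by simp
        thus "(exp (8 * L))\<^sup>2 \<le> u" using u1 by (simp flip: exp_double)
      qed
      also have "\<dots> = \<rho> ^ 2" by (simp add: \<rho>2)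
      also have "\<dots> \<le> \<rho> ^ (2 * k)" using \<rho>1 k by (intro power_increasing) auto
      finally have "exp (4 * L) \<le> \<rho> ^ (2 * k)" using L0 by (elim order_trans[rotated]) simp
      hence "1 / \<rho> ^ (2 * k) \<le> 1 / exp (4 * L)" using \<rho>1 by (intro divide_left_mono) auto
      thus ?thesis by (simp add: exp_minus field_simps)
    qed
    hence "exp (- 10 * real k) * (1 / \<rho> ^ (2 * k)) \<le> exp (- 10 * real k) * exp (- 4 * L)"
      by (intro mult_left_mono) auto
    also note ek
    finally have "real q * (1 * (exp (- 5) / \<rho>) ^ (2 * k)) \<le> real q * exp (- 2 * real k - 4 * L)"
      by (intro mult_left_mono) (auto simp: power_divide e10)
    thus ?thesis using bound[of 1] by (simp only: mult.assoc) linarith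
  next
    case 3
    define s where "s = A * x powr (-(1 / (2 * ln y)))"
    have lnypos: "ln y > 0" using ypos by simp
    have s: "s \<le> exp (- 4 * L)"
    proof -
      have kL: "exp L \<le> 2 * L * l"
      proof -
        have "exp L \<le> 2 * real k * l" using k by (simp add: l_def)
        also have "\<dots> \<le> 2 * L * l" using 3 l0 by (intro mult_right_mono) auto
        finally show ?thesis .
      qed
      have "exp L / (80 * L\<^sup>2) \<le> (2 * L * l) / (80 * L\<^sup>2)" using kL by (intro divide_right_mono) auto
      also have "\<dots> = l / (40 * L)" using L0 by (simp add: power2_eq_square)
      also have "\<dots> \<le> l / (2 * ln y)" using 3 lnypos l0 L0 by (intro divide_left_mono) auto
      finally have "exp (- (l / (2 * ln y))) \<le> exp (- (exp L / (80 * L\<^sup>2)))" by simp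
      moreover have "x powr (-(1 / (2 * ln y))) = exp (- (l / (2 * ln y)))"
        using x by (simp add: powr_def l_def)
      ultimately have "s \<le> A * exp (- (exp L / (80 * L\<^sup>2)))"
        unfolding s_def using A_ge_1 by simp
      thus ?thesis using L(5) by linarith
    qed
    have s0: "s \<ge> 0" using A_ge_1 by (simp add: s_def)
    have "s * (exp (- 5) / \<rho>) ^ (2 * k) = s * exp (- 10 * real k) * (1 / \<rho> ^ (2 * k))"
      by (simp add: power_divide e10)
    also have "\<dots> \<le> exp (- 4 * L) * exp (- 10 * real k) * 1"
      using s s0 \<rho>k by (intro mult_mono) auto
    also have "\<dots> \<le> exp (- 2 * real k - 4 * L)" using ek by (simp add: mult.commute)
    finally have "real q * (s * (exp (- 5) / \<rho>) ^ (2 * k)) \<le> real q * exp (- 2 * real k - 4 * L)"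
      by (intro mult_left_mono) auto
    thus ?thesis using bound[of s] by (simp only: mult.assoc s_def) linarith
  qed
qed

text \<open>The bounds for single \<open>y\<close> are combined over a grid fine enough that \<open>\<Psi>(x, y)\<close> changes by a
  factor \<open>1 + O(1 / L\<^sup>2)\<close> between neighbours.\<close>

lemma few_characters_far_from_smooth_sum:
  fixes x L :: real and q :: nat
  defines "y0 \<equiv> exp L * ln x * L ^ 5"
  assumes Lq: "ln (real q) = exp L" and q: "q \<ge> 2" and x: "1 \<le> x" "x \<le> real q"
    and L: "L \<ge> 6" "L \<ge> 5 / c" "L ^ 5 \<le> exp L" "2 * \<sigma>\<^sub>0 \<le> exp L"
      "A * exp (- (exp L / (80 * L\<^sup>2))) \<le> exp (- 4 * L)" "2 * (exp L)\<^sup>2 * L\<^sup>2 + 1 \<le> exp (4 * L)"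
  shows "real (card {\<xi> \<in> dirichlet_characters q.
        \<not> (\<forall>y::real. y \<ge> y0 \<longrightarrow> norm (rough_sum x y \<xi>)
               \<le> (C1 + 2 / c) * (Psi x y / L\<^sup>2))})
      \<le> (if x = 1 then 0 else real q powr (1 - 1 / ln x))"
proof -
  define Bad where "Bad = {\<xi> \<in> dirichlet_characters q.
        \<not> (\<forall>y::real. y \<ge> y0 \<longrightarrow> norm (rough_sum x y \<xi>)
               \<le> (C1 + 2 / c) * (Psi x y / L\<^sup>2))}"
  define l where "l = ln x"
  have C1: "C1 > 0" using A_ge_1 by (simp add: C1_def)
  have L0: "L > 0" "L \<ge> 1" using L by auto
  have L2: "L\<^sup>2 \<ge> 1" using L0 by (intro one_le_power)
  have rhs_nonneg: "0 \<le> (C1 + 2 / c) * (Psi x y / L\<^sup>2)" for y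
    using C1 c_pos by (intro mult_nonneg_nonneg divide_nonneg_nonneg add_nonneg_nonneg) auto
  show ?thesis
  \<comment> \<open>Here both sums agree for every y >= y0: for x < 2 only n = 1 occurs, and for x
    <= y0 every n <= x is y-smooth.\<close>
  proof (cases "x < 2 \<or> x \<le> y0")
    case True
    have "rough_sum x y \<xi> = 0" if "y \<ge> y0" for \<xi> :: "nat \<Rightarrow> complex" and y
    proof (cases "x < 2")
      case True
      have "\<lfloor>x\<rfloor> = 1" using x True by (simp add: floor_eq_iff)
      moreover have "smooth_upto x y = {1}"
      proof (intro equalityI subsetI)
        fix n assume "n \<in> smooth_upto x y"
        hence "0 < n" "real n < 2" using True by (auto simp: smooth_upto_def)
        thus "n \<in> {1}" by simp
      qed (use x not_prime_unit in \<open>auto simp: smooth_upto_def\<close>)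
      ultimately show ?thesis by (simp add: Psi_sum_def)
    next
      case False
      thus ?thesis using \<open>x < 2 \<or> x \<le> y0\<close> that x by (intro sum_minus_Psi_sum_eq_0) auto
    qed
    hence "Bad = {}" unfolding Bad_def using rhs_nonneg by simp
    thus ?thesis unfolding Bad_def[symmetric] by simp
  next
    case False
    hence x2: "x \<ge> 2" "y0 < x" by auto
    have x1: "1 < x" using x2 by simp
    have eL: "exp L \<ge> 7" using L(1) exp_ge_add_one_self[of L] by linarith
    have lq: "l \<le> exp L" using x x1 Lq ln_mono[of x "real q"] by (simp add: l_def)
    have y0_ge: "y0 \<ge> exp L"
    proof -
      have "ln 2 \<le> ln x" using x2 by simp
      hence "2 / 3 \<le> l" using ln2_ge_two_thirds unfolding l_def by linarith
      moreover have "2 * 1 \<le> L ^ 5" using L0 L(1) power_increasing[of 1 5 L] by simp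
      ultimately have "2 / 3 * 2 \<le> l * L ^ 5" by (intro mult_mono) auto
      hence "exp L * 1 \<le> exp L * (l * L ^ 5)" by (intro mult_left_mono) auto
      thus ?thesis by (simp add: y0_def l_def mult.assoc)
    qed
    have lL: "L \<le> l"
    proof -
      have "ln (exp L) \<le> ln x" using y0_ge x2 x1 by (intro ln_mono) auto
      thus ?thesis by (simp add: l_def)
    qed
    have l0: "l \<ge> 6" using lL L by simp
    obtain k where k: "k > 0" "real k * l \<le> exp L" "exp L \<le> 2 * real k * l" "x ^ k \<le> real q"
      using moment_exponent[OF x1 x(2)] Lq by (auto simp: l_def)
    \<comment> \<open>Enlarging y by the factor 1 + \<delta> changes \<Psi> by a proportion of about
      \<delta> ln x / c, by \<open>Psi_step\<close>; this \<delta> makes it of order 1 /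
      L^2.\<close>
    define \<delta> where "\<delta> = 1 / (l * L\<^sup>2)"
    have lL2: "l * L\<^sup>2 \<ge> 1" using l0 L2 mult_mono[of 1 l 1 "L\<^sup>2"] by simp
    have \<delta>: "0 < \<delta>" "\<delta> \<le> 1" using lL2 by (auto simp: \<delta>_def)
    \<comment> \<open>Only y < x matter, so 2 ln x / \<delta> = 2 l^2 L^2 grid steps suffice. This
      is polynomial in ln q = exp L and L, hence below exp (4 L).\<close>
    define N where "N = nat \<lfloor>2 * l\<^sup>2 * L\<^sup>2\<rfloor>"
    define Y where "Y i = y0 * (1 + \<delta>) ^ i" for i :: nat
    define F where "F y = {\<xi>\<in>dirichlet_characters q.
            C1 * Psi x y / L\<^sup>2 < norm (rough_sum x y \<xi>)}" for y
    have y0pos: "y0 > 0" using y0_ge eL by linarith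
    have Y_ge: "Y i \<ge> y0" for i
    proof -
      have "1 \<le> (1 + \<delta>) ^ i" using \<delta> by (intro one_le_power) auto
      thus ?thesis using y0pos by (simp add: Y_def)
    qed
    have finF: "finite (F y)" for y unfolding F_def using finite_dirichlet_characters[of q] q by auto
    have sub: "Bad \<subseteq> (\<Union>i\<in>{..N}. F (Y i))"
    proof
      fix \<xi> assume "\<xi> \<in> Bad"
      then obtain y where \<xi>: "\<xi> \<in> dirichlet_characters q" and y: "y \<ge> y0"
        and bad: "norm (rough_sum x y \<xi>) > (C1 + 2 / c) * (Psi x y / L\<^sup>2)"
        by (auto simp: Bad_def not_le)
      have yx: "y < x"
      proof (rule ccontr)
        assume "\<not> y < x"
        hence "rough_sum x y \<xi> = 0" using x by (intro sum_minus_Psi_sum_eq_0) auto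
        thus False using bad rhs_nonneg[of y] by simp
      qed
      obtain i where i: "Y i \<le> y" "y \<le> Y i * (1 + \<delta>)" "real i \<le> 2 * ln (y / y0) / \<delta>"
        unfolding Y_def by (rule geometric_grid[OF y0pos y \<delta>])
      have "i \<le> N"
      proof -
        have "y / y0 \<le> x / 1" using yx y0_ge eL x1 by (intro frac_le) auto
        hence "ln (y / y0) \<le> l" unfolding l_def using y y0pos x1 by (intro ln_mono) auto
        hence "2 * ln (y / y0) / \<delta> \<le> 2 * l / \<delta>" using \<delta> by (intro divide_right_mono mult_left_mono) auto
        also have "\<dots> = 2 * l\<^sup>2 * L\<^sup>2" by (simp add: \<delta>_def power2_eq_square)
        finally have "real i \<le> 2 * l\<^sup>2 * L\<^sup>2" using i by linarith
        thus ?thesis by (simp add: N_def le_nat_floor)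
      qed
      have Yi: "Y i \<ge> exp L" "Y i \<ge> 2" using Y_ge[of i] y0_ge eL by linarith+
      have incr: "Psi x y - Psi x (Y i) \<le> 2 / c * (Psi x y / L\<^sup>2)"
      proof -
        have "Psi x y - Psi x (Y i) \<le> (y - Y i + 1) * Psi (x / Y i) y"
          using i Yi x by (intro Psi_increment_le) auto
        also have "\<dots> \<le> (\<delta> * Y i + 1) * (ln x / (c * Y i) * Psi x y)"
          using i Yi x by (intro mult_mono Psi_step) (auto simp: algebra_simps intro!: add_nonneg_nonneg)
        also have "\<dots> = (\<delta> * l + l / Y i) * (1 / c) * Psi x y"
          using Yi c_pos by (simp add: l_def field_simps)
        also have "\<dots> \<le> (1 / L\<^sup>2 + 1 / L\<^sup>2) * (1 / c) * Psi x y"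
        proof (intro mult_right_mono add_mono)
          show "\<delta> * l \<le> 1 / L\<^sup>2" using l0 by (simp add: \<delta>_def)
          have "l * L\<^sup>2 \<le> Y i"
          proof -
            have "1 * (l * L\<^sup>2) \<le> exp L * (l * L ^ 5)"
              using L0 l0 by (intro mult_mono power_increasing) auto
            also have "\<dots> = y0" by (simp add: y0_def l_def)
            also note Y_ge[of i]
            finally show ?thesis by simp
          qed
          thus "l / Y i \<le> 1 / L\<^sup>2" using L0 Yi by (simp add: field_simps)
        qed (use c_pos in auto)
        finally show ?thesis by (simp add: mult_ac)
      qed
      have "C1 * Psi x (Y i) / L\<^sup>2 < norm (rough_sum x (Y i) \<xi>)"
      proof -
        have "norm (rough_sum x y \<xi>) \<le>
            norm (rough_sum x (Y i) \<xi>) + norm (Psi_sum x y \<xi> - Psi_sum x (Y i) \<xi>)"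
          using norm_triangle_ineq4[of "rough_sum x (Y i) \<xi>" "Psi_sum x y \<xi> - Psi_sum x (Y i) \<xi>"]
          by simp
        moreover have "norm (Psi_sum x y \<xi> - Psi_sum x (Y i) \<xi>) \<le> Psi x y - Psi x (Y i)"
          by (rule norm_Psi_sum_diff_le[OF \<xi> i(1)])
        moreover have "C1 * Psi x (Y i) / L\<^sup>2 \<le> C1 * (Psi x y / L\<^sup>2)"
          using C1 i(1) by (simp add: divide_right_mono Psi_mono)
        moreover have "(C1 + 2 / c) * (Psi x y / L\<^sup>2) = C1 * (Psi x y / L\<^sup>2) + 2 / c * (Psi x y / L\<^sup>2)"
          by (rule distrib_right)
        ultimately show ?thesis using bad incr by linarith
      qed
      thus "\<xi> \<in> (\<Union>i\<in>{..N}. F (Y i))" using \<open>i \<le> N\<close> \<xi> by (auto simp: F_def)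
    qed
    have "card Bad \<le> card (\<Union>i\<in>{..N}. F (Y i))" using finF sub by (intro card_mono) auto
    also have "\<dots> \<le> (\<Sum>i\<in>{..N}. card (F (Y i)))" by (rule card_UN_le) simp
    finally have "real (card Bad) \<le> (\<Sum>i\<in>{..N}. real (card (F (Y i))))"
      by (simp flip: of_nat_sum)
    also have "\<dots> \<le> (\<Sum>i\<in>{..N}. real q * exp (- 2 * real k - 4 * L))"
      unfolding F_def
    proof (intro sum_mono few_characters_far_from_smooth_sum_at)
      show "exp L * ln x * L ^ 5 \<le> Y i" for i using Y_ge[of i] by (simp add: y0_def)
    qed (use q x1 lL lq k L in \<open>auto simp: l_def\<close>)
    also have "\<dots> = (real N + 1) * (real q * exp (- 2 * real k - 4 * L))" by simp
    also have "\<dots> \<le> exp (4 * L) * (real q * exp (- 2 * real k - 4 * L))"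
    proof (intro mult_right_mono)
      have "real N \<le> 2 * l\<^sup>2 * L\<^sup>2" using l0 by (simp add: N_def)
      also have "\<dots> \<le> 2 * (exp L)\<^sup>2 * L\<^sup>2" using lq l0 by (intro mult_right_mono mult_left_mono power_mono) auto
      finally show "real N + 1 \<le> exp (4 * L)" using L(6) by linarith
    qed auto
    also have "\<dots> = real q * exp (- 2 * real k)" by (simp flip: exp_add)
    also have "\<dots> \<le> real q * exp (- (exp L / l))"
    proof (intro mult_left_mono)
      have "exp L / l \<le> 2 * real k" using k(3) l0 by (simp add: divide_le_eq)
      thus "exp (- 2 * real k) \<le> exp (- (exp L / l))" by simp
    qed auto
    also have "\<dots> = real q powr (1 - 1 / ln x)"
      using q Lq powr_one_minus[of "real q" "1 / ln x"] by (simp add: l_def)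
    finally show ?thesis using x1 by (simp add: Bad_def)
  qed
qed

end

text \<open>As x decreases to 1 the exponent 1 - 1 / ln x tends to minus infinity, so the first
  bound is read as 0 at x = 1: no exceptional characters.\<close>

theorem theorem1:
  shows "\<exists>C>0. \<exists>q0. \<forall>q\<ge>q0. \<forall>x::real. 1 \<le> x \<and> x \<le> real q \<longrightarrow>
    real (card {\<xi> \<in> dirichlet_characters q.
        \<not> (\<forall>y::real. y \<ge> ln (real q) * ln x * ln (ln (real q)) ^ 5 \<longrightarrow>
             norm ((\<Sum>n = 1..nat \<lfloor>x\<rfloor>. \<xi> n) - Psi_sum x y \<xi>)
               \<le> C * (Psi x y / ln (ln (real q)) ^ 2))})
      \<le> (if x = 1 then 0 else real q powr (1 - 1 / ln x)) \<and>
    real (card {\<xi> \<in> dirichlet_characters q.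
        \<not> norm (\<Sum>n = 1..nat \<lfloor>x\<rfloor>. \<xi> n)
             \<le> Psi x ((ln (real q) + ln x ^ 2) * ln (ln (real q)) ^ 5)})
      \<le> real q powr (1 - 1 / ln (ln (real q)) ^ 2)"
proof -
  obtain c K where "c > 0" "c \<le> 1" "K \<ge> 2" "\<And>z. z \<ge> 2 \<Longrightarrow> theta z \<ge> c * z"
    "\<And>d. d \<ge> 2 \<Longrightarrow> (\<Sum>p\<in>primes_in (d / K) d. ln (real p)) \<ge> c * d"
    by (rule primes_in_window) blast
  then interpret prime_windows c K by unfold_locales
  define c6 where "c6 = c / (36 * C4 * ln K)"
  have c6: "c6 > 0" using c_pos C4_pos K_ge by (simp add: c6_def)
  have C1: "C1 + 2 / c > 0" using A_ge_1 c_pos by (simp add: C1_def add_pos_pos)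
  \<comment> \<open>All conditions on the size of q are put on L = ln ln q alone, each valid for
    large L; x and y do not enter, so q0 is uniform in them.\<close>
  define good where "good L \<longleftrightarrow> L \<ge> 6 \<and> L \<ge> 5 / c \<and> L \<ge> 8 * A \<and> L \<ge> 4 * (3 * exp 3 / c\<^sup>2)\<^sup>2 \<and>
      L \<ge> 3 * exp 3 / c\<^sup>2 \<and> 2 * L ^ 5 \<le> exp L \<and> ln L \<ge> 4 * ln K \<and> c6 * ln L \<ge> A * exp 3 + 2 \<and>
      L ^ 5 \<le> exp L \<and> 2 * \<sigma>\<^sub>0 \<le> exp L \<and> A * exp (- (exp L / (80 * L\<^sup>2))) \<le> exp (- 4 * L) \<and>
      2 * (exp L)\<^sup>2 * L\<^sup>2 + 1 \<le> exp (4 * L)" for L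
  define R where "R C q \<longleftrightarrow> (\<forall>x::real. 1 \<le> x \<and> x \<le> real q \<longrightarrow>
    real (card {\<xi> \<in> dirichlet_characters q.
        \<not> (\<forall>y::real. y \<ge> ln (real q) * ln x * ln (ln (real q)) ^ 5 \<longrightarrow>
             norm (rough_sum x y \<xi>) \<le> C * (Psi x y / ln (ln (real q)) ^ 2))})
      \<le> (if x = 1 then 0 else real q powr (1 - 1 / ln x)) \<and>
    real (card {\<xi> \<in> dirichlet_characters q.
        \<not> norm (\<Sum>n = 1..nat \<lfloor>x\<rfloor>. \<xi> n)
             \<le> Psi x ((ln (real q) + ln x ^ 2) * ln (ln (real q)) ^ 5)})
      \<le> real q powr (1 - 1 / ln (ln (real q)) ^ 2))" for C q
  have "eventually good at_top"
    unfolding good_def using c6 A_ge_1 by (intro eventually_conj eventually_ge_at_top; real_asymp)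
  moreover have "filterlim (\<lambda>q::nat. ln (ln (real q))) at_top at_top" by real_asymp
  ultimately have "eventually (\<lambda>q::nat. good (ln (ln (real q)))) at_top"
    by (rule eventually_compose_filterlim)
  moreover have "eventually (\<lambda>q::nat. ln (real q) > 0) at_top" by real_asymp
  moreover have "eventually (\<lambda>q::nat. q \<ge> 2) at_top" by (rule eventually_ge_at_top)
  ultimately have "eventually (R (C1 + 2 / c)) at_top"
  proof eventually_elim
    case (elim q)
    define L where "L = ln (ln (real q))"
    have Lq: "ln (real q) = exp L" using elim by (simp add: L_def)
    note LL = elim(1)[folded L_def, unfolded good_def]
    show ?case unfolding R_def L_def[symmetric] unfolding Lq
    proof (intro allI impI conjI)
      fix x :: real assume x: "1 \<le> x \<and> x \<le> real q"
      show "real (card {\<xi> \<in> dirichlet_characters q.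
        \<not> (\<forall>y::real. y \<ge> exp L * ln x * L ^ 5 \<longrightarrow>
             norm (rough_sum x y \<xi>) \<le> (C1 + 2 / c) * (Psi x y / L ^ 2))})
        \<le> (if x = 1 then 0 else real q powr (1 - 1 / ln x))"
        using x LL elim by (intro few_characters_far_from_smooth_sum Lq) auto
      show "real (card {\<xi> \<in> dirichlet_characters q.
        \<not> norm (\<Sum>n = 1..nat \<lfloor>x\<rfloor>. \<xi> n) \<le> Psi x ((exp L + ln x ^ 2) * L ^ 5)})
        \<le> real q powr (1 - 1 / L ^ 2)"
        using x LL elim by (intro few_characters_exceed_Psi Lq) (auto simp: c6_def)
    qed
  qed
  hence "\<exists>q0. \<forall>q\<ge>q0. R (C1 + 2 / c) q" by (simp add: eventually_at_top_linorder)
  with C1 show ?thesis unfolding R_def by blast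
qed

end
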